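(* Let $V\subset\Omega'\subset\overline{\Omega'}\subset\Omega$ with $V,\Omega'$ open, and let $u_1,u_2\in N^{1,q}(\Omega)$ be $(p,q)$-minimizers on $\Omega$. If $u_2\le u_1$ $q$-q.e. in $\overline{\Omega'}\setminus V$, then $u_2\le u_1$ $q$-q.e. in $V$.
   Context: Setting. $(X,d,\mu)$ is a complete metric space with a Borel regular measure $\mu$ that is doubling: $0<\mu(B(y,2\rho))\le C_d\,\mu(B(y,\rho))<\infty$ for all $y\in X$, $\rho>0$. $Q>0$ is an exponent (it may be enlarged so that $Q>p$) with $\mu(B(y,\rho))/\mu(B(x,R))\ge C(\rho/R)^Q$ for $0<\rho\le R$, $x\in X$, $y\in B(x,R)$. For $1\le\kappa<\infty$, $X$ supports a weak $(1,\kappa)$-Poincaré inequality if there are $C_{PI}>0$ and $\lambda\ge1$ with $\frac{1}{\mu(B(y,r))}\int_{B(y,r)}|u-u_{B(y,r)}|\,d\mu\le C_{PI}\,r\big(\frac{1}{\mu(B(y,\lambda r))}\int_{B(y,\lambda r)}g_u^\kappa\,d\mu\big)^{1/\kappa}$ for all balls and all $u\in L^1_{loc}(X)$, where $u_B$ is the mean value of $u$ on $B$. It is assumed that $X$ supports a weak $(1,p)$-Poincaré inequality and $1<p<q<p^*=Qp/(Q-p)$. The functions $a,b:X\to\mathbb{R}$ are measurable with $0<\alpha\le a,b\le\beta$. $\Omega\subset X$ is a bounded domain with $\mu(X\setminus\Omega)>0$. Function spaces. $g_u$ denotes the minimal $q$-weak upper gradient of $u$: the $\mu$-a.e. smallest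 Borel $g\ge0$ with $|u(x)-u(y)|\le\int_\gamma g\,ds$ for all compact rectifiable paths $\gamma$ joining $x$ to $y$ outside a family of zero $q$-modulus (the integral being $+\infty$ if $u(x)$ or $u(y)$ is infinite). $N^{1,q}(\Omega)$ is the set of $u\in L^q(\Omega)$ with $g_u\in L^q(\Omega)$; $N^{1,q}_0(\Omega)$ is the set of restrictions to $\Omega$ of $u\in N^{1,q}(X)$ with $u=0$ in $X\setminus\Omega$. The $q$-capacity of $E\subset X$ is $\mathrm{C}_q(E)=\inf_u\big(\int_X|u|^q\,d\mu+\int_Xg_u^q\,d\mu\big)$, the infimum being over $u\in N^{1,q}(X)$ with $u=1$ on $E$; a property holds $q$-q.e. if it holds outside a set of zero $q$-capacity. Minimizers. $u\in N^{1,q}(\Omega)$ is a (global) $(p,q)$-minimizer on $\Omega$ if $\int_\Omega ag_u^p\,d\mu+\int_\Omega bg_u^q\,d\mu\le\int_\Omega ag_v^p\,d\mu+\int_\Omega bg_v^q\,d\mu$ for all $v\in N^{1,q}(\Omega)$ with $u-v\in N^{1,q}_0(\Omega)$. *)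

theory Defs
  imports "HOL-Analysis.Analysis"
begin

text \<open>
  Conventions. The measure is given as a measure \<open>M\<close> on the Borel sets; the measurable sets of the
  Borel regular outer measure that it generates are those of \<^term>\<open>completion M\<close>, and functions
  are measurable with respect to the latter. Functions are extended real valued and defined pointwise
  (not modulo null sets). A function on a subset \<open>A\<close> of the space is represented by a total function
  whose values outside \<open>A\<close> are irrelevant.
\<close>

text \<open>Real powers of extended nonnegative numbers, for positive exponents.\<close>

definition epowr :: "ennreal \<Rightarrow> real \<Rightarrow> ennreal" where
  "epowr x r = (if x = \<infinity> then \<infinity> else ennreal (enn2real x powr r))"

definition doubling_measure :: "'a::metric_space measure \<Rightarrow> bool" where
  "doubling_measure M \<longleftrightarrow> sets M = sets borel \<and>
     (\<exists>C::real. \<forall>y r. 0 < r \<longrightarrow>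
        0 < emeasure M (ball y (2 * r)) \<and>
        emeasure M (ball y (2 * r)) \<le> ennreal C * emeasure M (ball y r) \<and>
        ennreal C * emeasure M (ball y r) < \<infinity>)"

definition dimension_exponent :: "real \<Rightarrow> 'a::metric_space measure \<Rightarrow> bool" where
  "dimension_exponent Q M \<longleftrightarrow> 0 < Q \<and>
     (\<exists>C>0. \<forall>x y \<rho> R. 0 < \<rho> \<and> \<rho> \<le> R \<and> y \<in> ball x R \<longrightarrow>
        measure M (ball y \<rho>) / measure M (ball x R) \<ge> C * (\<rho> / R) powr Q)"

definition Lspace :: "real \<Rightarrow> 'a::metric_space measure \<Rightarrow> 'a set \<Rightarrow> ('a \<Rightarrow> ereal) set" where
  "Lspace r M A = {u. u \<in> borel_measurable (restrict_space (completion M) A) \<and>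
     (\<integral>\<^sup>+x\<in>A. epowr (e2ennreal \<bar>u x\<bar>) r \<partial>completion M) < \<infinity>}"

definition Lspace_loc :: "real \<Rightarrow> 'a::metric_space measure \<Rightarrow> 'a set \<Rightarrow> ('a \<Rightarrow> ereal) set" where
  "Lspace_loc r M A = {u. \<forall>x\<in>A. \<exists>\<delta>>0. u \<in> Lspace r M (A \<inter> ball x \<delta>)}"

text \<open>Length of the restriction of \<open>\<gamma>\<close> to \<open>[s, t]\<close>: supremum over the finite increasing
  sequences of parameters.\<close>

definition curve_length :: "(real \<Rightarrow> 'a::metric_space) \<Rightarrow> real \<Rightarrow> real \<Rightarrow> ennreal" where
  "curve_length \<gamma> s t =
     (SUP (n, \<tau>) \<in> {(n :: nat, \<tau> :: nat \<Rightarrow> real). mono_on {..n} \<tau> \<and> \<tau> ` {..n} \<subseteq> {s..t}}.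
        \<Sum>i<n. ennreal (dist (\<gamma> (\<tau> i)) (\<gamma> (\<tau> (Suc i)))))"

text \<open>Nonconstant compact rectifiable paths in \<open>A\<close>. Constant paths have to be left out, as usual:
  no function is admissible for a constant path, so a family containing one has infinite modulus.\<close>

definition curves_in :: "'a::metric_space set \<Rightarrow> (real \<Rightarrow> 'a) set" where
  "curves_in A = {\<gamma>. path \<gamma> \<and> path_image \<gamma> \<subseteq> A \<and>
     0 < curve_length \<gamma> 0 1 \<and> curve_length \<gamma> 0 1 < \<infinity>}"

text \<open>Arc length parametrization, on \<open>[0, length of \<gamma>]\<close>. All parameters \<open>t\<close> at which the length
  of \<open>\<gamma>\<close> up to \<open>t\<close> equals \<open>s\<close> give the same point, so the choice does not matter.\<close>

definition arc_param :: "(real \<Rightarrow> 'a::metric_space) \<Rightarrow> real \<Rightarrow> 'a" where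
  "arc_param \<gamma> s = \<gamma> (SOME t. t \<in> {0..1} \<and> curve_length \<gamma> 0 t = ennreal s)"

definition line_integral :: "('a::metric_space \<Rightarrow> ennreal) \<Rightarrow> (real \<Rightarrow> 'a) \<Rightarrow> ennreal" where
  "line_integral g \<gamma> =
     (\<integral>\<^sup>+s\<in>{0..enn2real (curve_length \<gamma> 0 1)}. g (arc_param \<gamma> s) \<partial>lborel)"

definition modulus :: "real \<Rightarrow> 'a::metric_space measure \<Rightarrow> (real \<Rightarrow> 'a) set \<Rightarrow> ennreal" where
  "modulus q M \<Gamma> =
     (INF \<rho> \<in> {\<rho> \<in> borel_measurable borel. \<forall>\<gamma>\<in>\<Gamma>. 1 \<le> line_integral \<rho> \<gamma>}.
        \<integral>\<^sup>+x. epowr (\<rho> x) q \<partial>M)"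

definition weak_upper_gradient ::
    "real \<Rightarrow> 'a::metric_space measure \<Rightarrow> 'a set \<Rightarrow> ('a \<Rightarrow> ereal) \<Rightarrow> ('a \<Rightarrow> ennreal) \<Rightarrow> bool" where
  "weak_upper_gradient q M A u g \<longleftrightarrow> g \<in> borel_measurable borel \<and>
     (\<exists>\<Gamma>. modulus q M \<Gamma> = 0 \<and>
       (\<forall>\<gamma> \<in> curves_in A - \<Gamma>.
          let x = pathstart \<gamma>; y = pathfinish \<gamma> in
          if \<bar>u x\<bar> = \<infinity> \<or> \<bar>u y\<bar> = \<infinity> then line_integral g \<gamma> = \<infinity>
          else e2ennreal \<bar>u x - u y\<bar> \<le> line_integral g \<gamma>))"

text \<open>Minimality is, as usual, among the \<open>q\<close>-weak upper gradients in \<open>L\<^sup>q\<^sub>l\<^sub>o\<^sub>c\<close>. Without an integrability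
  restriction there is in general no smallest one: on the real line, a Borel function that is not
  integrable on any interval is an upper gradient of every function, and it may be small on a
  set of positive measure.\<close>

definition minimal_wug ::
    "real \<Rightarrow> 'a::metric_space measure \<Rightarrow> 'a set \<Rightarrow> ('a \<Rightarrow> ereal) \<Rightarrow> ('a \<Rightarrow> ennreal) \<Rightarrow> bool" where
  "minimal_wug q M A u g \<longleftrightarrow>
     weak_upper_gradient q M A u g \<and> (\<lambda>x. enn2ereal (g x)) \<in> Lspace_loc q M A \<and>
     (\<forall>h. weak_upper_gradient q M A u h \<and> (\<lambda>x. enn2ereal (h x)) \<in> Lspace_loc q M A \<longrightarrow>
        (AE x in M. x \<in> A \<longrightarrow> g x \<le> h x))"

text \<open>The function \<open>g\<^sub>u\<close> on \<open>A\<close>, unique up to null sets; it is \<open>\<infinity>\<close> if \<open>u\<close> has no \<open>q\<close>-weak upper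
  gradient in \<open>L\<^sup>q\<^sub>l\<^sub>o\<^sub>c(A)\<close>.\<close>

definition grad :: "real \<Rightarrow> 'a::metric_space measure \<Rightarrow> 'a set \<Rightarrow> ('a \<Rightarrow> ereal) \<Rightarrow> 'a \<Rightarrow> ennreal" where
  "grad q M A u =
     (if \<exists>g. minimal_wug q M A u g then SOME g. minimal_wug q M A u g else (\<lambda>_. \<infinity>))"

definition mean_value :: "'a::metric_space measure \<Rightarrow> 'a set \<Rightarrow> ('a \<Rightarrow> ereal) \<Rightarrow> real" where
  "mean_value M B u = (LINT x:B|completion M. real_of_ereal (u x)) / measure M B"

text \<open>Weak \<open>(1,\<kappa>)\<close>-Poincare inequality, for minimal \<open>q\<close>-weak upper gradients.\<close>

definition weak_Poincare :: "real \<Rightarrow> real \<Rightarrow> 'a::metric_space measure \<Rightarrow> bool" where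
  "weak_Poincare q \<kappa> M \<longleftrightarrow>
     (\<exists>C>0. \<exists>l\<ge>1. \<forall>u \<in> Lspace_loc 1 M UNIV. \<forall>y. \<forall>r>0.
        (\<integral>\<^sup>+x\<in>ball y r. e2ennreal \<bar>u x - ereal (mean_value M (ball y r) u)\<bar> \<partial>completion M)
          / emeasure M (ball y r)
        \<le> ennreal (C * r) *
           epowr ((\<integral>\<^sup>+x\<in>ball y (l * r). epowr (grad q M UNIV u x) \<kappa> \<partial>M)
                   / emeasure M (ball y (l * r))) (1 / \<kappa>))"

definition N1 :: "real \<Rightarrow> 'a::metric_space measure \<Rightarrow> 'a set \<Rightarrow> ('a \<Rightarrow> ereal) set" where
  "N1 q M A = {u \<in> Lspace q M A. (\<lambda>x. enn2ereal (grad q M A u x)) \<in> Lspace q M A}"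

definition N1_0 :: "real \<Rightarrow> 'a::metric_space measure \<Rightarrow> 'a set \<Rightarrow> ('a \<Rightarrow> ereal) set" where
  "N1_0 q M A = {w. \<exists>v \<in> N1 q M UNIV. (\<forall>x\<in>A. w x = v x) \<and> (\<forall>x. x \<notin> A \<longrightarrow> v x = 0)}"

definition capacity :: "real \<Rightarrow> 'a::metric_space measure \<Rightarrow> 'a set \<Rightarrow> ennreal" where
  "capacity q M E =
     (INF u \<in> {u \<in> N1 q M UNIV. \<forall>x\<in>E. u x = 1}.
        (\<integral>\<^sup>+x. epowr (e2ennreal \<bar>u x\<bar>) q \<partial>completion M) +
        (\<integral>\<^sup>+x. epowr (grad q M UNIV u x) q \<partial>M))"

definition qe_in :: "real \<Rightarrow> 'a::metric_space measure \<Rightarrow> 'a set \<Rightarrow> ('a \<Rightarrow> bool) \<Rightarrow> bool" where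
  "qe_in q M A P \<longleftrightarrow> (\<exists>E. capacity q M E = 0 \<and> (\<forall>x \<in> A - E. P x))"

definition pq_energy ::
    "real \<Rightarrow> real \<Rightarrow> ('a::metric_space \<Rightarrow> real) \<Rightarrow> ('a \<Rightarrow> real) \<Rightarrow> 'a measure \<Rightarrow> 'a set \<Rightarrow>
     ('a \<Rightarrow> ereal) \<Rightarrow> ennreal" where
  "pq_energy p q a b M A u =
     (\<integral>\<^sup>+x\<in>A. ennreal (a x) * epowr (grad q M A u x) p \<partial>completion M) +
     (\<integral>\<^sup>+x\<in>A. ennreal (b x) * epowr (grad q M A u x) q \<partial>completion M)"

text \<open>The difference \<open>u - v\<close> is undefined (by convention \<open>\<infinity>\<close>) only at points where both \<open>u\<close> and \<open>v\<close>
  are infinite, that is, on a set of zero capacity.\<close>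

definition pq_minimizer ::
    "real \<Rightarrow> real \<Rightarrow> ('a::metric_space \<Rightarrow> real) \<Rightarrow> ('a \<Rightarrow> real) \<Rightarrow> 'a measure \<Rightarrow> 'a set \<Rightarrow>
     ('a \<Rightarrow> ereal) \<Rightarrow> bool" where
  "pq_minimizer p q a b M A u \<longleftrightarrow> u \<in> N1 q M A \<and>
     (\<forall>v \<in> N1 q M A. (\<lambda>x. u x - v x) \<in> N1_0 q M A \<longrightarrow>
        pq_energy p q a b M A u \<le> pq_energy p q a b M A v)"

end

theory Submission
  imports Defs
begin

text \<open>
  Let \<open>\<phi>\<close> be \<open>max 0 (u2 - u1)\<close> on \<open>V\<close> and \<open>0\<close> outside \<open>V\<close>. A path that leaves \<open>V\<close> crosses the boundary
  of \<open>V\<close>, where \<open>u2 \<le> u1\<close> up to a set of zero capacity, and \<open>q\<close>-almost every path avoids such a set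
  (\<open>capacity_zero_avoids\<close>). Hence \<open>\<phi>\<close> is a Newtonian function on the whole space, with the upper
  gradient \<open>g1 + g2\<close> on \<open>V\<close> and \<open>0\<close> elsewhere (\<open>weak_ug_extend_zero\<close>), where \<open>g1\<close> and \<open>g2\<close> are the
  minimal weak upper gradients of \<open>u1\<close> and \<open>u2\<close>. Let \<open>A\<close> be the set where \<open>\<phi> > 0\<close>.

  The competitor \<open>u1 + \<phi>\<close> for \<open>u1\<close> and the competitor \<open>u2 - \<phi>\<close> for \<open>u2\<close> interchange \<open>g1\<close> and \<open>g2\<close>
  on \<open>A\<close>, so \<open>g1\<close> and \<open>g2\<close> have the same energy on \<open>A\<close>. The competitor \<open>u1 + \<phi> / 2\<close> and the strict
  convexity of \<open>t \<mapsto> a t\<^sup>p + b t\<^sup>q\<close> then give \<open>g1 = g2\<close> almost everywhere on \<open>A\<close>. In the absence of a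
  linear gradient this does not yet say that \<open>\<phi>\<close> has zero gradient; but truncating \<open>u1 + \<phi>\<close> at a
  level \<open>c\<close>, that is, passing to \<open>max u1 (min (u1 + \<phi>) c)\<close>, kills the gradient where
  \<open>u1 < c < u2\<close> and does not change it elsewhere, so that minimality forces \<open>g1 = 0\<close> there. With \<open>c\<close>
  running through the rationals, \<open>g1 = g2 = 0\<close> almost everywhere on \<open>A\<close>.

  Thus \<open>\<phi>\<close> has a vanishing weak upper gradient. By the Poincare inequality it is constant almost
  everywhere, hence \<open>0\<close>, since it vanishes off \<open>\<Omega>\<close> (\<open>zero_gradient_imp_zero\<close>). As \<open>\<phi>\<close> is constant
  along \<open>q\<close>-almost every path, the indicator function of \<open>A\<close> also has a vanishing weak upper gradient,
  and therefore \<open>A\<close> has zero capacity (\<open>capacity_zero_intro\<close>).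

  The calculus of weak upper gradients behind this is reduced to functions of one real variable by
  arc length parametrization. Its core is that two upper gradients of one function can be glued
  along an arbitrary Borel set (\<open>ug_on_glue\<close>), and that the upper gradient of a function may be
  replaced by that of another function on a Borel set where the two functions agree
  (\<open>ug_on_replace\<close>). Gluing yields the lattice property, and with it the existence of the minimal weak
  upper gradient (\<open>weak_ug_minimal_exists\<close>).
\<close>

section \<open>Upper gradients on an interval\<close>

text \<open>
  \<open>h\<close> is an integrable upper gradient of \<open>f\<close> on \<open>[0, L]\<close>. The values of \<open>f\<close> and \<open>h\<close> outside this
  interval are irrelevant, except that \<open>h\<close> is Borel measurable on the whole line.
\<close>

definition ug_on :: "real \<Rightarrow> (real \<Rightarrow> real) \<Rightarrow> (real \<Rightarrow> ennreal) \<Rightarrow> bool" where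
  "ug_on L f h \<longleftrightarrow> h \<in> borel_measurable borel \<and> (\<integral>\<^sup>+x\<in>{0..L}. h x \<partial>lborel) < \<infinity> \<and>
     (\<forall>s t. 0 \<le> s \<longrightarrow> s \<le> t \<longrightarrow> t \<le> L \<longrightarrow>
        ennreal \<bar>f s - f t\<bar> \<le> (\<integral>\<^sup>+x\<in>{s..t}. h x \<partial>lborel))"

lemma ug_on_le:
  "ug_on L f h \<Longrightarrow> 0 \<le> s \<Longrightarrow> s \<le> t \<Longrightarrow> t \<le> L \<Longrightarrow>
    ennreal \<bar>f s - f t\<bar> \<le> (\<integral>\<^sup>+x\<in>{s..t}. h x \<partial>lborel)"
  by (simp add: ug_on_def)

lemma set_nn_integral_Icc_split:
  fixes h :: "real \<Rightarrow> ennreal"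
  assumes [measurable]: "h \<in> borel_measurable borel" and "s \<le> r" "r \<le> t"
  shows "(\<integral>\<^sup>+x\<in>{s..t}. h x \<partial>lborel) = (\<integral>\<^sup>+x\<in>{s..r}. h x \<partial>lborel) + (\<integral>\<^sup>+x\<in>{r..t}. h x \<partial>lborel)"
proof -
  have "AE x in lborel. x \<noteq> r" by (rule AE_lborel_singleton)
  then have "(\<integral>\<^sup>+x\<in>{s..t}. h x \<partial>lborel)
      = (\<integral>\<^sup>+x. h x * indicator {s..r} x + h x * indicator {r..t} x \<partial>lborel)"
    by (intro nn_integral_cong_AE) (use assms in \<open>auto split: split_indicator\<close>)
  also have "\<dots> = (\<integral>\<^sup>+x\<in>{s..r}. h x \<partial>lborel) + (\<integral>\<^sup>+x\<in>{r..t}. h x \<partial>lborel)"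
    by (rule nn_integral_add) auto
  finally show ?thesis .
qed

lemma set_nn_integral_mono_set:
  fixes h :: "'b \<Rightarrow> ennreal"
  shows "A \<subseteq> B \<Longrightarrow> (\<integral>\<^sup>+x\<in>A. h x \<partial>N) \<le> (\<integral>\<^sup>+x\<in>B. h x \<partial>N)"
  by (intro nn_integral_mono) (auto split: split_indicator)

lemma set_nn_integral_mono_fun:
  fixes h k :: "'b \<Rightarrow> ennreal"
  shows "(\<And>x. x \<in> A \<Longrightarrow> h x \<le> k x) \<Longrightarrow> (\<integral>\<^sup>+x\<in>A. h x \<partial>N) \<le> (\<integral>\<^sup>+x\<in>A. k x \<partial>N)"
  by (intro nn_integral_mono) (auto split: split_indicator)

lemma set_nn_integral_plus:
  fixes h k :: "real \<Rightarrow> ennreal"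
  assumes [measurable]: "h \<in> borel_measurable borel" "k \<in> borel_measurable borel"
  shows "(\<integral>\<^sup>+x\<in>{s..t}. h x + k x \<partial>lborel) = (\<integral>\<^sup>+x\<in>{s..t}. h x \<partial>lborel) + (\<integral>\<^sup>+x\<in>{s..t}. k x \<partial>lborel)"
  by (simp add: distrib_right nn_integral_add)

lemma ug_on_add:
  assumes 1: "ug_on L f1 h1" and 2: "ug_on L f2 h2"
    and le: "\<And>s t. 0 \<le> s \<Longrightarrow> s \<le> t \<Longrightarrow> t \<le> L \<Longrightarrow> \<bar>f s - f t\<bar> \<le> \<bar>f1 s - f1 t\<bar> + \<bar>f2 s - f2 t\<bar>"
  shows "ug_on L f (\<lambda>x. h1 x + h2 x)"
  unfolding ug_on_def
proof (intro conjI allI impI)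
  have m[measurable]: "h1 \<in> borel_measurable borel" "h2 \<in> borel_measurable borel"
    using 1 2 by (auto simp: ug_on_def)
  show "(\<lambda>x. h1 x + h2 x) \<in> borel_measurable borel" by simp
  show "(\<integral>\<^sup>+x\<in>{0..L}. h1 x + h2 x \<partial>lborel) < \<infinity>"
    using 1 2 by (subst set_nn_integral_plus[OF m]) (auto simp: ug_on_def)
  fix s t :: real assume st: "0 \<le> s" "s \<le> t" "t \<le> L"
  have "ennreal \<bar>f s - f t\<bar> \<le> ennreal (\<bar>f1 s - f1 t\<bar> + \<bar>f2 s - f2 t\<bar>)"
    using le[OF st] by (rule ennreal_leI)
  also have "\<dots> = ennreal \<bar>f1 s - f1 t\<bar> + ennreal \<bar>f2 s - f2 t\<bar>" by simp
  also have "\<dots> \<le> (\<integral>\<^sup>+x\<in>{s..t}. h1 x \<partial>lborel) + (\<integral>\<^sup>+x\<in>{s..t}. h2 x \<partial>lborel)"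
    by (intro add_mono ug_on_le[OF 1] ug_on_le[OF 2] st)
  also have "\<dots> = (\<integral>\<^sup>+x\<in>{s..t}. h1 x + h2 x \<partial>lborel)" by (subst set_nn_integral_plus[OF m]) auto
  finally show "ennreal \<bar>f s - f t\<bar> \<le> (\<integral>\<^sup>+x\<in>{s..t}. h1 x + h2 x \<partial>lborel)" .
qed

lemma ug_on_cmult:
  assumes 1: "ug_on L f1 h1" and c: "0 \<le> c"
    and le: "\<And>s t. 0 \<le> s \<Longrightarrow> s \<le> t \<Longrightarrow> t \<le> L \<Longrightarrow> \<bar>f s - f t\<bar> \<le> c * \<bar>f1 s - f1 t\<bar>"
  shows "ug_on L f (\<lambda>x. ennreal c * h1 x)"
  unfolding ug_on_def
proof (intro conjI allI impI)
  have m[measurable]: "h1 \<in> borel_measurable borel"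
    using 1 by (auto simp: ug_on_def)
  have *: "(\<integral>\<^sup>+x\<in>A. ennreal c * h1 x \<partial>lborel) = ennreal c * (\<integral>\<^sup>+x\<in>A. h1 x \<partial>lborel)"
    if [measurable]: "A \<in> sets borel" for A
    by (subst nn_integral_cmult[symmetric]) (auto simp: mult.assoc)
  show "(\<lambda>x. ennreal c * h1 x) \<in> borel_measurable borel" by simp
  show "(\<integral>\<^sup>+x\<in>{0..L}. ennreal c * h1 x \<partial>lborel) < \<infinity>"
    using 1 by (subst *) (auto simp: ug_on_def ennreal_mult_less_top)
  fix s t :: real assume st: "0 \<le> s" "s \<le> t" "t \<le> L"
  have "ennreal \<bar>f s - f t\<bar> \<le> ennreal (c * \<bar>f1 s - f1 t\<bar>)"
    using le[OF st] by (simp add: ennreal_leI)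
  also have "\<dots> = ennreal c * ennreal \<bar>f1 s - f1 t\<bar>" using c by (simp add: ennreal_mult)
  also have "\<dots> \<le> ennreal c * (\<integral>\<^sup>+x\<in>{s..t}. h1 x \<partial>lborel)"
    by (intro mult_left_mono ug_on_le[OF 1] st) auto
  also have "\<dots> = (\<integral>\<^sup>+x\<in>{s..t}. ennreal c * h1 x \<partial>lborel)" by (subst *) auto
  finally show "ennreal \<bar>f s - f t\<bar> \<le> (\<integral>\<^sup>+x\<in>{s..t}. ennreal c * h1 x \<partial>lborel)" .
qed

lemma ug_on_limit:
  assumes ug: "\<And>n. ug_on L f (H n)" and dom: "\<And>n x. H n x \<le> k x"
    and k[measurable]: "k \<in> borel_measurable borel" and kfin: "(\<integral>\<^sup>+x\<in>{0..L}. k x \<partial>lborel) < \<infinity>"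
    and lim: "\<And>x. (\<lambda>n. H n x) \<longlonglongrightarrow> h x"
  shows "ug_on L f h"
  unfolding ug_on_def
proof (intro conjI allI impI)
  have m[measurable]: "\<And>n. H n \<in> borel_measurable borel"
    using ug by (auto simp: ug_on_def)
  show [measurable]: "h \<in> borel_measurable borel"
    by (rule borel_measurable_LIMSEQ_order[OF lim m])
  have hk: "h x \<le> k x" for x
    by (rule LIMSEQ_le_const2[OF lim]) (use dom in auto)
  have *: "(\<lambda>n. \<integral>\<^sup>+x\<in>{s..t}. H n x \<partial>lborel) \<longlonglongrightarrow> (\<integral>\<^sup>+x\<in>{s..t}. h x \<partial>lborel)"
    if "0 \<le> s" "t \<le> L" for s t
  proof (rule nn_integral_dominated_convergence[where w="\<lambda>x. k x * indicator {0..L} x"])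
    show "AE x in lborel. (\<lambda>i. H i x * indicator {s..t} x) \<longlonglongrightarrow> h x * indicator {s..t} x"
      by (intro AE_I2) (auto split: split_indicator intro: lim)
    show "AE x in lborel. H j x * indicator {s..t} x \<le> k x * indicator {0..L} x" for j
      by (intro AE_I2) (use that dom in \<open>auto split: split_indicator\<close>)
  qed (use kfin in auto)
  show "(\<integral>\<^sup>+x\<in>{0..L}. h x \<partial>lborel) < \<infinity>"
    using set_nn_integral_mono_fun[of "{0..L}" h k lborel, OF hk] kfin by (rule le_less_trans)
  fix s t assume st: "0 \<le> s" "s \<le> t" "t \<le> L"
  show "ennreal \<bar>f s - f t\<bar> \<le> (\<integral>\<^sup>+x\<in>{s..t}. h x \<partial>lborel)"
    by (rule LIMSEQ_le_const[OF *]) (use ug st in \<open>auto simp: ug_on_def\<close>)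
qed

lemma ug_on_glue_atMost:
  assumes 1: "ug_on L f h1" and 2: "ug_on L f h2"
  shows "ug_on L f (\<lambda>x. if x \<in> {..c} then h1 x else h2 x)" (is "ug_on L f ?h")
  unfolding ug_on_def
proof (intro conjI allI impI)
  have m[measurable]: "h1 \<in> borel_measurable borel" "h2 \<in> borel_measurable borel"
    using 1 2 by (auto simp: ug_on_def)
  show hm[measurable]: "?h \<in> borel_measurable borel" by simp
  have "(\<integral>\<^sup>+x\<in>{0..L}. ?h x \<partial>lborel) \<le> (\<integral>\<^sup>+x\<in>{0..L}. h1 x + h2 x \<partial>lborel)"
    by (rule set_nn_integral_mono_fun) (auto simp: add_increasing add_increasing2)
  also have "\<dots> < \<infinity>"
    using 1 2 by (subst set_nn_integral_plus[OF m]) (auto simp: ug_on_def)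
  finally show "(\<integral>\<^sup>+x\<in>{0..L}. ?h x \<partial>lborel) < \<infinity>" .
  fix s t assume st: "0 \<le> s" "s \<le> t" "t \<le> L"
  have i1: "(\<integral>\<^sup>+x\<in>{a..b}. ?h x \<partial>lborel) = (\<integral>\<^sup>+x\<in>{a..b}. h1 x \<partial>lborel)" if "b \<le> c" for a b
    by (rule nn_integral_cong) (use that in \<open>auto split: split_indicator\<close>)
  have i2: "(\<integral>\<^sup>+x\<in>{a..b}. ?h x \<partial>lborel) = (\<integral>\<^sup>+x\<in>{a..b}. h2 x \<partial>lborel)" if "c \<le> a" for a b
  proof (rule nn_integral_cong_AE)
    have "AE x in lborel. x \<noteq> c" by (rule AE_lborel_singleton)
    then show "AE x in lborel. ?h x * indicator {a..b} x = h2 x * indicator {a..b} x"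
      by eventually_elim (use that in \<open>auto split: split_indicator\<close>)
  qed
  consider "t \<le> c" | "c \<le> s" | "s \<le> c" "c \<le> t" by linarith
  then show "ennreal \<bar>f s - f t\<bar> \<le> (\<integral>\<^sup>+x\<in>{s..t}. ?h x \<partial>lborel)"
  proof cases
    case 1
    then show ?thesis using ug_on_le[OF assms(1) st] by (simp only: i1)
  next
    case 2
    then show ?thesis using ug_on_le[OF assms(2) st] by (simp only: i2)
  next
    case 3
    have "ennreal \<bar>f s - f t\<bar> \<le> ennreal (\<bar>f s - f c\<bar> + \<bar>f c - f t\<bar>)" by (intro ennreal_leI) simp
    also have "\<dots> = ennreal \<bar>f s - f c\<bar> + ennreal \<bar>f c - f t\<bar>" by simp
    also have "\<dots> \<le> (\<integral>\<^sup>+x\<in>{s..c}. ?h x \<partial>lborel) + (\<integral>\<^sup>+x\<in>{c..t}. ?h x \<partial>lborel)"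
      unfolding i1[OF order_refl] i2[OF order_refl]
      using st 3 by (intro add_mono ug_on_le[OF assms(1)] ug_on_le[OF assms(2)]) auto
    also have "\<dots> = (\<integral>\<^sup>+x\<in>{s..t}. ?h x \<partial>lborel)"
      using set_nn_integral_Icc_split[OF hm 3] by simp
    finally show ?thesis .
  qed
qed

text \<open>
  The Borel sets along which any two upper gradients of \<open>f\<close> can be glued form a \<open>\<sigma>\<close>-algebra: finite
  unions are obtained by gluing twice, countable unions by dominated convergence. It contains the
  half-lines by additivity of the integral.
\<close>

lemma ug_on_glue:
  assumes B: "B \<in> sets borel" and "ug_on L f h1" and "ug_on L f h2"
  shows "ug_on L f (\<lambda>x. if x \<in> B then h1 x else h2 x)"
proof -
  have "B \<in> sigma_sets UNIV (range (\<lambda>a::real. {..a}))"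
    using B unfolding borel_eq_atMost by simp
  then show ?thesis using assms(2,3)
  proof (induction arbitrary: h1 h2)
    case (Basic a)
    then show ?case using ug_on_glue_atMost by auto
  next
    case Empty
    then show ?case by simp
  next
    case (Compl a)
    have "ug_on L f (\<lambda>x. if x \<in> a then h2 x else h1 x)" by (rule Compl.IH) (use Compl in auto)
    moreover have "(\<lambda>x. if x \<in> UNIV - a then h1 x else h2 x) = (\<lambda>x. if x \<in> a then h2 x else h1 x)"
      by auto
    ultimately show ?case by simp
  next
    case (Union a)
    have fin: "ug_on L f (\<lambda>x. if x \<in> (\<Union>i<n. a i) then h1 x else h2 x)" for n :: nat
    proof (induction n)
      case 0
      then show ?case using Union.prems by simp
    next
      case (Suc n)
      have "ug_on L f (\<lambda>x. if x \<in> a n then h1 x else (if x \<in> (\<Union>i<n. a i) then h1 x else h2 x))"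
        by (rule Union.IH[OF Union.prems(1) Suc])
      moreover have "(\<lambda>x. if x \<in> a n then h1 x else (if x \<in> (\<Union>i<n. a i) then h1 x else h2 x)) =
          (\<lambda>x. if x \<in> (\<Union>i<Suc n. a i) then h1 x else h2 x)"
        by (auto simp: fun_eq_iff lessThan_Suc)
      ultimately show ?case by simp
    qed
    have m[measurable]: "h1 \<in> borel_measurable borel" "h2 \<in> borel_measurable borel"
      using Union.prems by (auto simp: ug_on_def)
    show ?case
    proof (rule ug_on_limit[OF fin, where k="\<lambda>x. h1 x + h2 x"])
      show "(\<integral>\<^sup>+x\<in>{0..L}. h1 x + h2 x \<partial>lborel) < \<infinity>"
        using Union.prems by (subst set_nn_integral_plus[OF m]) (auto simp: ug_on_def)
      fix x
      show "(\<lambda>n. if x \<in> (\<Union>i<n. a i) then h1 x else h2 x) \<longlonglongrightarrow> (if x \<in> \<Union> (range a) then h1 x else h2 x)"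
      proof (rule tendsto_eventually)
        show "\<forall>\<^sub>F n in sequentially. (if x \<in> (\<Union>i<n. a i) then h1 x else h2 x)
            = (if x \<in> \<Union> (range a) then h1 x else h2 x)"
        proof (cases "x \<in> \<Union> (range a)")
          case True
          then obtain i where "x \<in> a i" by auto
          then show ?thesis using True by (intro eventually_sequentiallyI[of "Suc i"]) auto
        next
          case False
          then show ?thesis by auto
        qed
      qed
    qed (auto simp: add_increasing add_increasing2)
  qed
qed

lemma ug_on_min:
  assumes "ug_on L f h1" and "ug_on L f h2"
  shows "ug_on L f (\<lambda>x. min (h1 x) (h2 x))"
proof -
  have [measurable]: "h1 \<in> borel_measurable borel" "h2 \<in> borel_measurable borel"
    using assms by (auto simp: ug_on_def)
  have "ug_on L f (\<lambda>x. if x \<in> {x. h1 x \<le> h2 x} then h1 x else h2 x)"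
    by (rule ug_on_glue) (use assms in auto)
  then show ?thesis by (simp add: min_def)
qed

lemma ug_on_cong:
  assumes "ug_on L f h" "\<And>x. 0 \<le> x \<Longrightarrow> x \<le> L \<Longrightarrow> f x = f' x"
  shows "ug_on L f' h"
  using assms unfolding ug_on_def by (auto dest: order_trans)

lemma ug_on_const: "ug_on L (\<lambda>_. c) (\<lambda>_. 0)"
  by (simp add: ug_on_def)

lemma ug_on_continuous:
  assumes "ug_on L f h"
  shows "continuous_on {0..L} f"
  unfolding continuous_on_sequentially
proof (intro allI ballI impI)
  have [measurable]: "h \<in> borel_measurable borel" and hfin: "(\<integral>\<^sup>+x\<in>{0..L}. h x \<partial>lborel) < \<infinity>"
    using assms by (auto simp: ug_on_def)
  fix X a assume a: "a \<in> {0..L}" and X: "(\<forall>n. X n \<in> {0..L}) \<and> X \<longlonglongrightarrow> a"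
  define I where "I n = (\<integral>\<^sup>+x\<in>{min a (X n)..max a (X n)}. h x \<partial>lborel)" for n
  have "I \<longlonglongrightarrow> integral\<^sup>N lborel (\<lambda>_::real. 0::ennreal)" unfolding I_def
  proof (rule nn_integral_dominated_convergence[where w="\<lambda>x. h x * indicator {0..L} x"])
    have "AE x in lborel. x \<noteq> a" by (rule AE_lborel_singleton)
    then show "AE x in lborel. (\<lambda>n. h x * indicator {min a (X n)..max a (X n)} x) \<longlonglongrightarrow> 0"
    proof eventually_elim
      case (elim x)
      then have "eventually (\<lambda>n. dist (X n) a < \<bar>x - a\<bar>) sequentially"
        using X by (intro tendstoD) auto
      then have "eventually (\<lambda>n. h x * indicator {min a (X n)..max a (X n)} x = 0) sequentially"
        by eventually_elim (auto simp: dist_real_def split: split_indicator)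
      then show ?case by (rule tendsto_eventually)
    qed
    show "AE x in lborel. h x * indicator {min a (X j)..max a (X j)} x \<le> h x * indicator {0..L} x" for j
      using X a by (intro AE_I2) (auto split: split_indicator simp: min_def max_def split: if_splits
          dest: spec[of _ j])
  qed (use hfin in auto)
  then have I0: "I \<longlonglongrightarrow> 0" by simp
  have le: "ennreal (dist (f (X n)) (f a)) \<le> I n" for n
  proof (cases "a \<le> X n")
    case True
    then have "ennreal \<bar>f a - f (X n)\<bar> \<le> I n" unfolding I_def
      using ug_on_le[OF assms, of a "X n"] a X by (auto simp: min_absorb1 max_absorb2)
    then show ?thesis by (simp add: dist_real_def abs_minus_commute)
  next
    case False
    then have "ennreal \<bar>f (X n) - f a\<bar> \<le> I n" unfolding I_def
      using ug_on_le[OF assms, of "X n" a] a X by (auto simp: min_absorb2 max_absorb1)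
    then show ?thesis by (simp add: dist_real_def)
  qed
  have "(\<lambda>n. ennreal (dist (f (X n)) (f a))) \<longlonglongrightarrow> ennreal 0"
    using tendsto_sandwich[OF _ _ tendsto_const I0, of "\<lambda>n. ennreal (dist (f (X n)) (f a))"] le by simp
  then have "(\<lambda>n. dist (f (X n)) (f a)) \<longlonglongrightarrow> 0"
    by (subst (asm) tendsto_ennreal_iff) auto
  then show "(f \<circ> X) \<longlonglongrightarrow> f a" by (subst tendsto_dist_iff) (simp add: o_def)
qed

text \<open>
  An interval that meets the closed set \<open>Z\<close> of zeros of \<open>d\<close> contains a first and a last point of \<open>Z\<close>,
  and the part between them does not contribute to the increment of \<open>d\<close>. So only intervals
  without points of \<open>Z\<close> in their interior need to be examined.
\<close>

lemma ug_on_zero_set: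
  assumes Z: "closed Z" and zero: "\<And>x. x \<in> Z \<Longrightarrow> x \<in> {0..L} \<Longrightarrow> d x = 0"
    and hm: "h \<in> borel_measurable borel" and hfin: "(\<integral>\<^sup>+x\<in>{0..L}. h x \<partial>lborel) < \<infinity>"
    and off: "\<And>a b. 0 \<le> a \<Longrightarrow> a \<le> b \<Longrightarrow> b \<le> L \<Longrightarrow> (\<And>x. a < x \<Longrightarrow> x < b \<Longrightarrow> x \<notin> Z) \<Longrightarrow>
      ennreal \<bar>d a - d b\<bar> \<le> (\<integral>\<^sup>+x\<in>{a..b}. h x \<partial>lborel)"
  shows "ug_on L d h"
  unfolding ug_on_def
proof (intro conjI allI impI hm hfin)
  fix s t assume st: "0 \<le> s" "s \<le> t" "t \<le> L"
  show "ennreal \<bar>d s - d t\<bar> \<le> (\<integral>\<^sup>+x\<in>{s..t}. h x \<partial>lborel)"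
  proof (cases "Z \<inter> {s..t} = {}")
    case True
    then show ?thesis by (intro off st) auto
  next
    case False
    define D where "D = Z \<inter> {s..t}"
    have cD: "closed D" using Z by (simp add: D_def closed_Int)
    have D0: "D \<noteq> {}" using False by (simp add: D_def)
    have bb: "bdd_below D" "bdd_above D" unfolding D_def by (auto intro: bdd_belowI bdd_aboveI)
    have inf: "Inf D \<in> D" using D0 bb(1) cD by (rule closed_contains_Inf)
    have sup: "Sup D \<in> D" using D0 bb(2) cD by (rule closed_contains_Sup)
    have le: "Inf D \<le> Sup D" using inf bb by (meson cSup_upper)
    have 1: "ennreal \<bar>d s - d (Inf D)\<bar> \<le> (\<integral>\<^sup>+x\<in>{s..Inf D}. h x \<partial>lborel)"
    proof (rule off)
      fix x assume "s < x" "x < Inf D"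
      then show "x \<notin> Z" using cInf_lower[OF _ bb(1), of x] inf by (auto simp: D_def)
    qed (use inf st in \<open>auto simp: D_def\<close>)
    have 2: "ennreal \<bar>d (Sup D) - d t\<bar> \<le> (\<integral>\<^sup>+x\<in>{Sup D..t}. h x \<partial>lborel)"
    proof (rule off)
      fix x assume "Sup D < x" "x < t"
      then show "x \<notin> Z" using cSup_upper[OF _ bb(2), of x] sup by (auto simp: D_def)
    qed (use sup st in \<open>auto simp: D_def\<close>)
    have z: "d (Inf D) = 0" "d (Sup D) = 0" using inf sup st by (auto simp: D_def intro: zero)
    have "ennreal \<bar>d s - d t\<bar> \<le> ennreal (\<bar>d s - d (Inf D)\<bar> + \<bar>d (Sup D) - d t\<bar>)"
      using z by (intro ennreal_leI) simp
    also have "\<dots> = ennreal \<bar>d s - d (Inf D)\<bar> + ennreal \<bar>d (Sup D) - d t\<bar>" by simp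
    also have "\<dots> \<le> (\<integral>\<^sup>+x\<in>{s..Inf D}. h x \<partial>lborel) + (\<integral>\<^sup>+x\<in>{Sup D..t}. h x \<partial>lborel)"
      using 1 2 by (rule add_mono)
    also have "\<dots> \<le> (\<integral>\<^sup>+x\<in>{s..Inf D}. h x \<partial>lborel) + (\<integral>\<^sup>+x\<in>{Inf D..t}. h x \<partial>lborel)"
      using le by (intro add_left_mono set_nn_integral_mono_set) auto
    also have "\<dots> = (\<integral>\<^sup>+x\<in>{s..t}. h x \<partial>lborel)"
      by (rule set_nn_integral_Icc_split[OF hm, symmetric]) (use inf in \<open>auto simp: D_def\<close>)
    finally show ?thesis .
  qed
qed

lemma ug_on_vanish:
  assumes ug: "ug_on L d k"
  defines "C \<equiv> {x\<in>{0..L}. d x = 0}"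
  shows "ug_on L d (\<lambda>x. if x \<in> C then 0 else k x)" (is "ug_on L d ?h")
proof -
  have [measurable]: "k \<in> borel_measurable borel" and kfin: "(\<integral>\<^sup>+x\<in>{0..L}. k x \<partial>lborel) < \<infinity>"
    using ug by (auto simp: ug_on_def)
  have C: "closed C" unfolding C_def
    by (rule continuous_closed_preimage_constant[OF ug_on_continuous[OF ug]]) auto
  then have [measurable]: "C \<in> sets borel" by auto
  show "ug_on L d ?h"
  proof (rule ug_on_zero_set[OF C])
    show "?h \<in> borel_measurable borel" by measurable
    show "(\<integral>\<^sup>+x\<in>{0..L}. ?h x \<partial>lborel) < \<infinity>"
      by (rule le_less_trans[OF set_nn_integral_mono_fun kfin]) auto
    fix a b assume ab: "0 \<le> a" "a \<le> b" "b \<le> L" and n: "\<And>x. a < x \<Longrightarrow> x < b \<Longrightarrow> x \<notin> C"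
    have "AE x in lborel. x \<noteq> a" "AE x in lborel. x \<noteq> b" by (rule AE_lborel_singleton)+
    then have "AE x in lborel. k x * indicator {a..b} x = ?h x * indicator {a..b} x"
      by eventually_elim (use n in \<open>auto split: split_indicator\<close>)
    then have "(\<integral>\<^sup>+x\<in>{a..b}. k x \<partial>lborel) = (\<integral>\<^sup>+x\<in>{a..b}. ?h x \<partial>lborel)" by (rule nn_integral_cong_AE)
    then show "ennreal \<bar>d a - d b\<bar> \<le> (\<integral>\<^sup>+x\<in>{a..b}. ?h x \<partial>lborel)" using ug_on_le[OF ug ab] by simp
  qed (auto simp: C_def)
qed

text \<open>
  The difference \<open>f - f1\<close> has an upper gradient that vanishes on its zero set, and the sum of this
  upper gradient and \<open>h\<close> is an upper gradient of \<open>f\<close> that equals \<open>h\<close> on \<open>C\<close>.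
\<close>

lemma ug_on_replace:
  assumes f: "ug_on L f k" and f1: "ug_on L f1 h" and C: "C \<in> sets borel"
    and eq: "\<And>x. x \<in> C \<Longrightarrow> x \<in> {0..L} \<Longrightarrow> f x = f1 x"
  shows "ug_on L f (\<lambda>x. if x \<in> C then h x else k x)"
proof -
  define d where "d x = f x - f1 x" for x
  define E where "E = {x\<in>{0..L}. d x = 0}"
  have d: "ug_on L d (\<lambda>x. k x + h x)"
    by (rule ug_on_add[OF f f1]) (auto simp: d_def)
  note v = ug_on_vanish[OF d, folded E_def]
  have "ug_on L f (\<lambda>x. h x + (if x \<in> E then 0 else k x + h x))"
    by (rule ug_on_add[OF f1 v]) (auto simp: d_def)
  then have "ug_on L f (\<lambda>x. if x \<in> C \<inter> {0..L} then h x + (if x \<in> E then 0 else k x + h x) else k x)"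
    using C by (intro ug_on_glue f) auto
  moreover have "(\<lambda>x. if x \<in> C \<inter> {0..L} then h x + (if x \<in> E then 0 else k x + h x) else k x) = (\<lambda>x.
    if x \<in> C \<inter> {0..L} then h x else k x)"
    using eq by (auto simp: fun_eq_iff E_def d_def)
  ultimately have 1: "ug_on L f (\<lambda>x. if x \<in> C \<inter> {0..L} then h x else k x)" by simp
  have [measurable]: "h \<in> borel_measurable borel" "k \<in> borel_measurable borel" "C \<in> sets borel"
    using f f1 C by (auto simp: ug_on_def)
  have e: "(\<integral>\<^sup>+x\<in>{s..t}. (if x \<in> C then h x else k x) \<partial>lborel)
      = (\<integral>\<^sup>+x\<in>{s..t}. (if x \<in> C \<inter> {0..L} then h x else k x) \<partial>lborel)"
    if "0 \<le> s" "t \<le> L" for s t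
    by (rule nn_integral_cong) (use that in \<open>auto split: split_indicator\<close>)
  have meas: "(\<lambda>x. if x \<in> C then h x else k x) \<in> borel_measurable borel" by measurable
  show ?thesis using 1 meas unfolding ug_on_def by (simp add: e)
qed

section \<open>Arc length\<close>

lemma curve_length_upper:
  assumes "mono_on {..n} \<tau>" "\<tau> ` {..n} \<subseteq> {s..t}"
  shows "(\<Sum>i<n. ennreal (dist (\<gamma> (\<tau> i)) (\<gamma> (\<tau> (Suc i))))) \<le> curve_length \<gamma> s t"
  unfolding curve_length_def using assms by (intro SUP_upper2[of "(n, \<tau>)"]) auto

lemma curve_length_least:
  assumes "\<And>n \<tau>. mono_on {..n} \<tau> \<Longrightarrow> \<tau> ` {..n} \<subseteq> {s..t} \<Longrightarrow>
     (\<Sum>i<n. ennreal (dist (\<gamma> (\<tau> i)) (\<gamma> (\<tau> (Suc i))))) \<le> K"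
  shows "curve_length \<gamma> s t \<le> K"
  unfolding curve_length_def using assms by (intro SUP_least) auto

lemma dist_le_curve_length:
  assumes "s \<le> t"
  shows "ennreal (dist (\<gamma> s) (\<gamma> t)) \<le> curve_length \<gamma> s t"
proof -
  define \<tau> where "\<tau> i = (if i = 0 then s else t)" for i :: nat
  have "(\<Sum>i<1. ennreal (dist (\<gamma> (\<tau> i)) (\<gamma> (\<tau> (Suc i))))) \<le> curve_length \<gamma> s t"
    by (rule curve_length_upper) (use assms in \<open>auto simp: mono_on_def \<tau>_def\<close>)
  then show ?thesis by (simp add: \<tau>_def)
qed

lemma mono_on_min_max:
  fixes \<tau> :: "'b::order \<Rightarrow> 'c::linorder"
  assumes "mono_on A \<tau>"
  shows "mono_on A (\<lambda>i. min (\<tau> i) b)" "mono_on A (\<lambda>i. max (\<tau> i) b)"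
  using assms by (auto intro!: mono_onI min.mono max.mono dest: mono_onD)

lemma curve_length_mono:
  assumes "s' \<le> s" "t \<le> t'"
  shows "curve_length \<gamma> s t \<le> curve_length \<gamma> s' t'"
  by (rule curve_length_least, rule curve_length_upper) (use assms in \<open>auto\<close>)

lemma curve_length_refl [simp]: "curve_length \<gamma> s s = 0"
proof -
  have "curve_length \<gamma> s s \<le> 0"
  proof (rule curve_length_least)
    fix n :: nat and \<tau> :: "nat \<Rightarrow> real" assume "\<tau> ` {..n} \<subseteq> {s..s}"
    then have "\<tau> i = s" if "i \<le> n" for i using that by auto
    then show "(\<Sum>i<n. ennreal (dist (\<gamma> (\<tau> i)) (\<gamma> (\<tau> (Suc i))))) \<le> 0" by simp
  qed
  then show ?thesis by simp
qed

text \<open>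
  Cutting a partition at \<open>b\<close> by means of \<open>min\<close> and \<open>max\<close> does not decrease the sum of distances, and
  needs no insertion of a new partition point.
\<close>

lemma partition_sum_clip_le:
  fixes \<gamma> :: "real \<Rightarrow> 'a::metric_space"
  assumes "mono_on {..n} \<tau>"
  shows "(\<Sum>i<n. dist (\<gamma> (\<tau> i)) (\<gamma> (\<tau> (Suc i)))) \<le>
     (\<Sum>i<n. dist (\<gamma> (min (\<tau> i) b)) (\<gamma> (min (\<tau> (Suc i)) b))) +
     (\<Sum>i<n. dist (\<gamma> (max (\<tau> i) b)) (\<gamma> (max (\<tau> (Suc i)) b)))"
  unfolding sum.distrib[symmetric]
proof (rule sum_mono)
  fix i assume "i \<in> {..<n}"
  then have "\<tau> i \<le> \<tau> (Suc i)" using assms by (auto simp: mono_on_def)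
  then consider "\<tau> (Suc i) \<le> b" | "b \<le> \<tau> i" | "\<tau> i \<le> b" "b \<le> \<tau> (Suc i)" by linarith
  then show "dist (\<gamma> (\<tau> i)) (\<gamma> (\<tau> (Suc i))) \<le> dist (\<gamma> (min (\<tau> i) b)) (\<gamma> (min (\<tau> (Suc i)) b)) +
        dist (\<gamma> (max (\<tau> i) b)) (\<gamma> (max (\<tau> (Suc i)) b))"
    using \<open>\<tau> i \<le> \<tau> (Suc i)\<close>
    by cases (auto simp: min_def max_def dist_triangle split: if_splits)
qed

lemma curve_length_add:
  assumes "a \<le> b" "b \<le> c"
  shows "curve_length \<gamma> a c = curve_length \<gamma> a b + curve_length \<gamma> b c"
proof (rule antisym)
  show "curve_length \<gamma> a c \<le> curve_length \<gamma> a b + curve_length \<gamma> b c"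
  proof (rule curve_length_least)
    fix n :: nat and \<tau> :: "nat \<Rightarrow> real" assume mono: "mono_on {..n} \<tau>" and sub: "\<tau> ` {..n} \<subseteq> {a..c}"
    have "(\<Sum>i<n. ennreal (dist (\<gamma> (\<tau> i)) (\<gamma> (\<tau> (Suc i)))))
        = ennreal (\<Sum>i<n. dist (\<gamma> (\<tau> i)) (\<gamma> (\<tau> (Suc i))))"
      by (simp add: sum_ennreal)
    also have "\<dots> \<le> ennreal ((\<Sum>i<n. dist (\<gamma> (min (\<tau> i) b)) (\<gamma> (min (\<tau> (Suc i)) b))) +
       (\<Sum>i<n. dist (\<gamma> (max (\<tau> i) b)) (\<gamma> (max (\<tau> (Suc i)) b))))"
      by (intro ennreal_leI partition_sum_clip_le mono)
    also have "\<dots> = (\<Sum>i<n. ennreal (dist (\<gamma> (min (\<tau> i) b)) (\<gamma> (min (\<tau> (Suc i)) b)))) +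
       (\<Sum>i<n. ennreal (dist (\<gamma> (max (\<tau> i) b)) (\<gamma> (max (\<tau> (Suc i)) b))))"
      by (simp add: sum_ennreal sum_nonneg)
    also have "\<dots> \<le> curve_length \<gamma> a b + curve_length \<gamma> b c"
      by (intro add_mono curve_length_upper) (use mono sub assms in \<open>auto intro: mono_on_min_max
          simp: image_subset_iff min_le_iff_disj le_max_iff_disj\<close>)
    finally show "(\<Sum>i<n. ennreal (dist (\<gamma> (\<tau> i)) (\<gamma> (\<tau> (Suc i))))) \<le> curve_length \<gamma> a b
        + curve_length \<gamma> b c" .
  qed
next
  define I where "I s t = {(n :: nat, \<tau> :: nat \<Rightarrow> real). mono_on {..n} \<tau> \<and> \<tau> ` {..n} \<subseteq> {s..t}}" for s t
  define S where "S p = (\<Sum>i<fst p. ennreal (dist (\<gamma> (snd p i)) (\<gamma> (snd p (Suc i)))))"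
    for p :: "nat \<times> (nat \<Rightarrow> real)"
  have len: "curve_length \<gamma> s t = (SUP p\<in>I s t. S p)" for s t
    unfolding curve_length_def I_def S_def by (simp add: case_prod_unfold)
  have ne: "I s t \<noteq> {}" if "s \<le> t" for s t
  proof -
    have "(0, \<lambda>_. s) \<in> I s t" using that by (auto simp: I_def mono_on_def)
    then show ?thesis by auto
  qed
  have step: "S p + S r \<le> curve_length \<gamma> a c" if p: "p \<in> I a b" and r: "r \<in> I b c" for p r
  proof -
    obtain n \<tau> where p': "p = (n, \<tau>)" "mono_on {..n} \<tau>" "\<tau> ` {..n} \<subseteq> {a..b}" using p
      by (auto simp: I_def)
    obtain m \<sigma> where r': "r = (m, \<sigma>)" "mono_on {..m} \<sigma>" "\<sigma> ` {..m} \<subseteq> {b..c}" using r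
      by (auto simp: I_def)
    have split: "(\<Sum>i<k + l. f i) = (\<Sum>i<k. f i) + (\<Sum>i<l. f (k + i))" for f :: "nat \<Rightarrow> ennreal" and k l
      by (induction l) (simp_all add: add.assoc)
    define \<rho> where "\<rho> i = (if i \<le> n then \<tau> i else \<sigma> (i - Suc n))" for i
    have \<tau>b: "\<tau> i \<in> {a..b}" if "i \<le> n" for i using p' that by auto
    have \<sigma>b: "\<sigma> i \<in> {b..c}" if "i \<le> m" for i using r' that by auto
    have "mono_on {..Suc n + m} \<rho>"
    proof (rule mono_onI)
      fix i j assume ij: "i \<in> {..Suc n + m}" "j \<in> {..Suc n + m}" "i \<le> j"
      consider "j \<le> n" | "i \<le> n" "n < j" | "n < i" by linarith
      then show "\<rho> i \<le> \<rho> j"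
      proof cases
        case 1
        then show ?thesis using ij p' by (auto simp: \<rho>_def mono_on_def)
      next
        case 2
        then have "j - Suc n \<le> m" using ij by auto
        then show ?thesis using 2 \<tau>b[of i] \<sigma>b[of "j - Suc n"] by (auto simp: \<rho>_def)
      next
        case 3
        then have "i - Suc n \<le> m" "j - Suc n \<le> m" "i - Suc n \<le> j - Suc n" using ij by auto
        then show ?thesis using 3 ij mono_onD[OF r'(2)] by (auto simp: \<rho>_def)
      qed
    qed
    moreover have "\<rho> ` {..Suc n + m} \<subseteq> {a..c}"
    proof (rule image_subsetI)
      fix i assume "i \<in> {..Suc n + m}"
      then have "i \<le> n \<or> i - Suc n \<le> m" by auto
      then show "\<rho> i \<in> {a..c}"
        using \<tau>b[of i] \<sigma>b[of "i - Suc n"] assms by (auto simp: \<rho>_def)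
    qed
    ultimately have "(\<Sum>i<Suc n + m. ennreal (dist (\<gamma> (\<rho> i)) (\<gamma> (\<rho> (Suc i))))) \<le> curve_length \<gamma> a c"
      by (rule curve_length_upper)
    moreover have "(\<Sum>i<Suc n + m. ennreal (dist (\<gamma> (\<rho> i)) (\<gamma> (\<rho> (Suc i))))) =
        (\<Sum>i<Suc n. ennreal (dist (\<gamma> (\<rho> i)) (\<gamma> (\<rho> (Suc i))))) +
        (\<Sum>i<m. ennreal (dist (\<gamma> (\<rho> (Suc n + i))) (\<gamma> (\<rho> (Suc (Suc n + i))))))"
      by (rule split)
    moreover have "(\<Sum>i<m. ennreal (dist (\<gamma> (\<rho> (Suc n + i))) (\<gamma> (\<rho> (Suc (Suc n + i)))))) = S r"
      by (simp add: S_def r' \<rho>_def)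
    moreover have "(\<Sum>i<n. ennreal (dist (\<gamma> (\<rho> i)) (\<gamma> (\<rho> (Suc i))))) = S p"
      by (simp add: S_def p' \<rho>_def)
    ultimately have "S p + ennreal (dist (\<gamma> (\<rho> n)) (\<gamma> (\<rho> (Suc n)))) + S r \<le> curve_length \<gamma> a c"
      by (simp only: sum.lessThan_Suc)
    moreover have "S p + S r \<le> S p + ennreal (dist (\<gamma> (\<rho> n)) (\<gamma> (\<rho> (Suc n)))) + S r"
      by (intro add_right_mono) simp
    ultimately show ?thesis by (rule order_trans[rotated])
  qed
  have "curve_length \<gamma> a b + S r \<le> curve_length \<gamma> a c" if r: "r \<in> I b c" for r
  proof -
    have "curve_length \<gamma> a b + S r = (SUP p\<in>I a b. S p + S r)"
      unfolding len[of a b] by (rule ennreal_SUP_add_left[OF ne[OF assms(1)], symmetric])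
    also have "\<dots> \<le> curve_length \<gamma> a c" by (rule SUP_least) (rule step[OF _ r])
    finally show ?thesis .
  qed
  note 1 = this
  have "curve_length \<gamma> a b + curve_length \<gamma> b c = (SUP r\<in>I b c. curve_length \<gamma> a b + S r)"
    unfolding len[of b c] by (rule ennreal_SUP_add_right[OF ne[OF assms(2)]])
  also have "\<dots> \<le> curve_length \<gamma> a c" by (rule SUP_least) (rule 1)
  finally show "curve_length \<gamma> a b + curve_length \<gamma> b c \<le> curve_length \<gamma> a c" .
qed

lemma curve_length_affine:
  assumes "u \<le> v" "0 \<le> x"
  shows "curve_length (\<lambda>x. \<gamma> (u + (v - u) * x)) 0 x = curve_length \<gamma> u (u + (v - u) * x)"
proof (cases "u = v")
  case True
  have "curve_length (\<lambda>x. \<gamma> (u + (v - u) * x)) 0 x \<le> 0"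
    by (rule curve_length_least) (simp add: True)
  then show ?thesis using True by simp
next
  case False
  then have uv: "u < v" using assms by simp
  show ?thesis
  proof (rule antisym)
    show "curve_length (\<lambda>x. \<gamma> (u + (v - u) * x)) 0 x \<le> curve_length \<gamma> u (u + (v - u) * x)"
    proof (rule curve_length_least)
      fix n :: nat and \<tau> :: "nat \<Rightarrow> real" assume "mono_on {..n} \<tau>" "\<tau> ` {..n} \<subseteq> {0..x}"
      then show "(\<Sum>i<n. ennreal (dist ((\<lambda>x. \<gamma> (u + (v - u) * x)) (\<tau> i)) ((\<lambda>x. \<gamma> (u
          + (v - u) * x)) (\<tau> (Suc i))))) \<le> curve_length \<gamma> u (u + (v - u) * x)"
        using uv
        by (intro order_trans[OF _ curve_length_upper[of n "\<lambda>i. u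
            + (v - u) * \<tau> i"]]) (auto simp: mono_on_def mult_left_mono image_subset_iff)
    qed
    show "curve_length \<gamma> u (u + (v - u) * x) \<le> curve_length (\<lambda>x. \<gamma> (u + (v - u) * x)) 0 x"
    proof (rule curve_length_least)
      fix n :: nat and \<tau> :: "nat \<Rightarrow> real" assume \<tau>: "mono_on {..n} \<tau>" "\<tau> ` {..n} \<subseteq> {u..u + (v - u) * x}"
      have sp: "(\<lambda>x. \<gamma> (u + (v - u) * x)) ((y - u) / (v - u)) = \<gamma> y" for y
      proof -
        have "(v - u) * ((y - u) / (v - u)) = y - u" using uv by simp
        then show ?thesis by simp
      qed
      have "(\<Sum>i<n. ennreal (dist ((\<lambda>x. \<gamma> (u + (v - u) * x)) ((\<tau> i - u) / (v - u))) ((\<lambda>x. \<gamma> (u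
          + (v - u) * x)) ((\<tau> (Suc i) - u) / (v - u))))) \<le> curve_length (\<lambda>x. \<gamma> (u + (v - u) * x)) 0 x"
      proof (rule curve_length_upper[of n "\<lambda>i. (\<tau> i - u) / (v - u)"])
        show "mono_on {..n} (\<lambda>i. (\<tau> i - u) / (v - u))"
          using \<tau>(1) uv by (auto simp: mono_on_def intro!: divide_right_mono)
        show "(\<lambda>i. (\<tau> i - u) / (v - u)) ` {..n} \<subseteq> {0..x}"
        proof (rule image_subsetI)
          fix i assume "i \<in> {..n}"
          then have "u \<le> \<tau> i" "\<tau> i \<le> u + (v - u) * x" using \<tau>(2) by auto
          then show "(\<tau> i - u) / (v - u) \<in> {0..x}" using uv by (simp add: pos_divide_le_eq mult.commute)
        qed
      qed
      then show "(\<Sum>i<n. ennreal (dist (\<gamma> (\<tau> i)) (\<gamma> (\<tau> (Suc i))))) \<le> curve_length (\<lambda>x. \<gamma> (u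
          + (v - u) * x)) 0 x"
        unfolding sp .
    qed
  qed
qed

text \<open>
  The length up to \<open>t\<close> is the uniform limit of the continuous functions \<open>P\<close> that arise from clipping
  at \<open>t\<close> a fixed partition of \<open>[0, 1]\<close> whose sum is almost the total length.
\<close>

lemma continuous_on_curve_length:
  fixes \<gamma> :: "real \<Rightarrow> 'a::metric_space"
  assumes \<gamma>: "continuous_on {0..1} \<gamma>" and fin: "curve_length \<gamma> 0 1 < \<infinity>"
  shows "continuous_on {0..1} (\<lambda>t. enn2real (curve_length \<gamma> 0 t))"
  unfolding continuous_on_iff
proof (intro ballI allI impI)
  fix t e :: real assume t: "t \<in> {0..1}" and e: "0 < e"
  let ?S = "\<lambda>\<tau> n. \<Sum>i<n. dist (\<gamma> (\<tau> i)) (\<gamma> (\<tau> (Suc i)))"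
  define L where "L = enn2real (curve_length \<gamma> 0 1)"
  have L: "curve_length \<gamma> 0 1 = ennreal L" using fin by (simp add: L_def)
  have "\<exists>n \<tau>. mono_on {..n} \<tau> \<and> \<tau> ` {..n} \<subseteq> {0..1} \<and> L - e / 2 < ?S \<tau> n"
  proof (rule ccontr)
    assume "\<not> ?thesis"
    then have c: "?S \<tau> n \<le> L - e / 2" if "mono_on {..n} \<tau>" "\<tau> ` {..n} \<subseteq> {0..1}" for n \<tau>
      using that by (meson not_less)
    have "curve_length \<gamma> 0 1 \<le> ennreal (L - e / 2)"
    proof (rule curve_length_least)
      fix n :: nat and \<tau> :: "nat \<Rightarrow> real" assume "mono_on {..n} \<tau>" "\<tau> ` {..n} \<subseteq> {0..1}"
      then have "?S \<tau> n \<le> L - e / 2" by (rule c)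
      then show "(\<Sum>i<n. ennreal (dist (\<gamma> (\<tau> i)) (\<gamma> (\<tau> (Suc i))))) \<le> ennreal (L - e / 2)"
        by (simp add: sum_ennreal ennreal_leI)
    qed
    moreover have "0 \<le> L - e / 2"
    proof -
      have "mono_on {..0} (\<lambda>_::nat. 0::real)" "(\<lambda>_::nat. 0::real) ` {..0} \<subseteq> {0..1}"
        by (auto simp: mono_on_def)
      from c[OF this] show ?thesis by simp
    qed
    ultimately show False using L e by (simp add: ennreal_le_iff)
  qed
  then obtain n \<tau> where \<tau>: "mono_on {..n} \<tau>" "\<tau> ` {..n} \<subseteq> {0..1}" and big: "L - e / 2 < ?S \<tau> n" by auto
  define P where "P t = ?S (\<lambda>i. min (\<tau> i) t) n" for t
  define l where "l t = enn2real (curve_length \<gamma> 0 t)" for t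
  have \<tau>in: "\<tau> i \<in> {0..1}" if "i \<le> n" for i using \<tau> that by auto
  have contP: "continuous_on {0..1} P"
    unfolding P_def
  proof (intro continuous_on_sum continuous_on_dist)
    fix i assume "i \<in> {..<n}"
    then have i: "\<tau> i \<in> {0..1}" "\<tau> (Suc i) \<in> {0..1}" using \<tau>in by auto
    have *: "continuous_on {0..1} (\<lambda>t. \<gamma> (min x t))" if "x \<in> {0..1}" for x
      by (rule continuous_on_compose2[OF \<gamma>]) (use that in \<open>auto intro!: continuous_intros\<close>)
    show "continuous_on {0..1} (\<lambda>t. \<gamma> (min (\<tau> i) t))" "continuous_on {0..1} (\<lambda>t. \<gamma> (min (\<tau> (Suc i)) t))"
      by (rule *[OF i(1)], rule *[OF i(2)])
  qed
  have fin': "curve_length \<gamma> 0 t < \<infinity>" "curve_length \<gamma> t 1 < \<infinity>" if "t \<in> {0..1}" for t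
    using fin curve_length_mono[of 0 0 t 1 \<gamma>] curve_length_mono[of 0 t 1 1 \<gamma>] that
    by (auto intro: le_less_trans)
  have bounds: "P t \<le> l t \<and> l t < P t + e / 2" if t: "t \<in> {0..1}" for t
  proof
    have "ennreal (P t) \<le> curve_length \<gamma> 0 t"
      unfolding P_def using curve_length_upper[of n "\<lambda>i. min (\<tau> i) t" 0 t \<gamma>] \<tau> t \<tau>in
      by (auto simp: sum_ennreal mono_on_min_max image_subset_iff min_le_iff_disj)
    then show "P t \<le> l t" using fin'[OF t]
      by (cases "curve_length \<gamma> 0 t") (auto simp: l_def ennreal_le_iff P_def sum_nonneg)
    have "ennreal (?S (\<lambda>i. max (\<tau> i) t) n) \<le> curve_length \<gamma> t 1"
      using curve_length_upper[of n "\<lambda>i. max (\<tau> i) t" t 1 \<gamma>] \<tau> t \<tau>in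
      by (auto simp: sum_ennreal mono_on_min_max image_subset_iff le_max_iff_disj)
    then have Q: "?S (\<lambda>i. max (\<tau> i) t) n \<le> enn2real (curve_length \<gamma> t 1)"
      using fin'[OF t] by (cases "curve_length \<gamma> t 1") (auto simp: ennreal_le_iff)
    have "L = l t + enn2real (curve_length \<gamma> t 1)"
      unfolding L_def l_def using curve_length_add[of 0 t 1 \<gamma>] t fin'[OF t] by (simp add: enn2real_plus)
    then show "l t < P t + e / 2"
      using big Q partition_sum_clip_le[OF \<tau>(1), of \<gamma> t] by (simp add: P_def)
  qed
  obtain d where d: "d > 0" "\<And>s. s \<in> {0..1} \<Longrightarrow> dist s t < d \<Longrightarrow> dist (P s) (P t) < e / 2"
    using contP t e unfolding continuous_on_iff by (meson half_gt_zero)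
  show "\<exists>d>0. \<forall>s\<in>{0..1}. dist s t < d \<longrightarrow> dist (enn2real (curve_length \<gamma> 0 s)) (enn2real (curve_length
      \<gamma> 0 t)) < e"
  proof (intro exI[of _ d] conjI ballI impI d(1))
    fix s assume s: "s \<in> {0..1}" "dist s t < d"
    have "dist (l s) (l t) < e" using d(2)[OF s] bounds[OF s(1)] bounds[OF t]
      unfolding dist_real_def by linarith
    then show "dist (enn2real (curve_length \<gamma> 0 s)) (enn2real (curve_length \<gamma> 0 t)) < e"
      by (simp add: l_def)
  qed
qed

text \<open>
  The length of a path as a real number; it is only meaningful for rectifiable paths.
\<close>

definition arc_len :: "(real \<Rightarrow> 'a::metric_space) \<Rightarrow> real" where
  "arc_len \<gamma> = enn2real (curve_length \<gamma> 0 1)"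

lemma arc_len_nonneg [simp]: "0 \<le> arc_len \<gamma>"
  by (simp add: arc_len_def)

context
  fixes \<gamma> :: "real \<Rightarrow> 'a::metric_space"
  assumes \<gamma>: "path \<gamma>" and fin: "curve_length \<gamma> 0 1 < \<infinity>"
begin

lemma ennreal_arc_len: "ennreal (arc_len \<gamma>) = curve_length \<gamma> 0 1"
  using fin by (simp add: arc_len_def)

lemma curve_length_finite: "0 \<le> s \<Longrightarrow> t \<le> 1 \<Longrightarrow> curve_length \<gamma> s t < \<infinity>"
  using fin curve_length_mono[of 0 s t 1 \<gamma>] by (auto intro: le_less_trans)

lemma arc_len_param_exists:
  assumes "0 \<le> s" "s \<le> arc_len \<gamma>"
  obtains t where "t \<in> {0..1}" "curve_length \<gamma> 0 t = ennreal s"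
proof -
  have "\<exists>t\<ge>0. t \<le> 1 \<and> enn2real (curve_length \<gamma> 0 t) = s"
    by (rule IVT') (use assms \<gamma> fin continuous_on_curve_length[of \<gamma>] in \<open>auto simp: arc_len_def
        path_def\<close>)
  then obtain t where t: "t \<in> {0..1}" "enn2real (curve_length \<gamma> 0 t) = s" by auto
  then have "curve_length \<gamma> 0 t = ennreal s" using curve_length_finite[of 0 t] by auto
  with t show ?thesis using that by blast
qed

lemma dist_le_length_diff:
  assumes "0 \<le> t" "t \<le> 1" "0 \<le> t'" "t' \<le> 1"
    and "curve_length \<gamma> 0 t = ennreal s" "curve_length \<gamma> 0 t' = ennreal s'" "0 \<le> s" "0 \<le> s'"
  shows "dist (\<gamma> t) (\<gamma> t') \<le> \<bar>s - s'\<bar>"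
proof -
  have *: "dist (\<gamma> t) (\<gamma> t') \<le> s' - s" if "t \<le> t'" "0 \<le> t" "t' \<le> 1"
      "curve_length \<gamma> 0 t = ennreal s" "curve_length \<gamma> 0 t' = ennreal s'" "0 \<le> s" "0 \<le> s'" for t t' s s'
  proof -
    have "ennreal s' = ennreal s + curve_length \<gamma> t t'"
      using curve_length_add[of 0 t t' \<gamma>] that by simp
    then have "ennreal s + ennreal (dist (\<gamma> t) (\<gamma> t')) \<le> ennreal s'"
      using dist_le_curve_length[of t t' \<gamma>] that by (metis add_left_mono)
    then show ?thesis using that by (simp flip: ennreal_plus)
  qed
  show ?thesis
    using *[of t t' s s'] *[of t' t s' s] assms by (cases "t \<le> t'") (auto simp: dist_commute)
qed

lemma arc_param_eq:
  assumes "t \<in> {0..1}" "curve_length \<gamma> 0 t = ennreal s" "0 \<le> s"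
  shows "arc_param \<gamma> s = \<gamma> t"
proof -
  define t' where "t' = (SOME t. t \<in> {0..1} \<and> curve_length \<gamma> 0 t = ennreal s)"
  have "t' \<in> {0..1} \<and> curve_length \<gamma> 0 t' = ennreal s"
    unfolding t'_def by (rule someI[of _ t]) (use assms in auto)
  then have "dist (\<gamma> t') (\<gamma> t) \<le> \<bar>s - s\<bar>" using assms by (intro dist_le_length_diff) auto
  then show ?thesis by (simp add: arc_param_def t'_def)
qed

lemma arc_param_0: "arc_param \<gamma> 0 = pathstart \<gamma>"
  unfolding pathstart_def by (rule arc_param_eq) auto

lemma arc_param_arc_len: "arc_param \<gamma> (arc_len \<gamma>) = pathfinish \<gamma>"
  unfolding pathfinish_def by (rule arc_param_eq) (auto simp: ennreal_arc_len)

lemma arc_param_dist: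
  assumes "s \<in> {0..arc_len \<gamma>}" "t \<in> {0..arc_len \<gamma>}"
  shows "dist (arc_param \<gamma> s) (arc_param \<gamma> t) \<le> \<bar>s - t\<bar>"
proof -
  obtain a where a: "a \<in> {0..1}" "curve_length \<gamma> 0 a = ennreal s" using arc_len_param_exists assms
    by auto
  obtain b where b: "b \<in> {0..1}" "curve_length \<gamma> 0 b = ennreal t" using arc_len_param_exists assms
    by auto
  show ?thesis
    using dist_le_length_diff[of a b s t] a b assms
    by (auto simp: arc_param_eq[OF a] arc_param_eq[OF b])
qed

lemma continuous_on_arc_param: "continuous_on {0..arc_len \<gamma>} (arc_param \<gamma>)"
  unfolding continuous_on_iff
proof (intro ballI allI impI)
  fix t e :: real assume "t \<in> {0..arc_len \<gamma>}" "0 < e"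
  then show "\<exists>d>0. \<forall>s\<in>{0..arc_len \<gamma>}. dist s t < d \<longrightarrow> dist (arc_param \<gamma> s) (arc_param \<gamma> t) < e"
    by (intro exI[of _ e]) (auto simp: dist_real_def intro: le_less_trans[OF arc_param_dist])
qed

lemma arc_param_image: "arc_param \<gamma> ` {0..arc_len \<gamma>} = path_image \<gamma>"
proof
  show "arc_param \<gamma> ` {0..arc_len \<gamma>} \<subseteq> path_image \<gamma>"
  proof (rule image_subsetI)
    fix s assume s: "s \<in> {0..arc_len \<gamma>}"
    obtain a where a: "a \<in> {0..1}" "curve_length \<gamma> 0 a = ennreal s" using arc_len_param_exists s by auto
    then show "arc_param \<gamma> s \<in> path_image \<gamma>" using s by (auto simp: arc_param_eq[OF a] path_image_def)
  qed
  show "path_image \<gamma> \<subseteq> arc_param \<gamma> ` {0..arc_len \<gamma>}"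
  proof
    fix x assume "x \<in> path_image \<gamma>"
    then obtain t where t: "t \<in> {0..1}" "x = \<gamma> t" by (auto simp: path_image_def)
    define s where "s = enn2real (curve_length \<gamma> 0 t)"
    have len: "curve_length \<gamma> 0 t = ennreal s" using curve_length_finite[of 0 t] t by (simp add: s_def)
    have "ennreal s \<le> ennreal (arc_len \<gamma>)" unfolding ennreal_arc_len len[symmetric]
      by (rule curve_length_mono) (use t in auto)
    then have "s \<in> {0..arc_len \<gamma>}" by (simp add: s_def ennreal_le_iff)
    then show "x \<in> arc_param \<gamma> ` {0..arc_len \<gamma>}" using arc_param_eq[OF t(1) len] t by force
  qed
qed

end

text \<open>
  The restriction of the arc length parametrization to \<open>[s, t]\<close> is again the arc length
  parametrization of a path, namely of an affine reparametrization of a piece of \<open>\<gamma>\<close>.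
\<close>

lemma arc_param_subcurve:
  fixes \<gamma> :: "real \<Rightarrow> 'a::metric_space"
  assumes \<gamma>: "path \<gamma>" and fin: "curve_length \<gamma> 0 1 < \<infinity>" and st: "0 \<le> s" "s < t" "t \<le> arc_len \<gamma>"
  obtains \<gamma>' where "\<gamma>' \<in> curves_in (arc_param \<gamma> ` {s..t})" "arc_len \<gamma>' = t - s"
    "\<And>r. r \<in> {0..t - s} \<Longrightarrow> arc_param \<gamma>' r = arc_param \<gamma> (s + r)"
proof -
  obtain u where u: "u \<in> {0..1}" "curve_length \<gamma> 0 u = ennreal s"
    using arc_len_param_exists[OF \<gamma> fin, of s] st by auto
  obtain v where v: "v \<in> {0..1}" "curve_length \<gamma> 0 v = ennreal t"
    using arc_len_param_exists[OF \<gamma> fin, of t] st by auto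
  have uv: "u < v"
  proof (rule ccontr)
    assume "\<not> u < v"
    then have "ennreal t \<le> ennreal s" unfolding u(2)[symmetric] v(2)[symmetric]
      by (intro curve_length_mono) auto
    then show False using st by (simp add: ennreal_le_iff)
  qed
  have unit: "0 \<le> (v - u) * x" "(v - u) * x \<le> v - u" if "0 \<le> x" "x \<le> 1" for x
    using that uv mult_left_le[of x "v - u"] by simp_all
  define \<gamma>' where "\<gamma>' = (\<lambda>x. \<gamma> (u + (v - u) * x))"
  have path: "path \<gamma>'" unfolding \<gamma>'_def path_def
  proof (rule continuous_on_compose2[where g=\<gamma>])
    show "continuous_on {0..1} \<gamma>" using \<gamma> by (simp add: path_def)
    show "(\<lambda>x. u + (v - u) * x) ` {0..1} \<subseteq> {0..1}"
    proof (rule image_subsetI)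
      fix x :: real assume "x \<in> {0..1}"
      then have "0 \<le> (v - u) * x" "(v - u) * x \<le> v - u" by (auto intro!: unit)
      then show "u + (v - u) * x \<in> {0..1}" using u(1) v(1) by simp
    qed
    show "continuous_on {0..1} (\<lambda>x. u + (v - u) * x)" by (intro continuous_intros)
  qed
  have len: "ennreal s + curve_length \<gamma>' 0 x = curve_length \<gamma> 0 (u + (v - u) * x)" if "x \<in> {0..1}" for x
    using curve_length_add[of 0 u "u + (v - u) * x" \<gamma>] that uv u
    by (simp add: curve_length_affine \<gamma>'_def)
  have "ennreal s + curve_length \<gamma>' 0 1 = ennreal s + ennreal (t - s)"
    using len[of 1] v st by (simp flip: ennreal_plus)
  then have len1: "curve_length \<gamma>' 0 1 = ennreal (t - s)" by simp
  have fin': "curve_length \<gamma>' 0 1 < \<infinity>" by (simp add: len1)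
  have al: "arc_len \<gamma>' = t - s" using st by (simp add: arc_len_def len1)
  have ap: "arc_param \<gamma>' r = arc_param \<gamma> (s + r)" if r: "r \<in> {0..t - s}" for r
  proof -
    obtain x where x: "x \<in> {0..1}" "curve_length \<gamma>' 0 x = ennreal r"
      using arc_len_param_exists[OF path fin', of r] r al by auto
    have 1: "arc_param \<gamma>' r = \<gamma>' x" by (rule arc_param_eq[OF path fin' x]) (use r in auto)
    have "curve_length \<gamma> 0 (u + (v - u) * x) = ennreal (s + r)"
      using len[OF x(1)] x(2) r st by simp
    moreover have "u + (v - u) * x \<in> {0..1}"
      using u(1) v(1) unit[of x] x(1) unfolding atLeastAtMost_iff by linarith
    ultimately have "arc_param \<gamma> (s + r) = \<gamma> (u + (v - u) * x)"
      by (intro arc_param_eq[OF \<gamma> fin]) (use r st in auto)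
    then show ?thesis using 1 by (simp add: \<gamma>'_def)
  qed
  have im: "path_image \<gamma>' = arc_param \<gamma> ` {s..t}"
  proof -
    have "path_image \<gamma>' = arc_param \<gamma>' ` {0..t - s}" using arc_param_image[OF path fin'] al by simp
    also have "\<dots> = (\<lambda>r. arc_param \<gamma> (s + r)) ` {0..t - s}" by (intro image_cong ap) auto
    also have "\<dots> = arc_param \<gamma> ` ((+) s ` {0..t - s})" by (simp only: image_image)
    also have "(+) s ` {0..t - s} = {s..t}" by simp
    finally show ?thesis .
  qed
  show ?thesis
    by (rule that[of \<gamma>']) (use path im len1 st al ap in \<open>auto simp: curves_in_def\<close>)
qed

section \<open>Properties of almost every path\<close>

lemma ennreal_eq_0I:
  fixes x :: ennreal
  assumes "\<And>e. 0 < e \<Longrightarrow> x \<le> ennreal e"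
  shows "x = 0"
proof -
  have "x \<le> 0" by (rule ennreal_le_epsilon) (simp add: assms)
  then show ?thesis by simp
qed

lemma epowr_0 [simp]: "epowr 0 r = 0"
  by (simp add: epowr_def)

lemma epowr_top [simp]: "epowr \<infinity> r = \<infinity>" "epowr top r = top"
  by (simp_all add: epowr_def)

lemma epowr_ennreal [simp]: "0 \<le> x \<Longrightarrow> epowr (ennreal x) r = ennreal (x powr r)"
  by (simp add: epowr_def)

lemma epowr_mono: "x \<le> y \<Longrightarrow> 0 \<le> r \<Longrightarrow> epowr x r \<le> epowr y r"
  by (cases x; cases y) (auto intro!: ennreal_leI powr_mono2 simp: top_unique ennreal_le_iff2)

lemma epowr_strict_mono: "x < y \<Longrightarrow> 0 < r \<Longrightarrow> epowr x r < epowr y r"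
  by (cases x; cases y) (auto intro!: powr_less_mono2 simp: ennreal_less_iff)

lemma epowr_eq_0_iff [simp]: "epowr x r = 0 \<longleftrightarrow> x = 0"
  by (cases x) auto

lemma epowr_eq_top_iff [simp]: "epowr x r = top \<longleftrightarrow> x = top"
  by (cases x) auto

lemma measurable_epowr [measurable]:
  assumes [measurable]: "f \<in> borel_measurable N"
  shows "(\<lambda>x. epowr (f x) r) \<in> borel_measurable N"
  unfolding epowr_def by measurable

lemma epowr_max: "0 \<le> r \<Longrightarrow> epowr (max x y) r = max (epowr x r) (epowr y r)"
  by (metis epowr_mono linear max.absorb1 max.absorb2)

lemma epowr_cmult:
  assumes "0 \<le> c"
  shows "epowr (ennreal c * x) r = ennreal (c powr r) * epowr x r"
proof (cases x)
  case (real z)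
  then have e: "ennreal c * x = ennreal (c * z)" using assms by (simp add: ennreal_mult)
  have "epowr (ennreal c * x) r = ennreal ((c * z) powr r)"
    unfolding e using assms real by (intro epowr_ennreal) simp
  also have "\<dots> = ennreal (c powr r) * epowr x r"
    using assms real by (simp add: powr_mult ennreal_mult)
  finally show ?thesis .
next
  case top
  then show ?thesis using assms by (cases "c = 0") (simp_all add: ennreal_mult_top)
qed

lemma epowr_add_le:
  assumes "0 \<le> r"
  shows "epowr (x + y) r \<le> ennreal (2 powr r) * (epowr x r + epowr y r)"
proof -
  have "x + y \<le> 2 * max x y" by (simp add: mult_2 add_mono)
  then have "epowr (x + y) r \<le> epowr (2 * max x y) r" using assms by (rule epowr_mono)
  also have "\<dots> = ennreal (2 powr r) * epowr (max x y) r"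
    using epowr_cmult[of 2 "max x y" r] by simp
  also have "epowr (max x y) r \<le> epowr x r + epowr y r"
    using assms by (simp add: epowr_max add_increasing add_increasing2)
  finally show ?thesis by (simp add: mult_left_mono)
qed

text \<open>
  This replaces the Minkowski inequality: suprema of countably many functions are used instead of sums.
\<close>

lemma epowr_SUP_le_suminf:
  fixes f :: "nat \<Rightarrow> ennreal"
  assumes q: "0 < q"
  shows "epowr (SUP i. f i) q \<le> (\<Sum>i. epowr (f i) q)"
proof (rule ccontr)
  define S where "S = (\<Sum>i. epowr (f i) q)"
  have le: "epowr (f i) q \<le> S" for i
    unfolding S_def using sum_le_suminf[of "\<lambda>i. epowr (f i) q" "{i}"] by simp
  assume "\<not> ?thesis"
  then have lt: "S < epowr (SUP i. f i) q" by (simp add: S_def)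
  then obtain s where s: "S = ennreal s" "0 \<le> s" by (cases S) auto
  have *: "epowr (ennreal (s powr (1/q))) q = S" using s q by (simp add: powr_powr)
  then have "ennreal (s powr (1/q)) < (SUP i. f i)"
    using lt q by (metis epowr_mono less_imp_le not_le)
  then obtain i where "ennreal (s powr (1/q)) < f i" unfolding less_SUP_iff by auto
  then have "S < epowr (f i) q" using epowr_strict_mono[OF _ q] * by metis
  with le[of i] show False by simp
qed

lemma line_integral_eq: "line_integral g \<gamma> = (\<integral>\<^sup>+s\<in>{0..arc_len \<gamma>}. g (arc_param \<gamma> s) \<partial>lborel)"
  by (simp add: line_integral_def arc_len_def)

text \<open>
  The arc length parametrization, extended from \<open>[0, arc_len \<gamma>]\<close> to the whole line by constants, so
  that it is continuous everywhere.
\<close>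

definition arc_clamp :: "(real \<Rightarrow> 'a::metric_space) \<Rightarrow> real \<Rightarrow> 'a" where
  "arc_clamp \<gamma> s = arc_param \<gamma> (max 0 (min (arc_len \<gamma>) s))"

lemma curves_inD:
  assumes "\<gamma> \<in> curves_in A"
  shows "path \<gamma>" "path_image \<gamma> \<subseteq> A" "curve_length \<gamma> 0 1 < \<infinity>" "0 < arc_len \<gamma>"
  using assms by (auto simp: curves_in_def arc_len_def enn2real_positive_iff)

lemma arc_clamp_eq: "s \<in> {0..arc_len \<gamma>} \<Longrightarrow> arc_clamp \<gamma> s = arc_param \<gamma> s"
  by (simp add: arc_clamp_def)

lemma continuous_arc_clamp:
  assumes "\<gamma> \<in> curves_in A"
  shows "continuous_on UNIV (arc_clamp \<gamma>)"
  unfolding arc_clamp_def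
  by (rule continuous_on_compose2[OF continuous_on_arc_param[OF curves_inD(1,3)[OF assms]]])
    (auto intro!: continuous_intros simp: min.coboundedI1)

lemma measurable_arc_clamp [measurable]:
  assumes "\<gamma> \<in> curves_in A"
  shows "arc_clamp \<gamma> \<in> borel_measurable borel"
  using continuous_arc_clamp[OF assms] by (rule borel_measurable_continuous_onI)

lemma arc_clamp_in:
  assumes "\<gamma> \<in> curves_in A"
  shows "arc_clamp \<gamma> s \<in> A"
proof -
  have "arc_clamp \<gamma> s \<in> arc_param \<gamma> ` {0..arc_len \<gamma>}"
    unfolding arc_clamp_def by (rule imageI) (simp add: min.coboundedI1)
  then show ?thesis using arc_param_image[OF curves_inD(1,3)[OF assms]] curves_inD(2)[OF assms] by auto
qed

lemma line_integral_clamp: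
  "line_integral g \<gamma> = (\<integral>\<^sup>+s\<in>{0..arc_len \<gamma>}. g (arc_clamp \<gamma> s) \<partial>lborel)"
  unfolding line_integral_eq by (rule nn_integral_cong) (auto simp: arc_clamp_eq split: split_indicator)

lemma line_integral_mono:
  assumes "\<gamma> \<in> curves_in A" "\<And>x. x \<in> A \<Longrightarrow> g x \<le> h x"
  shows "line_integral g \<gamma> \<le> line_integral h \<gamma>"
  unfolding line_integral_clamp
  by (rule set_nn_integral_mono_fun, rule assms(2), rule arc_clamp_in[OF assms(1)])

lemma line_integral_cmult:
  assumes \<gamma>: "\<gamma> \<in> curves_in A" and [measurable]: "g \<in> borel_measurable borel"
  shows "line_integral (\<lambda>x. c * g x) \<gamma> = c * line_integral g \<gamma>"
proof -
  note [measurable] = measurable_arc_clamp[OF \<gamma>]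
  show ?thesis unfolding line_integral_clamp mult.assoc by (rule nn_integral_cmult) measurable
qed

lemma set_nn_integral_shift:
  fixes h :: "real \<Rightarrow> ennreal"
  assumes [measurable]: "h \<in> borel_measurable borel"
  shows "(\<integral>\<^sup>+x\<in>{a..b}. h x \<partial>lborel) = (\<integral>\<^sup>+r\<in>{0..b - a}. h (a + r) \<partial>lborel)"
proof -
  have "(\<integral>\<^sup>+x\<in>{a..b}. h x \<partial>lborel) = (\<integral>\<^sup>+r. h (a + 1 * r) * indicator {a..b} (a + 1 * r) \<partial>lborel)"
    using nn_integral_real_affine[of "\<lambda>x. h x * indicator {a..b} x" 1 a] by simp
  also have "\<dots> = (\<integral>\<^sup>+r\<in>{0..b - a}. h (a + r) \<partial>lborel)"
    by (rule nn_integral_cong) (auto split: split_indicator)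
  finally show ?thesis .
qed

lemma modulus_mono: "\<Gamma> \<subseteq> \<Gamma>' \<Longrightarrow> modulus q M \<Gamma> \<le> modulus q M \<Gamma>'"
  unfolding modulus_def by (rule INF_superset_mono) auto

text \<open>
  \<open>P\<close> holds for \<open>q\<close>-almost every nonconstant rectifiable path in \<open>A\<close>.
\<close>

definition curve_ae :: "real \<Rightarrow> 'a::metric_space measure \<Rightarrow> 'a set \<Rightarrow> ((real \<Rightarrow> 'a) \<Rightarrow> bool) \<Rightarrow> bool" where
  "curve_ae q M A P \<longleftrightarrow> modulus q M {\<gamma> \<in> curves_in A. \<not> P \<gamma>} = 0"

lemma curve_ae_iff: "curve_ae q M A P \<longleftrightarrow> (\<exists>\<Gamma>. modulus q M \<Gamma> = 0 \<and> (\<forall>\<gamma> \<in> curves_in A - \<Gamma>. P \<gamma>))"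
proof
  assume "curve_ae q M A P"
  then show "\<exists>\<Gamma>. modulus q M \<Gamma> = 0 \<and> (\<forall>\<gamma> \<in> curves_in A - \<Gamma>. P \<gamma>)"
    unfolding curve_ae_def by (intro exI[of _ "{\<gamma> \<in> curves_in A. \<not> P \<gamma>}"]) auto
next
  assume "\<exists>\<Gamma>. modulus q M \<Gamma> = 0 \<and> (\<forall>\<gamma> \<in> curves_in A - \<Gamma>. P \<gamma>)"
  then obtain \<Gamma> where \<Gamma>: "modulus q M \<Gamma> = 0" "\<forall>\<gamma> \<in> curves_in A - \<Gamma>. P \<gamma>" by auto
  then have "modulus q M {\<gamma> \<in> curves_in A. \<not> P \<gamma>} \<le> modulus q M \<Gamma>" by (intro modulus_mono) auto
  with \<Gamma> show "curve_ae q M A P" by (simp add: curve_ae_def)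
qed

lemma curve_ae_mono:
  assumes "curve_ae q M A P" "\<And>\<gamma>. \<gamma> \<in> curves_in A \<Longrightarrow> P \<gamma> \<Longrightarrow> Q \<gamma>"
  shows "curve_ae q M A Q"
proof -
  have "modulus q M {\<gamma> \<in> curves_in A. \<not> Q \<gamma>} \<le> modulus q M {\<gamma> \<in> curves_in A. \<not> P \<gamma>}"
    by (rule modulus_mono) (use assms(2) in auto)
  then show ?thesis using assms(1) by (simp add: curve_ae_def)
qed

lemma curves_in_mono: "A \<subseteq> B \<Longrightarrow> curves_in A \<subseteq> curves_in B"
  by (auto simp: curves_in_def)

lemma curve_ae_subset:
  assumes "curve_ae q M B P" "A \<subseteq> B"
  shows "curve_ae q M A P"
proof -
  have "modulus q M {\<gamma> \<in> curves_in A. \<not> P \<gamma>} \<le> modulus q M {\<gamma> \<in> curves_in B. \<not> P \<gamma>}"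
    by (rule modulus_mono) (use curves_in_mono[OF assms(2)] in auto)
  then show ?thesis using assms(1) by (simp add: curve_ae_def)
qed

lemma curve_ae_countable:
  fixes P :: "nat \<Rightarrow> (real \<Rightarrow> 'a::metric_space) \<Rightarrow> bool"
  assumes M: "sets M = sets borel" and q: "0 < q" and ae: "\<And>i. curve_ae q M A (P i)"
  shows "curve_ae q M A (\<lambda>\<gamma>. \<forall>i. P i \<gamma>)"
proof -
  let ?\<Gamma> = "\<lambda>i. {\<gamma> \<in> curves_in A. \<not> P i \<gamma>}"
  let ?U = "{\<gamma> \<in> curves_in A. \<not> (\<forall>i. P i \<gamma>)}"
  have "modulus q M ?U \<le> ennreal e" if e: "0 < e" for e
  proof -
    have "\<forall>i. \<exists>\<rho>. \<rho> \<in> borel_measurable borel \<and> (\<forall>\<gamma>\<in>?\<Gamma> i. 1 \<le> line_integral \<rho> \<gamma>) \<and>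
        (\<integral>\<^sup>+x. epowr (\<rho> x) q \<partial>M) < ennreal (e * (1/2) ^ Suc i)" (is "\<forall>i. ?E i")
    proof
      fix i
      have "modulus q M (?\<Gamma> i) < ennreal (e * (1/2) ^ Suc i)"
        using ae[of i] e by (simp add: curve_ae_def)
      then show "?E i" unfolding modulus_def INF_less_iff by auto
    qed
    from choice[OF this] obtain \<rho> where \<rho>: "\<forall>i. \<rho> i \<in> borel_measurable borel \<and> (\<forall>\<gamma>\<in>?\<Gamma> i. 1
        \<le> line_integral (\<rho> i) \<gamma>) \<and>
        (\<integral>\<^sup>+x. epowr (\<rho> i x) q \<partial>M) < ennreal (e * (1/2) ^ Suc i)" ..
    then have [measurable]: "\<rho> i \<in> borel_measurable borel" for i by (rule allE) (erule conjunct1)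
    have adm: "1 \<le> line_integral (\<rho> i) \<gamma>" if "\<gamma> \<in> ?\<Gamma> i" for i \<gamma>
      using \<rho>[THEN spec, of i] that by simp
    have int: "(\<integral>\<^sup>+x. epowr (\<rho> i x) q \<partial>M) < ennreal (e * (1/2) ^ Suc i)" for i
      using \<rho>[THEN spec, of i] by simp
    define \<sigma> where "\<sigma> x = (SUP i. \<rho> i x)" for x
    have [measurable]: "\<sigma> \<in> borel_measurable borel" unfolding \<sigma>_def by measurable
    have "1 \<le> line_integral \<sigma> \<gamma>" if U: "\<gamma> \<in> ?U" for \<gamma>
    proof -
      obtain i where "\<gamma> \<in> ?\<Gamma> i" using U by auto
      moreover have "line_integral (\<rho> i) \<gamma> \<le> line_integral \<sigma> \<gamma>"
        by (rule line_integral_mono[of _ A]) (use U in \<open>auto simp: \<sigma>_def intro: SUP_upper\<close>)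
      ultimately show ?thesis using adm order_trans by blast
    qed
    then have "modulus q M ?U \<le> (\<integral>\<^sup>+x. epowr (\<sigma> x) q \<partial>M)"
      unfolding modulus_def by (intro INF_lower) auto
    also have "\<dots> \<le> (\<integral>\<^sup>+x. (\<Sum>i. epowr (\<rho> i x) q) \<partial>M)"
      unfolding \<sigma>_def by (intro nn_integral_mono epowr_SUP_le_suminf q)
    also have "\<dots> = (\<Sum>i. \<integral>\<^sup>+x. epowr (\<rho> i x) q \<partial>M)"
      by (rule nn_integral_suminf) (simp add: measurable_cong_sets[OF M refl])
    also have "\<dots> \<le> (\<Sum>i. ennreal (e * (1/2) ^ Suc i))"
      by (intro suminf_le less_imp_le[OF int]) auto
    also have "\<dots> = ennreal e"
      using e sums_mult[OF power_half_series, of e] by (intro suminf_ennreal_eq) auto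
    finally show ?thesis .
  qed
  then have "modulus q M ?U = 0" by (rule ennreal_eq_0I)
  then show ?thesis by (simp add: curve_ae_def)
qed

lemma curve_ae_conj:
  fixes P :: "(real \<Rightarrow> 'a::metric_space) \<Rightarrow> bool"
  assumes M: "sets M = sets borel" and q: "0 < q" and "curve_ae q M A P" "curve_ae q M A Q"
  shows "curve_ae q M A (\<lambda>\<gamma>. P \<gamma> \<and> Q \<gamma>)"
proof -
  have "curve_ae q M A (\<lambda>\<gamma>. \<forall>i. if i = (0::nat) then P \<gamma> else Q \<gamma>)"
  proof (rule curve_ae_countable[OF M q])
    fix i :: nat
    show "curve_ae q M A (\<lambda>\<gamma>. if i = 0 then P \<gamma> else Q \<gamma>)"
      by (cases "i = 0") (simp_all add: assms)
  qed
  then show ?thesis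
    by (rule curve_ae_mono) (metis zero_neq_one)
qed

lemma curve_ae_line_integral_finite:
  assumes M: "sets M = sets borel" and q: "0 < q" and g[measurable]: "g \<in> borel_measurable borel"
    and fin: "(\<integral>\<^sup>+x. epowr (g x) q \<partial>M) < \<infinity>"
  shows "curve_ae q M A (\<lambda>\<gamma>. line_integral g \<gamma> < \<infinity>)"
proof -
  let ?\<Gamma> = "{\<gamma> \<in> curves_in A. \<not> line_integral g \<gamma> < \<infinity>}"
  have gM: "(\<lambda>x. epowr (g x) q) \<in> borel_measurable M" by (simp add: measurable_cong_sets[OF M refl])
  obtain I where I: "(\<integral>\<^sup>+x. epowr (g x) q \<partial>M) = ennreal I" "0 \<le> I"
    using fin by (cases "\<integral>\<^sup>+x. epowr (g x) q \<partial>M") auto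
  have le: "modulus q M ?\<Gamma> \<le> ennreal (e powr q * I)" if e: "0 < e" for e
  proof -
    have "modulus q M ?\<Gamma> \<le> (\<integral>\<^sup>+x. epowr (ennreal e * g x) q \<partial>M)"
      unfolding modulus_def
    proof (intro INF_lower CollectI conjI ballI)
      fix \<gamma> assume "\<gamma> \<in> ?\<Gamma>"
      then have \<gamma>: "\<gamma> \<in> curves_in A" and "line_integral g \<gamma> = top" by (auto simp: less_top[symmetric])
      then show "1 \<le> line_integral (\<lambda>x. ennreal e * g x) \<gamma>"
        using e by (simp add: line_integral_cmult[OF \<gamma> g] ennreal_mult_top)
    qed measurable
    also have "\<dots> = ennreal (e powr q) * ennreal I"
      using e by (simp add: epowr_cmult nn_integral_cmult[OF gM] I)
    finally show ?thesis by (simp add: ennreal_mult I)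
  qed
  have "modulus q M ?\<Gamma> \<le> ennreal d" if d: "0 < d" for d
  proof -
    define e where "e = (d / (I + 1)) powr (1 / q)"
    have "e powr q = d / (I + 1)" using q d I by (simp add: e_def powr_powr)
    moreover have "0 < e" using d I by (simp add: e_def)
    ultimately have "modulus q M ?\<Gamma> \<le> ennreal (d / (I + 1) * I)" using le[of e] by simp
    also have "\<dots> \<le> ennreal d" using d I by (intro ennreal_leI) (simp add: field_simps)
    finally show ?thesis .
  qed
  then have "modulus q M ?\<Gamma> = 0" by (rule ennreal_eq_0I)
  then show ?thesis by (simp add: curve_ae_def)
qed

text \<open>
  The function that is infinite on \<open>N\<close> and zero elsewhere has zero norm, so its line integral is finite
  along almost every path.
\<close>

lemma curve_ae_null:
  assumes M: "sets M = sets borel" and q: "0 < q" and N: "N \<in> null_sets M"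
  shows "curve_ae q M A (\<lambda>\<gamma>. AE s in lborel. s \<in> {0..arc_len \<gamma>} \<longrightarrow> arc_param \<gamma> s \<notin> N)"
proof -
  have [measurable]: "N \<in> sets borel" using N M by auto
  define g where "g x = (top * indicator N x :: ennreal)" for x :: 'a
  have g[measurable]: "g \<in> borel_measurable borel" unfolding g_def by measurable
  have "AE x in M. g x = 0" using AE_not_in[OF N] by eventually_elim (auto simp: g_def)
  then have "(\<integral>\<^sup>+x. epowr (g x) q \<partial>M) = (\<integral>\<^sup>+x. 0 \<partial>M)" by (intro nn_integral_cong_AE) auto
  then have "curve_ae q M A (\<lambda>\<gamma>. line_integral g \<gamma> < \<infinity>)"
    by (intro curve_ae_line_integral_finite[OF M q g]) simp
  then show ?thesis
  proof (rule curve_ae_mono)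
    fix \<gamma> assume \<gamma>: "\<gamma> \<in> curves_in A" and fin: "line_integral g \<gamma> < \<infinity>"
    note [measurable] = measurable_arc_clamp[OF \<gamma>]
    have "AE s in lborel. g (arc_clamp \<gamma> s) * indicator {0..arc_len \<gamma>} s \<noteq> \<infinity>"
      by (rule nn_integral_PInf_AE) (use fin in \<open>auto simp: line_integral_clamp\<close>)
    then show "AE s in lborel. s \<in> {0..arc_len \<gamma>} \<longrightarrow> arc_param \<gamma> s \<notin> N"
      by eventually_elim (auto simp: g_def arc_clamp_eq split: split_indicator_asm)
  qed
qed

text \<open>
  A function admissible for a family of paths is admissible for the paths having a subpath in this
  family. Subpaths are recognized by their arc length parametrization.
\<close>

lemma curve_ae_sub:
  assumes "curve_ae q M A P"
  shows "curve_ae q M B (\<lambda>\<gamma>. \<forall>\<gamma>' \<in> curves_in A. \<forall>s t. 0 \<le> s \<longrightarrow> s < t \<longrightarrow> t \<le> arc_len \<gamma> \<longrightarrow> arc_len \<gamma>'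
      = t - s \<longrightarrow>
    (\<forall>r\<in>{0..t - s}. arc_param \<gamma>' r = arc_param \<gamma> (s + r)) \<longrightarrow> P \<gamma>')" (is "curve_ae q M B ?Q")
proof -
  let ?\<Gamma> = "{\<gamma> \<in> curves_in A. \<not> P \<gamma>}"
  let ?\<Delta> = "{\<gamma> \<in> curves_in B. \<not> ?Q \<gamma>}"
  have "modulus q M ?\<Delta> \<le> modulus q M ?\<Gamma>"
    unfolding modulus_def
  proof (rule INF_superset_mono)
    show "{\<rho> \<in> borel_measurable borel. \<forall>\<gamma>\<in>?\<Gamma>. 1
        \<le> line_integral \<rho> \<gamma>} \<subseteq> {\<rho> \<in> borel_measurable borel. \<forall>\<gamma>\<in>?\<Delta>. 1 \<le> line_integral \<rho> \<gamma>}"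
    proof (intro subsetI CollectI conjI ballI; elim CollectE conjE)
      fix \<rho> :: "'a \<Rightarrow> ennreal" and \<gamma>
      assume [measurable]: "\<rho> \<in> borel_measurable borel" and adm: "\<forall>\<gamma>\<in>?\<Gamma>. 1 \<le> line_integral \<rho> \<gamma>"
        and \<gamma>: "\<gamma> \<in> curves_in B" and nQ: "\<not> ?Q \<gamma>"
      obtain \<gamma>' s t where \<gamma>': "\<gamma>' \<in> curves_in A" and st: "0 \<le> s" "s < t" "t \<le> arc_len \<gamma>"
        and len: "arc_len \<gamma>' = t - s" and eq: "\<forall>r\<in>{0..t - s}. arc_param \<gamma>' r = arc_param \<gamma> (s + r)"
            and nP: "\<not> P \<gamma>'"
        using nQ by blast
      note [measurable] = measurable_arc_clamp[OF \<gamma>] measurable_arc_clamp[OF \<gamma>']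
      have "1 \<le> line_integral \<rho> \<gamma>'" using adm \<gamma>' nP by auto
      also have "\<dots> = (\<integral>\<^sup>+r\<in>{0..t - s}. \<rho> (arc_clamp \<gamma> (s + r)) \<partial>lborel)"
        unfolding line_integral_eq len
        by (rule nn_integral_cong) (use eq st in \<open>auto simp: arc_clamp_eq split: split_indicator\<close>)
      also have "\<dots> = (\<integral>\<^sup>+r\<in>{s..t}. \<rho> (arc_clamp \<gamma> r) \<partial>lborel)"
        by (rule set_nn_integral_shift[symmetric]) measurable
      also have "\<dots> \<le> line_integral \<rho> \<gamma>"
        unfolding line_integral_clamp by (rule set_nn_integral_mono_set) (use st in auto)
      finally show "1 \<le> line_integral \<rho> \<gamma>" .
    qed
  qed simp
  with assms show ?thesis by (simp add: curve_ae_def)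
qed

section \<open>Weak upper gradients of real functions\<close>

text \<open>
  The balls of radius \<open>e / 2\<close> around the points of \<open>S\<close> are disjoint, so a ball of finite measure
  contains only finitely many of them whose measure exceeds a given positive number.
\<close>

lemma separated_set_countable:
  fixes S :: "'a::metric_space set" and M :: "'a measure"
  assumes M: "sets M = sets borel" and pos: "\<And>x r. 0 < r \<Longrightarrow> 0 < emeasure M (ball x r)"
    and fin: "\<And>x r. emeasure M (ball x r) < \<infinity>"
    and e: "0 < e" and sep: "\<And>x y. x \<in> S \<Longrightarrow> y \<in> S \<Longrightarrow> x \<noteq> y \<Longrightarrow> e \<le> dist x y"
  shows "countable S"
proof -
  fix x0 :: 'a
  define T where "T n m = {x \<in> S. dist x0 x < real n \<and> 1 / real (Suc m)
      \<le> measure M (ball x (e / 2))}" for n m :: nat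
  have sets[measurable]: "ball x r \<in> sets M" for x r by (simp add: M)
  have finT: "finite (T n m)" for n m
  proof (rule ccontr)
    assume inf: "infinite (T n m)"
    define K where "K = measure M (ball x0 (real n + e))"
    obtain N :: nat where N: "real (Suc m) * K < real N" using reals_Archimedean2 by blast
    obtain F where F: "F \<subseteq> T n m" "finite F" "card F = N" using infinite_arbitrarily_large[OF inf]
      by blast
    have disj: "disjoint_family_on (\<lambda>x. ball x (e / 2)) F"
      unfolding disjoint_family_on_def
    proof (intro ballI impI)
      fix x y assume xy: "x \<in> F" "y \<in> F" "x \<noteq> y"
      then have d: "e \<le> dist x y" using F by (intro sep) (auto simp: T_def)
      show "ball x (e / 2) \<inter> ball y (e / 2) = {}"
      proof (rule ccontr)
        assume "ball x (e / 2) \<inter> ball y (e / 2) \<noteq> {}"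
        then obtain z where "dist x z < e / 2" "dist y z < e / 2" by auto
        then show False using d dist_triangle[of x y z] by (simp add: dist_commute)
      qed
    qed
    have "real N / real (Suc m) = (\<Sum>x\<in>F. 1 / real (Suc m))" using F by simp
    also have "\<dots> \<le> (\<Sum>x\<in>F. measure M (ball x (e / 2)))"
      by (rule sum_mono) (use F in \<open>auto simp: T_def\<close>)
    also have "\<dots> = measure M (\<Union>x\<in>F. ball x (e / 2))"
      using F disj fin by (intro measure_finite_Union[symmetric]) (auto simp: less_top[symmetric])
    also have "\<dots> \<le> K"
      unfolding K_def
    proof (rule measure_mono_fmeasurable)
      show "(\<Union>x\<in>F. ball x (e / 2)) \<subseteq> ball x0 (real n + e)"
      proof safe
        fix x z assume "x \<in> F" "z \<in> ball x (e / 2)"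
        then have "dist x0 x < real n" "dist x z < e / 2" using F by (auto simp: T_def)
        then show "z \<in> ball x0 (real n + e)" using dist_triangle[of x0 z x] e by simp
      qed
      show "ball x0 (real n + e) \<in> fmeasurable M" using fin by (intro fmeasurableI) auto
    qed (use F in auto)
    finally have "real N \<le> real (Suc m) * K" by (simp add: field_simps)
    with N show False by simp
  qed
  have "S \<subseteq> (\<Union>n m. T n m)"
  proof
    fix x assume x: "x \<in> S"
    obtain n :: nat where n: "dist x0 x < real n" using reals_Archimedean2 by blast
    have "0 < measure M (ball x (e / 2))"
      using pos[of "e / 2" x] e fin[of x "e / 2"] by (simp add: measure_def enn2real_positive_iff)
    then obtain m :: nat where "1 / real (Suc m) < measure M (ball x (e / 2))"
      using reals_Archimedean[of "measure M (ball x (e / 2))"] by (auto simp: inverse_eq_divide)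
    then have "x \<in> T n m" using x n by (simp add: T_def)
    then show "x \<in> (\<Union>n m. T n m)" by blast
  qed
  moreover have "countable (\<Union>n m. T n m)" by (simp add: countable_finite finT)
  ultimately show ?thesis by (rule countable_subset)
qed

text \<open>
  The space carries a doubling measure; \<open>q\<close> is the exponent for modulus, upper gradients and capacity.
\<close>

locale doubling_space =
  fixes M :: "'a::metric_space measure" and q :: real
  assumes doubling: "doubling_measure M" and q: "1 < q"
begin

lemma q_pos: "0 < q" using q by simp

lemma sets_M [simp, measurable_cong]: "sets M = sets borel"
  using doubling by (simp add: doubling_measure_def)

lemma space_M [simp]: "space M = UNIV"
  using sets_eq_imp_space_eq[OF sets_M] by simp

lemma emeasure_ball_pos: "0 < r \<Longrightarrow> 0 < emeasure M (ball x r)"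
  using doubling unfolding doubling_measure_def by (metis half_gt_zero mult_2 field_sum_of_halves)

lemma emeasure_ball_finite: "emeasure M (ball x r) < \<infinity>"
proof (cases "0 < r")
  case True
  obtain C :: real where C: "\<And>y r. 0 < r \<Longrightarrow> 0 < emeasure M (ball y (2 * r)) \<and>
        emeasure M (ball y (2 * r)) \<le> ennreal C * emeasure M (ball y r) \<and>
        ennreal C * emeasure M (ball y r) < \<infinity>"
    using doubling by (auto simp: doubling_measure_def)
  show ?thesis
    using C[of "r / 2" x] True by (auto intro: le_less_trans)
next
  case False
  then show ?thesis by (simp add: ball_empty)
qed

lemma emeasure_open_pos:
  assumes "open A" "A \<noteq> {}"
  shows "0 < emeasure M A"
proof -
  obtain x where "x \<in> A" using assms by auto
  then obtain r where r: "0 < r" "ball x r \<subseteq> A" using assms openE by blast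
  have "0 < emeasure M (ball x r)" using r emeasure_ball_pos by auto
  also have "\<dots> \<le> emeasure M A" by (rule emeasure_mono) (use r assms in auto)
  finally show ?thesis .
qed

lemma countable_dense_exists:
  obtains D :: "'a set" where "countable D" "\<And>x r. 0 < r \<Longrightarrow> \<exists>d\<in>D. dist x d < r"
proof -
  have "\<exists>S :: 'a set. (\<forall>x\<in>S. \<forall>y\<in>S. x \<noteq> y \<longrightarrow> e \<le> dist x y) \<and> (\<forall>x. \<exists>d\<in>S. dist x d < e)" if e: "0 < e" for e
  proof -
    define \<A> where "\<A> = {S :: 'a set. \<forall>x\<in>S. \<forall>y\<in>S. x \<noteq> y \<longrightarrow> e \<le> dist x y}"
    have "\<exists>S\<in>\<A>. \<forall>X\<in>\<A>. S \<subseteq> X \<longrightarrow> X = S"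
    proof (rule subset_Zorn')
      fix C assume C: "subset.chain \<A> C"
      show "\<Union>C \<in> \<A>"
        unfolding \<A>_def
      proof (intro CollectI ballI impI)
        fix x y assume "x \<in> \<Union>C" "y \<in> \<Union>C" "x \<noteq> y"
        then obtain X Y where XY: "X \<in> C" "Y \<in> C" "x \<in> X" "y \<in> Y" by auto
        then have "X \<subseteq> Y \<or> Y \<subseteq> X" using C by (auto simp: subset_chain_def)
        then obtain Z where "Z \<in> C" "x \<in> Z" "y \<in> Z" using XY by blast
        then show "e \<le> dist x y" using C \<open>x \<noteq> y\<close> by (auto simp: subset_chain_def \<A>_def)
      qed
    qed
    then obtain S where S: "S \<in> \<A>" and max: "\<And>X. X \<in> \<A> \<Longrightarrow> S \<subseteq> X \<Longrightarrow> X = S" by blast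
    have "\<exists>d\<in>S. dist x d < e" for x
    proof (rule ccontr)
      assume n: "\<not> (\<exists>d\<in>S. dist x d < e)"
      then have "insert x S \<in> \<A>" using S by (auto simp: \<A>_def dist_commute not_less)
      then have "x \<in> S" using max by blast
      with n e show False by auto
    qed
    moreover have "\<forall>x\<in>S. \<forall>y\<in>S. x \<noteq> y \<longrightarrow> e \<le> dist x y" using S unfolding \<A>_def by (rule CollectD)
    ultimately show ?thesis by blast
  qed
  then have "\<forall>k. \<exists>S :: 'a set. (\<forall>x\<in>S. \<forall>y\<in>S. x \<noteq> y \<longrightarrow> inverse (real (Suc k)) \<le> dist x y)
      \<and> (\<forall>x. \<exists>d\<in>S. dist x d < inverse (real (Suc k)))"
    by simp
  from choice[OF this] obtain S :: "nat \<Rightarrow> 'a set" where S_all: "\<forall>k. (\<forall>x\<in>S k. \<forall>y\<in>S k. x \<noteq> y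
      \<longrightarrow> inverse (real (Suc k)) \<le> dist x y) \<and>
      (\<forall>x. \<exists>d\<in>S k. dist x d < inverse (real (Suc k)))" ..
  have S: "x \<in> S k \<Longrightarrow> y \<in> S k \<Longrightarrow> x \<noteq> y \<Longrightarrow> inverse (real (Suc k)) \<le> dist x y"
    "\<exists>d\<in>S k. dist z d < inverse (real (Suc k))" for k x y z
    using S_all[rule_format, of k] by simp_all
  have "countable (S k)" for k
    by (rule separated_set_countable[OF sets_M emeasure_ball_pos emeasure_ball_finite, of
        "inverse (real (Suc k))"]) (use S in auto)
  then have "countable (\<Union>k. S k)" by auto
  moreover have "\<exists>d\<in>(\<Union>k. S k). dist x d < r" if r: "0 < r" for x r
  proof -
    obtain k where "inverse (real (Suc k)) < r" using reals_Archimedean[OF r] by auto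
    moreover obtain d where "d \<in> S k" "dist x d < inverse (real (Suc k))" using S(2) by blast
    ultimately show ?thesis by force
  qed
  ultimately show ?thesis using that by blast
qed

lemmas curve_ae_conj' = curve_ae_conj[OF sets_M q_pos]
lemmas curve_ae_finite = curve_ae_line_integral_finite[OF sets_M q_pos]

lemma curve_ae_countable_ball:
  assumes "countable I" "\<And>i. i \<in> I \<Longrightarrow> curve_ae q M A (P i)"
  shows "curve_ae q M A (\<lambda>\<gamma>. \<forall>i\<in>I. P i \<gamma>)"
proof (cases "I = {}")
  case True
  then show ?thesis
    using curve_ae_finite[of "\<lambda>_. 0" A] by (auto intro: curve_ae_mono)
next
  case False
  have "curve_ae q M A (\<lambda>\<gamma>. \<forall>n. P (from_nat_into I n) \<gamma>)"
    by (intro curve_ae_countable[OF sets_M q_pos] assms(2) from_nat_into False)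
  then show ?thesis
  proof (rule curve_ae_mono, intro ballI)
    fix \<gamma> i assume all: "\<forall>n. P (from_nat_into I n) \<gamma>" and "i \<in> I"
    then obtain n where "from_nat_into I n = i" using from_nat_into_surj[OF assms(1)] by blast
    then show "P i \<gamma>" using all by auto
  qed
qed

lemma curve_ae_AE:
  assumes "AE x in M. P x"
  shows "curve_ae q M A (\<lambda>\<gamma>. AE s in lborel. s \<in> {0..arc_len \<gamma>} \<longrightarrow> P (arc_clamp \<gamma> s))"
proof -
  obtain N where N: "{x \<in> space M. \<not> P x} \<subseteq> N" "N \<in> null_sets M"
    using assms unfolding eventually_ae_filter by blast
  show ?thesis
  proof (rule curve_ae_mono[OF curve_ae_null[OF sets_M q_pos N(2)]])
    fix \<gamma> assume "AE s in lborel. s \<in> {0..arc_len \<gamma>} \<longrightarrow> arc_param \<gamma> s \<notin> N"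
    then show "AE s in lborel. s \<in> {0..arc_len \<gamma>} \<longrightarrow> P (arc_clamp \<gamma> s)"
      by eventually_elim (use N in \<open>auto simp: arc_clamp_eq\<close>)
  qed
qed

text \<open>
  A separable space is Lindelof, so \<open>A\<close> is covered
    by countably many balls \<open>B\<close> such that \<open>h\<close> is integrable
  to the power \<open>q\<close> on \<open>A \<inter> B\<close>, and the image of a path is covered by finitely many of these.
\<close>

lemma curve_ae_finite_local:
  assumes A: "open A" and h[measurable]: "h \<in> borel_measurable borel"
    and loc: "(\<lambda>x. enn2ereal (h x)) \<in> Lspace_loc q M A"
  shows "curve_ae q M A (\<lambda>\<gamma>. line_integral h \<gamma> < \<infinity>)"
proof -
  obtain D :: "'a set" where D: "countable D" "\<And>x r. 0 < r \<Longrightarrow> \<exists>d\<in>D. dist x d < r"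
    using countable_dense_exists by blast
  define B where "B i = (case i of (d, k) \<Rightarrow> ball d (inverse (real (Suc k))))" for i :: "'a \<times> nat"
  define k where "k i x = h x * indicator (A \<inter> B i) x" for i x
  define I where "I = {i \<in> D \<times> UNIV. (\<integral>\<^sup>+x. epowr (k i x) q \<partial>M) < \<infinity>}"
  have opB: "open (B i)" for i by (auto simp: B_def split: prod.split)
  have [measurable]: "A \<inter> B i \<in> sets borel" for i using A opB by auto
  have k[measurable]: "k i \<in> borel_measurable borel" for i unfolding k_def by measurable
  have I: "countable I" using D(1) by (rule countable_subset[rotated, OF countable_SIGMA[of D
      "\<lambda>_. UNIV :: nat set"]]) (auto simp: I_def)
  have cover: "A \<subseteq> (\<Union>i\<in>I. B i)"
  proof
    fix x assume "x \<in> A"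
    then obtain \<delta> where \<delta>: "0 < \<delta>" "(\<lambda>x. enn2ereal (h x)) \<in> Lspace q M (A \<inter> ball x \<delta>)"
      using loc by (auto simp: Lspace_loc_def)
    then have fin: "(\<integral>\<^sup>+y. epowr (h y) q * indicator (A \<inter> ball x \<delta>) y \<partial>M) < \<infinity>"
      by (simp add: Lspace_def nn_integral_completion)
    obtain n where n: "inverse (real (Suc n)) < \<delta> / 2" using reals_Archimedean[of "\<delta> / 2"] \<delta> by auto
    obtain d where d: "d \<in> D" "dist x d < inverse (real (Suc n))"
      using D(2)[of "inverse (real (Suc n))" x] by auto
    have "B (d, n) \<subseteq> ball x \<delta>"
    proof
      fix y assume "y \<in> B (d, n)"
      then have "dist d y < inverse (real (Suc n))" by (simp add: B_def)
      then show "y \<in> ball x \<delta>" using d n dist_triangle[of x y d] by simp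
    qed
    then have "(\<integral>\<^sup>+y. epowr (k (d, n) y) q \<partial>M) \<le> (\<integral>\<^sup>+y. epowr (h y) q * indicator (A \<inter> ball x \<delta>) y \<partial>M)"
      by (intro nn_integral_mono) (auto simp: k_def split: split_indicator)
    then have "(d, n) \<in> I" using fin d by (auto simp: I_def intro: le_less_trans)
    moreover have "x \<in> B (d, n)" using d by (simp add: B_def dist_commute)
    ultimately show "x \<in> (\<Union>i\<in>I. B i)" by blast
  qed
  have "curve_ae q M A (\<lambda>\<gamma>. \<forall>i\<in>I. line_integral (k i) \<gamma> < \<infinity>)"
    by (intro curve_ae_countable_ball I curve_ae_finite k) (simp add: I_def)
  then show ?thesis
  proof (rule curve_ae_mono)
    fix \<gamma> assume \<gamma>: "\<gamma> \<in> curves_in A" and fin: "\<forall>i\<in>I. line_integral (k i) \<gamma> < \<infinity>"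
    note [measurable] = measurable_arc_clamp[OF \<gamma>]
    have "compact (path_image \<gamma>)" using curves_inD(1)[OF \<gamma>] by (rule compact_path_image)
    then obtain F where F: "F \<subseteq> I" "finite F" "path_image \<gamma> \<subseteq> (\<Union>i\<in>F. B i)"
      using compactE_image[of "path_image \<gamma>" I B] opB cover curves_inD(2)[OF \<gamma>] by (metis subset_trans)
    have in_path: "arc_clamp \<gamma> s \<in> path_image \<gamma>" for s
    proof (rule arc_clamp_in)
      show "\<gamma> \<in> curves_in (path_image \<gamma>)" using \<gamma> by (auto simp: curves_in_def)
    qed
    have "line_integral h \<gamma> \<le> (\<integral>\<^sup>+s. (\<Sum>i\<in>F. k i (arc_clamp \<gamma> s) * indicator {0..arc_len \<gamma>} s) \<partial>lborel)"
      unfolding line_integral_clamp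
    proof (rule nn_integral_mono)
      fix s
      obtain i where i: "i \<in> F" "arc_clamp \<gamma> s \<in> B i" using in_path[of s] F by blast
      have "h (arc_clamp \<gamma> s) * indicator {0..arc_len \<gamma>} s
          = k i (arc_clamp \<gamma> s) * indicator {0..arc_len \<gamma>} s"
        using i arc_clamp_in[OF \<gamma>, of s] by (simp add: k_def)
      also have "\<dots> \<le> (\<Sum>i\<in>F. k i (arc_clamp \<gamma> s) * indicator {0..arc_len \<gamma>} s)"
        using F i by (intro member_le_sum) auto
      finally show "h (arc_clamp \<gamma> s) * indicator {0..arc_len \<gamma>} s
          \<le> (\<Sum>i\<in>F. k i (arc_clamp \<gamma> s) * indicator {0..arc_len \<gamma>} s)" .
    qed
    also have "\<dots> = (\<Sum>i\<in>F. line_integral (k i) \<gamma>)"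
      unfolding line_integral_clamp by (rule nn_integral_sum) measurable
    also have "\<dots> < \<infinity>" using fin F by (auto simp: less_top[symmetric])
    finally show "line_integral h \<gamma> < \<infinity>" .
  qed
qed

text \<open>
  Every subpath of \<open>\<gamma>\<close> that lies in \<open>A\<close> satisfies \<open>P\<close>; more precisely, among the paths that have the
  same arc length parametrization as this subpath, one satisfies \<open>P\<close>.
\<close>

definition subcurves_satisfy :: "'a set \<Rightarrow> ((real \<Rightarrow> 'a) \<Rightarrow> bool) \<Rightarrow> (real \<Rightarrow> 'a) \<Rightarrow> bool" where
  "subcurves_satisfy A P \<gamma> \<longleftrightarrow>
     (\<forall>s t. 0 \<le> s \<longrightarrow> s < t \<longrightarrow> t \<le> arc_len \<gamma> \<longrightarrow> arc_clamp \<gamma> ` {s..t} \<subseteq> A \<longrightarrow>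
       (\<exists>\<gamma>'\<in>curves_in A. P \<gamma>' \<and> arc_len \<gamma>' = t - s \<and>
          (\<forall>r\<in>{0..t - s}. arc_clamp \<gamma>' r = arc_clamp \<gamma> (s + r))))"

lemma curve_ae_subcurves_satisfy:
  assumes "curve_ae q M A P"
  shows "curve_ae q M B (subcurves_satisfy A P)"
  using curve_ae_sub[OF assms]
proof (rule curve_ae_mono)
  fix \<gamma>
  assume \<gamma>: "\<gamma> \<in> curves_in B"
    and P: "\<forall>\<gamma>' \<in> curves_in A. \<forall>s t. 0 \<le> s \<longrightarrow> s < t \<longrightarrow> t \<le> arc_len \<gamma> \<longrightarrow> arc_len \<gamma>' = t - s \<longrightarrow>
      (\<forall>r\<in>{0..t - s}. arc_param \<gamma>' r = arc_param \<gamma> (s + r)) \<longrightarrow> P \<gamma>'"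
  show "subcurves_satisfy A P \<gamma>"
    unfolding subcurves_satisfy_def
  proof (intro allI impI)
    fix s t :: real
    assume st: "0 \<le> s" "s < t" "t \<le> arc_len \<gamma>" and sub: "arc_clamp \<gamma> ` {s..t} \<subseteq> A"
    obtain \<gamma>' where \<gamma>': "\<gamma>' \<in> curves_in (arc_param \<gamma> ` {s..t})" "arc_len \<gamma>' = t - s"
      "\<And>r. r \<in> {0..t - s} \<Longrightarrow> arc_param \<gamma>' r = arc_param \<gamma> (s + r)"
      using arc_param_subcurve[OF curves_inD(1,3)[OF \<gamma>] st] by metis
    have "arc_param \<gamma> ` {s..t} = arc_clamp \<gamma> ` {s..t}" using st
      by (intro image_cong) (auto simp: arc_clamp_eq)
    then have A: "\<gamma>' \<in> curves_in A" using \<gamma>'(1) curves_in_mono[OF sub] by auto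
    have "arc_clamp \<gamma>' r = arc_clamp \<gamma> (s + r)" if "r \<in> {0..t - s}" for r
      using \<gamma>'(2) \<gamma>'(3)[OF that] that st by (simp add: arc_clamp_eq)
    moreover have "P \<gamma>'" using P A st \<gamma>' by blast
    ultimately show "\<exists>\<gamma>'\<in>curves_in A. P \<gamma>' \<and> arc_len \<gamma>' = t - s \<and>
        (\<forall>r\<in>{0..t - s}. arc_clamp \<gamma>' r = arc_clamp \<gamma> (s + r))"
      using A \<gamma>'(2) by blast
  qed
qed

lemma subcurves_satisfyE:
  assumes "subcurves_satisfy A P \<gamma>" and \<gamma>: "\<gamma> \<in> curves_in B"
    and st: "0 \<le> s" "s < t" "t \<le> arc_len \<gamma>" and sub: "arc_clamp \<gamma> ` {s..t} \<subseteq> A"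
  obtains \<gamma>' where "\<gamma>' \<in> curves_in A" "P \<gamma>'" "arc_len \<gamma>' = t - s"
    "\<And>r. r \<in> {0..t - s} \<Longrightarrow> arc_clamp \<gamma>' r = arc_clamp \<gamma> (s + r)"
    "pathstart \<gamma>' = arc_clamp \<gamma> s" "pathfinish \<gamma>' = arc_clamp \<gamma> t"
    "\<And>g. g \<in> borel_measurable borel \<Longrightarrow> line_integral g \<gamma>' = (\<integral>\<^sup>+x\<in>{s..t}. g (arc_clamp \<gamma> x) \<partial>lborel)"
proof -
  obtain \<gamma>' where \<gamma>': "\<gamma>' \<in> curves_in A" "P \<gamma>'" "arc_len \<gamma>' = t - s"
    and eq: "\<And>r. r \<in> {0..t - s} \<Longrightarrow> arc_clamp \<gamma>' r = arc_clamp \<gamma> (s + r)"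
    using assms unfolding subcurves_satisfy_def by blast
  note [measurable] = measurable_arc_clamp[OF \<gamma>]
  have "pathstart \<gamma>' = arc_clamp \<gamma> s"
    using arc_param_0[OF curves_inD(1,3)[OF \<gamma>'(1)]] \<gamma>'(3) eq[of 0] st
    by (simp add: arc_clamp_eq[of 0 \<gamma>'])
  moreover have "pathfinish \<gamma>' = arc_clamp \<gamma> t"
    using arc_param_arc_len[OF curves_inD(1,3)[OF \<gamma>'(1)]] \<gamma>'(3) eq[of "t - s"] st
    by (simp add: arc_clamp_eq[of "t - s" \<gamma>'])
  moreover have "line_integral g \<gamma>' = (\<integral>\<^sup>+x\<in>{s..t}. g (arc_clamp \<gamma> x) \<partial>lborel)"
    if [measurable]: "g \<in> borel_measurable borel" for g
  proof -
    have "line_integral g \<gamma>' = (\<integral>\<^sup>+r\<in>{0..t - s}. g (arc_clamp \<gamma> (s + r)) \<partial>lborel)"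
      unfolding line_integral_clamp \<gamma>'(3)
      by (rule nn_integral_cong) (auto split: split_indicator simp: eq)
    also have "\<dots> = (\<integral>\<^sup>+x\<in>{s..t}. g (arc_clamp \<gamma> x) \<partial>lborel)"
      by (rule set_nn_integral_shift[symmetric]) measurable
    finally show ?thesis .
  qed
  ultimately show ?thesis using \<gamma>' eq that by blast
qed

text \<open>
  The upper gradient inequality, with finite line integral, holds on all subpaths of \<open>\<gamma>\<close>.
\<close>

definition ug_along :: "('a \<Rightarrow> real) \<Rightarrow> ('a \<Rightarrow> ennreal) \<Rightarrow> (real \<Rightarrow> 'a) \<Rightarrow> bool" where
  "ug_along f g \<gamma> \<longleftrightarrow> ug_on (arc_len \<gamma>) (\<lambda>s. f (arc_clamp \<gamma> s)) (\<lambda>s. g (arc_clamp \<gamma> s))"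

text \<open>
  A weak upper gradient of a real-valued function on \<open>A\<close> that is integrable along almost every path.
  For such upper gradients the inequality may be demanded on all subpaths at once, which makes the
  results on intervals applicable. For an extended real-valued \<open>u\<close>, the real function in question is
  the real part of \<open>u\<close>, with value \<open>0\<close> where \<open>u\<close> is infinite.
\<close>

definition weak_ug :: "'a set \<Rightarrow> ('a \<Rightarrow> real) \<Rightarrow> ('a \<Rightarrow> ennreal) \<Rightarrow> bool" where
  "weak_ug A f g \<longleftrightarrow> g \<in> borel_measurable borel \<and> curve_ae q M A (ug_along f g)"

text \<open>
  Almost every path in \<open>A\<close> misses \<open>N\<close>.
\<close>

definition curve_avoids :: "'a set \<Rightarrow> 'a set \<Rightarrow> bool" where
  "curve_avoids A N \<longleftrightarrow> curve_ae q M A (\<lambda>\<gamma>. \<forall>s. arc_clamp \<gamma> s \<notin> N)"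

lemma weak_ug_measurable: "weak_ug A f g \<Longrightarrow> g \<in> borel_measurable borel"
  by (simp add: weak_ug_def)

text \<open>
  A path is nonconstant, so each of its points is an end point of a nonconstant subpath; hence \<open>u\<close> is
  finite on all of \<open>\<gamma>\<close> if the upper gradient inequality holds on the subpaths of \<open>\<gamma>\<close> and \<open>g\<close> is
      integrable
  along \<open>\<gamma>\<close>.
\<close>

lemma weak_upper_gradient_imp_weak_ug:
  assumes wug: "weak_upper_gradient q M A u g" and fin: "curve_ae q M A (\<lambda>\<gamma>. line_integral g \<gamma> < \<infinity>)"
  shows "weak_ug A (\<lambda>x. real_of_ereal (u x)) g" "curve_avoids A {x. \<bar>u x\<bar> = \<infinity>}"
proof -
  define P where "P \<gamma> \<longleftrightarrow> (let x = pathstart \<gamma>; y = pathfinish \<gamma> in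
          if \<bar>u x\<bar> = \<infinity> \<or> \<bar>u y\<bar> = \<infinity> then line_integral g \<gamma> = \<infinity>
          else e2ennreal \<bar>u x - u y\<bar> \<le> line_integral g \<gamma>)" for \<gamma>
  have g[measurable]: "g \<in> borel_measurable borel" using wug by (simp add: weak_upper_gradient_def)
  have "curve_ae q M A P" using wug unfolding curve_ae_iff weak_upper_gradient_def P_def by blast
  note curve_ae_conj'[OF curve_ae_subcurves_satisfy[OF this, of A] fin]
  then have both: "curve_ae q M A (\<lambda>\<gamma>. ug_along (\<lambda>x. real_of_ereal (u x)) g \<gamma>
      \<and> (\<forall>s. arc_clamp \<gamma> s \<notin> {x. \<bar>u x\<bar> = \<infinity>}))"
  proof (rule curve_ae_mono, elim conjE)
    fix \<gamma> assume \<gamma>: "\<gamma> \<in> curves_in A" and lfin: "line_integral g \<gamma> < \<infinity>"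
      and sub: "subcurves_satisfy A P \<gamma>"
    note [measurable] = measurable_arc_clamp[OF \<gamma>]
    let ?c = "arc_clamp \<gamma>" and ?L = "arc_len \<gamma>"
    have inA: "?c ` X \<subseteq> A" for X using arc_clamp_in[OF \<gamma>] by auto
    have L: "0 < ?L" using curves_inD(4)[OF \<gamma>] .
    have I: "\<bar>u (?c s)\<bar> \<noteq> \<infinity> \<and> \<bar>u (?c t)\<bar> \<noteq> \<infinity> \<and> e2ennreal \<bar>u (?c s) - u (?c t)\<bar>
        \<le> (\<integral>\<^sup>+x\<in>{s..t}. g (?c x) \<partial>lborel)"
      if st: "0 \<le> s" "s < t" "t \<le> ?L" for s t
    proof -
      obtain \<gamma>' where \<gamma>': "P \<gamma>'" "pathstart \<gamma>' = ?c s" "pathfinish \<gamma>' = ?c t"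
        "line_integral g \<gamma>' = (\<integral>\<^sup>+x\<in>{s..t}. g (?c x) \<partial>lborel)"
        using subcurves_satisfyE[OF sub \<gamma> st inA] g by metis
      have "(\<integral>\<^sup>+x\<in>{s..t}. g (?c x) \<partial>lborel) \<le> line_integral g \<gamma>"
        unfolding line_integral_clamp by (rule set_nn_integral_mono_set) (use st in auto)
      then have "line_integral g \<gamma>' \<noteq> \<infinity>" using lfin \<gamma>'(4) by auto
      then show ?thesis using \<gamma>' by (auto simp: P_def Let_def split: if_splits)
    qed
    have fin1: "\<bar>u (?c s)\<bar> \<noteq> \<infinity>" if "s \<in> {0..?L}" for s
      using I[of s ?L] I[of 0 s] that L by (cases "s < ?L") auto
    have cl: "?c s = ?c (max 0 (min ?L s))" for s
      by (simp add: arc_clamp_def)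
    have fin2: "\<bar>u (?c s)\<bar> \<noteq> \<infinity>" for s
      using fin1[of "max 0 (min ?L s)"] L by (subst cl) (auto simp: min.coboundedI1)
    have "ug_along (\<lambda>x. real_of_ereal (u x)) g \<gamma>"
      unfolding ug_along_def ug_on_def
    proof (intro conjI allI impI)
      show "(\<lambda>s. g (?c s)) \<in> borel_measurable borel" by measurable
      show "(\<integral>\<^sup>+x\<in>{0..?L}. g (?c x) \<partial>lborel) < \<infinity>" using lfin by (simp add: line_integral_clamp)
      fix s t assume st: "0 \<le> s" "s \<le> t" "t \<le> ?L"
      show "ennreal \<bar>real_of_ereal (u (?c s)) - real_of_ereal (u (?c t))\<bar>
          \<le> (\<integral>\<^sup>+x\<in>{s..t}. g (?c x) \<partial>lborel)"
      proof (cases "s = t")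
        case False
        then have i: "e2ennreal \<bar>u (?c s) - u (?c t)\<bar> \<le> (\<integral>\<^sup>+x\<in>{s..t}. g (?c x) \<partial>lborel)"
          using I[of s t] st by auto
        have "e2ennreal \<bar>u (?c s) - u (?c t)\<bar> = ennreal \<bar>real_of_ereal (u (?c s)) - real_of_ereal (u
            (?c t))\<bar>"
          using fin2[of s] fin2[of t] by (cases "u (?c s)"; cases "u (?c t)") auto
        with i show ?thesis by simp
      qed simp
    qed
    with fin2 show "ug_along (\<lambda>x. real_of_ereal (u x)) g \<gamma> \<and> (\<forall>s. ?c s \<notin> {x. \<bar>u x\<bar> = \<infinity>})" by simp
  qed
  show "weak_ug A (\<lambda>x. real_of_ereal (u x)) g" "curve_avoids A {x. \<bar>u x\<bar> = \<infinity>}"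
    unfolding weak_ug_def curve_avoids_def using g both by (auto intro: curve_ae_mono)
qed

lemma weak_ug_imp_weak_upper_gradient:
  assumes weak_ug: "weak_ug A f g" and av: "curve_avoids A {x. u x \<noteq> ereal (f x)}"
  shows "weak_upper_gradient q M A u g"
proof -
  have "curve_ae q M A (\<lambda>\<gamma>. ug_along f g \<gamma> \<and> (\<forall>s. arc_clamp \<gamma> s \<notin> {x. u x \<noteq> ereal (f x)}))"
    using weak_ug av by (intro curve_ae_conj') (auto simp: weak_ug_def curve_avoids_def)
  then have "curve_ae q M A (\<lambda>\<gamma>. let x = pathstart \<gamma>; y = pathfinish \<gamma> in
          if \<bar>u x\<bar> = \<infinity> \<or> \<bar>u y\<bar> = \<infinity> then line_integral g \<gamma> = \<infinity>
          else e2ennreal \<bar>u x - u y\<bar> \<le> line_integral g \<gamma>)"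
  proof (rule curve_ae_mono, elim conjE)
    fix \<gamma> assume \<gamma>: "\<gamma> \<in> curves_in A" and ug: "ug_along f g \<gamma>" and av:
        "\<forall>s. arc_clamp \<gamma> s \<notin> {x. u x \<noteq> ereal (f x)}"
    let ?L = "arc_len \<gamma>"
    have 1: "pathstart \<gamma> = arc_clamp \<gamma> 0" using arc_param_0[OF curves_inD(1,3)[OF \<gamma>]]
      by (simp add: arc_clamp_eq)
    have 2: "pathfinish \<gamma> = arc_clamp \<gamma> ?L" using arc_param_arc_len[OF curves_inD(1,3)[OF \<gamma>]]
      by (simp add: arc_clamp_eq)
    have 3: "u (pathstart \<gamma>) = ereal (f (pathstart \<gamma>))" "u (pathfinish \<gamma>) = ereal (f (pathfinish \<gamma>))"
      using av unfolding 1 2 by blast+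
    have "ennreal \<bar>f (pathstart \<gamma>) - f (pathfinish \<gamma>)\<bar> \<le> line_integral g \<gamma>"
      using ug_on_le[OF ug[unfolded ug_along_def], of 0 ?L] unfolding 1 2 line_integral_clamp by simp
    then show "let x = pathstart \<gamma>; y = pathfinish \<gamma> in
          if \<bar>u x\<bar> = \<infinity> \<or> \<bar>u y\<bar> = \<infinity> then line_integral g \<gamma> = \<infinity>
          else e2ennreal \<bar>u x - u y\<bar> \<le> line_integral g \<gamma>"
      by (simp add: 3)
  qed
  then show ?thesis using weak_ug unfolding weak_upper_gradient_def weak_ug_def curve_ae_iff by blast
qed

end

section \<open>Calculus of weak upper gradients and the minimal one\<close>

lemma nn_integral_le_imp_AE_le:
  fixes f g :: "'b \<Rightarrow> ennreal"
  assumes f: "f \<in> borel_measurable N" and g: "g \<in> borel_measurable N"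
    and le: "AE x in N. f x \<le> g x" and int: "integral\<^sup>N N g \<le> integral\<^sup>N N f" and fin:
        "integral\<^sup>N N f < \<infinity>"
  shows "AE x in N. g x \<le> f x"
proof -
  have "(\<integral>\<^sup>+x. g x - f x \<partial>N) = integral\<^sup>N N g - integral\<^sup>N N f"
    by (rule nn_integral_diff) (use assms in auto)
  also have "\<dots> = 0" using int le_less_trans[OF int fin] by (simp add: diff_eq_0_iff_ennreal)
  finally have "AE x in N. g x - f x = 0"
    using f g by (subst (asm) nn_integral_0_iff_AE) auto
  then show ?thesis by eventually_elim (simp add: diff_eq_0_iff_ennreal)
qed

context doubling_space
begin

lemma weak_ug_transfer:
  assumes "weak_ug A f g" "\<And>\<gamma>. \<gamma> \<in> curves_in A \<Longrightarrow> ug_along f g \<gamma> \<Longrightarrow> ug_along f' g' \<gamma>"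
      "g' \<in> borel_measurable borel"
  shows "weak_ug A f' g'"
  using assms unfolding weak_ug_def by (auto intro: curve_ae_mono)

lemma weak_ug_transfer2:
  assumes "weak_ug A f1 g1" "weak_ug A f2 g2"
    "\<And>\<gamma>. \<gamma> \<in> curves_in A \<Longrightarrow> ug_along f1 g1 \<gamma> \<Longrightarrow> ug_along f2 g2 \<gamma> \<Longrightarrow> ug_along f' g' \<gamma>"
    "g' \<in> borel_measurable borel"
  shows "weak_ug A f' g'"
  using curve_ae_conj'[of A "ug_along f1 g1" "ug_along f2 g2"] assms unfolding weak_ug_def
  by (auto intro: curve_ae_mono)

lemma weak_ug_subset: "weak_ug B f g \<Longrightarrow> A \<subseteq> B \<Longrightarrow> weak_ug A f g"
  unfolding weak_ug_def by (auto intro: curve_ae_subset)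

lemma weak_ug_add:
  assumes "weak_ug A f1 g1" "weak_ug A f2 g2" "\<And>x y. \<bar>f x - f y\<bar> \<le> \<bar>f1 x - f1 y\<bar> + \<bar>f2 x - f2 y\<bar>"
  shows "weak_ug A f (\<lambda>x. g1 x + g2 x)"
proof (rule weak_ug_transfer2[OF assms(1,2)])
  have [measurable]: "g1 \<in> borel_measurable borel" "g2 \<in> borel_measurable borel"
    using assms by (auto dest: weak_ug_measurable)
  show "(\<lambda>x. g1 x + g2 x) \<in> borel_measurable borel" by measurable
  fix \<gamma> assume "ug_along f1 g1 \<gamma>" "ug_along f2 g2 \<gamma>"
  then show "ug_along f (\<lambda>x. g1 x + g2 x) \<gamma>"
    unfolding ug_along_def by (rule ug_on_add) (rule assms(3))
qed

lemma weak_ug_cmult: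
  assumes "weak_ug A f1 g1" "0 \<le> c" "\<And>x y. \<bar>f x - f y\<bar> \<le> c * \<bar>f1 x - f1 y\<bar>"
  shows "weak_ug A f (\<lambda>x. ennreal c * g1 x)"
proof (rule weak_ug_transfer[OF assms(1)])
  have [measurable]: "g1 \<in> borel_measurable borel" using assms by (auto dest: weak_ug_measurable)
  show "(\<lambda>x. ennreal c * g1 x) \<in> borel_measurable borel" by measurable
  fix \<gamma> assume "ug_along f1 g1 \<gamma>"
  then show "ug_along f (\<lambda>x. ennreal c * g1 x) \<gamma>"
    unfolding ug_along_def using assms(2) by (rule ug_on_cmult) (rule assms(3))
qed

lemma weak_ug_const: "weak_ug A (\<lambda>_. c) (\<lambda>_. 0)"
  using curve_ae_finite[of "\<lambda>_. 0" A] unfolding weak_ug_def ug_along_def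
  by (auto intro: curve_ae_mono ug_on_const)

lemma weak_ug_min:
  assumes "weak_ug A f g1" "weak_ug A f g2"
  shows "weak_ug A f (\<lambda>x. min (g1 x) (g2 x))"
proof (rule weak_ug_transfer2[OF assms(1,2)])
  have [measurable]: "g1 \<in> borel_measurable borel" "g2 \<in> borel_measurable borel"
    using assms by (auto dest: weak_ug_measurable)
  show "(\<lambda>x. min (g1 x) (g2 x)) \<in> borel_measurable borel" by measurable
qed (auto simp: ug_along_def intro: ug_on_min)

lemma weak_ug_replace:
  assumes f: "weak_ug A f k" and f1: "weak_ug A f1 h" and S: "S \<in> sets borel" and eq: "\<And>x. x \<in> S
      \<Longrightarrow> x \<in> A \<Longrightarrow> f x = f1 x"
  shows "weak_ug A f (\<lambda>x. if x \<in> S then h x else k x)"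
proof (rule weak_ug_transfer2[OF f f1])
  have [measurable]: "k \<in> borel_measurable borel" "h \<in> borel_measurable borel" "S \<in> sets borel"
    using assms by (auto dest: weak_ug_measurable)
  show "(\<lambda>x. if x \<in> S then h x else k x) \<in> borel_measurable borel" by measurable
  fix \<gamma> assume \<gamma>: "\<gamma> \<in> curves_in A" and ug: "ug_along f k \<gamma>" "ug_along f1 h \<gamma>"
  note [measurable] = measurable_arc_clamp[OF \<gamma>]
  have "ug_on (arc_len \<gamma>) (\<lambda>s. f (arc_clamp \<gamma> s))
    (\<lambda>s. if s \<in> {s. arc_clamp \<gamma> s \<in> S} then h (arc_clamp \<gamma> s) else k (arc_clamp \<gamma> s))"
  proof (rule ug_on_replace)
    show "{s. arc_clamp \<gamma> s \<in> S} \<in> sets borel" by measurable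
  qed (use ug eq arc_clamp_in[OF \<gamma>] in \<open>auto simp: ug_along_def\<close>)
  then show "ug_along f (\<lambda>x. if x \<in> S then h x else k x) \<gamma>" by (simp add: ug_along_def)
qed

text \<open>
  Functions are only measurable for the completion, whereas upper gradients are Borel. The set \<open>S\<close> is
  therefore replaced by its Borel main part, which is contained in \<open>S\<close> and differs from it
    by a null set.
\<close>

lemma weak_ug_replace_AE:
  assumes f: "weak_ug A f k" and f1: "weak_ug A f1 h" and S: "S \<in> sets (completion M)" and eq:
      "\<And>x. x \<in> S \<Longrightarrow> x \<in> A \<Longrightarrow> f x = f1 x"
  obtains g where "weak_ug A f g" "AE x in M. g x = (if x \<in> S then h x else k x)"
proof -
  define S' where "S' = main_part M S"
  have S': "S' \<in> sets borel" "S' \<subseteq> S"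
    using main_part_sets[OF S] main_part_null_part_Un[OF S] by (auto simp: S'_def)
  obtain N where N: "N \<in> null_sets M" "null_part M S \<subseteq> N" using null_part[OF S] by blast
  have "AE x in M. x \<notin> null_part M S"
    using AE_not_in[OF N(1)] by eventually_elim (use N(2) in auto)
  then have ae: "AE x in M. (if x \<in> S' then h x else k x) = (if x \<in> S then h x else k x)"
    by eventually_elim (use main_part_null_part_Un[OF S] in \<open>auto simp: S'_def\<close>)
  have "weak_ug A f (\<lambda>x. if x \<in> S' then h x else k x)"
    by (rule weak_ug_replace[OF f f1 S'(1)]) (use S' eq in auto)
  then show ?thesis using ae that by blast
qed

text \<open>
  A subpath whose interior points lie in \<open>V\<close> stays in the closure of \<open>V\<close>, hence in \<open>\<Omega>\<close>, and \<open>f\<close> vanishes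
  at an end point outside \<open>V\<close>. By \<open>ug_on_zero_set\<close> it suffices to consider such subpaths.
\<close>

lemma weak_ug_extend_zero:
  assumes psi: "weak_ug \<Omega> f k" and V: "open V" "closure V \<subseteq> \<Omega>"
    and kfin: "(\<integral>\<^sup>+x\<in>V. epowr (k x) q \<partial>M) < \<infinity>"
    and bdry: "curve_avoids UNIV {x \<in> frontier V. f x \<noteq> 0}"
  shows "weak_ug UNIV (\<lambda>x. if x \<in> V then f x else 0) (\<lambda>x.
    if x \<in> V then k x else 0)" (is "weak_ug UNIV ?f ?k")
proof -
  have [measurable]: "k \<in> borel_measurable borel" "V \<in> sets borel" using psi V
    by (auto dest: weak_ug_measurable)
  have km[measurable]: "?k \<in> borel_measurable borel" by measurable
  have "(\<integral>\<^sup>+x. epowr (?k x) q \<partial>M) = (\<integral>\<^sup>+x\<in>V. epowr (k x) q \<partial>M)"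
    by (rule nn_integral_cong) (auto split: split_indicator)
  then have "curve_ae q M UNIV (\<lambda>\<gamma>. line_integral ?k \<gamma> < \<infinity>)" using kfin by (intro curve_ae_finite) auto
  moreover have "curve_ae q M \<Omega> (ug_along f k)" using psi by (simp add: weak_ug_def)
  note curve_ae_subcurves_satisfy[OF this, of UNIV]
  ultimately have "curve_ae q M UNIV (\<lambda>\<gamma>. line_integral ?k \<gamma> < \<infinity> \<and>
      (subcurves_satisfy \<Omega> (ug_along f k) \<gamma> \<and> (\<forall>s. arc_clamp \<gamma> s \<notin> {x \<in> frontier V. f x \<noteq> 0})))"
    using bdry unfolding curve_avoids_def by (intro curve_ae_conj')
  then have "curve_ae q M UNIV (ug_along ?f ?k)"
  proof (rule curve_ae_mono, elim conjE)
    fix \<gamma> assume \<gamma>: "\<gamma> \<in> curves_in UNIV" and lfin: "line_integral ?k \<gamma> < \<infinity>"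
      and sub: "subcurves_satisfy \<Omega> (ug_along f k) \<gamma>"
      and bd: "\<forall>s. arc_clamp \<gamma> s \<notin> {x \<in> frontier V. f x \<noteq> 0}"
    note [measurable] = measurable_arc_clamp[OF \<gamma>]
    let ?c = "arc_clamp \<gamma>" and ?L = "arc_len \<gamma>"
    have cont: "continuous_on UNIV ?c" using continuous_arc_clamp[OF \<gamma>] .
    define Z where "Z = ?c -` (- V)"
    have Z: "closed Z" unfolding Z_def using V(1) cont by (intro closed_vimage) auto
    show "ug_along ?f ?k \<gamma>"
      unfolding ug_along_def
    proof (rule ug_on_zero_set[OF Z])
      show "?f (?c x) = 0" if "x \<in> Z" for x using that by (simp add: Z_def)
      show "(\<lambda>s. ?k (?c s)) \<in> borel_measurable borel" by measurable
      show "(\<integral>\<^sup>+x\<in>{0..?L}. ?k (?c x) \<partial>lborel) < \<infinity>" using lfin by (simp only: line_integral_clamp)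
      fix a b assume ab: "0 \<le> a" "a \<le> b" "b \<le> ?L" and n: "\<And>x. a < x \<Longrightarrow> x < b \<Longrightarrow> x \<notin> Z"
      show "ennreal \<bar>?f (?c a) - ?f (?c b)\<bar> \<le> (\<integral>\<^sup>+x\<in>{a..b}. ?k (?c x) \<partial>lborel)"
      proof (cases "a = b")
        case False
        then have ab': "a < b" using ab by simp
        have "?c ` closure {a<..<b} \<subseteq> closure V"
        proof (rule image_closure_subset)
          show "continuous_on (closure {a<..<b}) ?c" using cont by (rule continuous_on_subset) simp
          show "?c ` {a<..<b} \<subseteq> closure V" using n closure_subset[of V] by (auto simp: Z_def)
        qed simp
        then have cl: "?c ` {a..b} \<subseteq> closure V" using ab' by simp
        have fe: "?f (?c s) = f (?c s)" if "s \<in> {a..b}" for s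
        proof (cases "?c s \<in> V")
          case False
          then have "?c s \<in> frontier V" using cl that V(1) by (auto simp: frontier_def interior_open)
          then show ?thesis using bd False by auto
        qed simp
        have "?c ` {a..b} \<subseteq> \<Omega>" using cl V(2) by (rule order_trans)
        then obtain \<gamma>' where \<gamma>': "\<gamma>' \<in> curves_in \<Omega>" "ug_along f k \<gamma>'" "arc_len \<gamma>' = b - a"
          "\<And>r. r \<in> {0..b - a} \<Longrightarrow> arc_clamp \<gamma>' r = ?c (a + r)"
          "line_integral k \<gamma>' = (\<integral>\<^sup>+x\<in>{a..b}. k (?c x) \<partial>lborel)"
          using subcurves_satisfyE[OF sub \<gamma> ab(1) ab' ab(3)] weak_ug_measurable[OF psi] by metis
        have "ennreal \<bar>f (?c a) - f (?c b)\<bar> = ennreal \<bar>f (arc_clamp \<gamma>' 0) - f (arc_clamp \<gamma>' (b - a))\<bar>"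
          using \<gamma>'(4) ab' by simp
        also have "\<dots> \<le> line_integral k \<gamma>'"
          using ug_on_le[OF \<gamma>'(2)[unfolded ug_along_def], of 0 "b - a"] \<gamma>'(3) ab'
          by (simp only: line_integral_clamp)
        also have "\<dots> = (\<integral>\<^sup>+x\<in>{a..b}. ?k (?c x) \<partial>lborel)"
          unfolding \<gamma>'(5)
        proof (rule nn_integral_cong_AE)
          have "AE x in lborel. x \<noteq> a" "AE x in lborel. x \<noteq> b" by (rule AE_lborel_singleton)+
          then show "AE x in lborel. k (?c x) * indicator {a..b} x = ?k (?c x) * indicator {a..b} x"
          proof eventually_elim
            case (elim x)
            then show ?case using n[of x] by (auto simp: Z_def split: split_indicator)
          qed
        qed
        finally show ?thesis using fe[of a] fe[of b] ab' by simp
      qed simp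
    qed
  qed
  then show ?thesis by (simp add: weak_ug_def)
qed

lemma curve_avoids_mono: "curve_avoids A N \<Longrightarrow> N' \<subseteq> N \<Longrightarrow> curve_avoids A N'"
  unfolding curve_avoids_def by (auto intro: curve_ae_mono)

lemma curve_avoids_Un:
  assumes "curve_avoids A E" "curve_avoids A F"
  shows "curve_avoids A (E \<union> F)"
  using curve_ae_conj'[OF assms[unfolded curve_avoids_def]] unfolding curve_avoids_def
  by (auto intro: curve_ae_mono)

lemma curve_avoids_empty: "curve_avoids A {}"
  using curve_ae_finite[of "\<lambda>_. 0" A] unfolding curve_avoids_def by (auto intro: curve_ae_mono)

text \<open>
  A path in the whole space that meets \<open>N\<close> has a nonconstant subpath in the open set \<open>\<Omega>\<close> that meets \<open>N\<close>.
\<close>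

lemma curve_avoids_extend:
  assumes av: "curve_avoids \<Omega> N" and N: "N \<subseteq> \<Omega>" and \<Omega>: "open \<Omega>"
  shows "curve_avoids UNIV N"
  unfolding curve_avoids_def
  using curve_ae_subcurves_satisfy[OF av[unfolded curve_avoids_def], of UNIV]
proof (rule curve_ae_mono, intro allI notI)
  fix \<gamma> s assume \<gamma>: "\<gamma> \<in> curves_in UNIV" and sN: "arc_clamp \<gamma> s \<in> N"
    and sub: "subcurves_satisfy \<Omega> (\<lambda>\<gamma>. \<forall>s. arc_clamp \<gamma> s \<notin> N) \<gamma>"
  let ?c = "arc_clamp \<gamma>" and ?L = "arc_len \<gamma>"
  have L: "0 < ?L" using curves_inD(4)[OF \<gamma>] .
  define s0 where "s0 = max 0 (min ?L s)"
  have s0: "0 \<le> s0" "s0 \<le> ?L" using L by (auto simp: s0_def)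
  have cs0: "?c s0 \<in> N" using sN s0 by (simp add: s0_def arc_clamp_def)
  have "open (?c -` \<Omega>)" using continuous_arc_clamp[OF \<gamma>] \<Omega> by (intro open_vimage) auto
  then obtain e where e: "0 < e" "cball s0 e \<subseteq> ?c -` \<Omega>" using cs0 N open_contains_cball
    by (metis subsetD vimageI2)
  define a b where "a = max 0 (s0 - e)" and "b = min ?L (s0 + e)"
  have ab: "0 \<le> a" "a < b" "b \<le> ?L" "a \<le> s0" "s0 \<le> b" using s0 e L by (auto simp: a_def b_def)
  have "?c ` {a..b} \<subseteq> \<Omega>"
  proof (rule image_subsetI)
    fix x assume "x \<in> {a..b}"
    then have "x \<in> cball s0 e" by (auto simp: a_def b_def dist_real_def)
    then show "?c x \<in> \<Omega>" using e by auto
  qed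
  then obtain \<gamma>' where \<gamma>': "\<forall>s. arc_clamp \<gamma>' s \<notin> N" "\<And>r. r \<in> {0..b - a} \<Longrightarrow> arc_clamp \<gamma>' r = ?c (a + r)"
    using subcurves_satisfyE[OF sub \<gamma> ab(1-3)] by metis
  have "arc_clamp \<gamma>' (s0 - a) = ?c s0" using \<gamma>'(2) ab by simp
  then show False using \<gamma>'(1) cs0 by metis
qed

text \<open>
  Along almost every path the first upper gradient is integrable and dominates the others. So passing to
  a decreasing limit needs no convergence in norm.
\<close>

lemma weak_ug_INF:
  assumes weak_ug: "\<And>n. weak_ug A f (H n)" and dec: "\<And>x. decseq (\<lambda>n. H n x)"
  shows "weak_ug A f (\<lambda>x. INF n. H n x)"
  unfolding weak_ug_def
proof
  have [measurable]: "\<And>n. H n \<in> borel_measurable borel" using weak_ug by (auto simp: weak_ug_def)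
  show "(\<lambda>x. INF n. H n x) \<in> borel_measurable borel" by measurable
  have "curve_ae q M A (\<lambda>\<gamma>. \<forall>n. ug_along f (H n) \<gamma>)"
    by (rule curve_ae_countable[OF sets_M q_pos]) (use weak_ug in \<open>auto simp: weak_ug_def\<close>)
  then show "curve_ae q M A (ug_along f (\<lambda>x. INF n. H n x))"
  proof (rule curve_ae_mono)
    fix \<gamma> assume \<gamma>: "\<gamma> \<in> curves_in A" and all: "\<forall>n. ug_along f (H n) \<gamma>"
    show "ug_along f (\<lambda>x. INF n. H n x) \<gamma>"
      unfolding ug_along_def
    proof (rule ug_on_limit)
      show "ug_on (arc_len \<gamma>) (\<lambda>s. f (arc_clamp \<gamma> s)) (\<lambda>s. H n (arc_clamp \<gamma> s))" for n
        using all by (simp add: ug_along_def)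
      show "H n (arc_clamp \<gamma> x) \<le> H 0 (arc_clamp \<gamma> x)" for n x using dec by (simp add: decseq_def)
      show "(\<lambda>s. H 0 (arc_clamp \<gamma> s)) \<in> borel_measurable borel"
          "(\<integral>\<^sup>+x\<in>{0..arc_len \<gamma>}. H 0 (arc_clamp \<gamma> x) \<partial>lborel) < \<infinity>"
        using all[rule_format, of 0] by (auto simp: ug_along_def ug_on_def)
      show "(\<lambda>n. H n (arc_clamp \<gamma> x)) \<longlonglongrightarrow> (INF n. H n (arc_clamp \<gamma> x))" for x
        using dec by (rule LIMSEQ_INF)
    qed
  qed
qed

text \<open>
  A decreasing sequence of upper gradients that minimizes the integral of the \<open>q\<close>-th power converges
      to an
  upper gradient \<open>g\<close>. If \<open>h\<close> is another one, then the minimum of \<open>g\<close> and \<open>h\<close> has no smaller integral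
  than \<open>g\<close>, so that \<open>g \<le> h\<close> almost everywhere. Here \<open>h\<close> need not be integrable to the power \<open>q\<close>.
\<close>

lemma weak_ug_minimal_exists:
  assumes A: "A \<in> sets borel" and g0: "weak_ug A f g0" and fin0: "(\<integral>\<^sup>+x\<in>A. epowr (g0 x) q \<partial>M) < \<infinity>"
  obtains g where "weak_ug A f g" "(\<integral>\<^sup>+x\<in>A. epowr (g x) q \<partial>M) < \<infinity>"
    "\<And>h. weak_ug A f h \<Longrightarrow> AE x in M. x \<in> A \<longrightarrow> g x \<le> h x"
proof -
  define m where "m g = (\<integral>\<^sup>+x\<in>A. epowr (g x) q \<partial>M)" for g :: "'a \<Rightarrow> ennreal"
  \<comment> \<open>The infimum may be taken over all upper gradients, integrable to the power \<open>q\<close> or not, since \<open>g0\<close>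
    makes it finite.\<close>
  define I where "I = (INF g\<in>{g. weak_ug A f g}. m g)"
  have [measurable]: "A \<in> sets borel" by (rule A)
  have I_le: "I \<le> m g" if "weak_ug A f g" for g unfolding I_def using that by (intro INF_lower) auto
  have Ifin: "I < \<infinity>" using I_le[OF g0] fin0 by (auto simp: m_def intro: le_less_trans)
  have m_mono: "m g \<le> m h" if "\<And>x. g x \<le> h x" for g h
    unfolding m_def using q by (intro set_nn_integral_mono_fun epowr_mono that) auto
  have "\<forall>n. \<exists>g. weak_ug A f g \<and> m g < I + ennreal (inverse (real (Suc n)))"
  proof
    fix n
    have "I < I + ennreal (inverse (real (Suc n)))"
      using Ifin by (cases I) (auto simp: ennreal_less_iff simp flip: ennreal_plus)
    then show "\<exists>g. weak_ug A f g \<and> m g < I + ennreal (inverse (real (Suc n)))"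
      by (subst (asm) I_def) (auto simp: INF_less_iff)
  qed
  from choice[OF this] obtain G where G: "\<And>n. weak_ug A f (G n)" "\<And>n. m (G n) < I
      + ennreal (inverse (real (Suc n)))" by blast
  define H where "H = rec_nat g0 (\<lambda>n h x. min (h x) (G n x))"
  have H0: "H 0 = g0" and HSuc: "\<And>n. H (Suc n) = (\<lambda>x. min (H n x) (G n x))" by (simp_all add: H_def)
  have H: "weak_ug A f (H n)" for n
    by (induction n) (auto simp: H0 HSuc g0 intro: weak_ug_min G)
  have dec: "decseq (\<lambda>n. H n x)" for x by (rule decseq_SucI) (simp add: HSuc)
  define g where "g x = (INF n. H n x)" for x
  have g: "weak_ug A f g" unfolding g_def by (rule weak_ug_INF[OF H dec])
  have mg: "m g \<le> I"
  proof (rule ennreal_le_epsilon)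
    fix e :: real assume "0 < e"
    then obtain n where n: "inverse (real (Suc n)) < e" using reals_Archimedean by auto
    have "m g \<le> m (H (Suc n))" by (rule m_mono) (auto simp: g_def intro: INF_lower)
    also have "\<dots> \<le> m (G n)" by (rule m_mono) (simp add: HSuc)
    also have "\<dots> \<le> I + ennreal (inverse (real (Suc n)))" using G(2) by (rule less_imp_le)
    also have "\<dots> \<le> I + ennreal e" using n by (intro add_left_mono ennreal_leI) auto
    finally show "m g \<le> I + ennreal e" .
  qed
  show ?thesis
  proof (rule that[OF g])
    show "(\<integral>\<^sup>+x\<in>A. epowr (g x) q \<partial>M) < \<infinity>" using mg Ifin
      by (auto simp: m_def[symmetric] intro: le_less_trans)
    fix h assume h: "weak_ug A f h"
    have [measurable]: "h \<in> borel_measurable borel" "g \<in> borel_measurable borel" using h g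
      by (auto simp: weak_ug_def)
    have c: "weak_ug A f (\<lambda>x. min (g x) (h x))" using g h by (rule weak_ug_min)
    have "AE x in M. epowr (g x) q * indicator A x \<le> epowr (min (g x) (h x)) q * indicator A x"
    proof (rule nn_integral_le_imp_AE_le)
      show "AE x in M. epowr (min (g x) (h x)) q * indicator A x \<le> epowr (g x) q * indicator A x"
        using q by (intro AE_I2 mult_right_mono epowr_mono) auto
      show "(\<integral>\<^sup>+x\<in>A. epowr (g x) q \<partial>M) \<le> (\<integral>\<^sup>+x\<in>A. epowr (min (g x) (h x)) q \<partial>M)"
        using mg I_le[OF c] unfolding m_def by (rule order_trans)
      have "m (\<lambda>x. min (g x) (h x)) \<le> m g" by (rule m_mono) simp
      then show "(\<integral>\<^sup>+x\<in>A. epowr (min (g x) (h x)) q \<partial>M) < \<infinity>" using mg Ifin unfolding m_def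
        by (auto intro: le_less_trans)
    qed measurable
    then show "AE x in M. x \<in> A \<longrightarrow> g x \<le> h x"
    proof eventually_elim
      case (elim x)
      show ?case
      proof (intro impI leI notI)
        assume "x \<in> A" "h x < g x"
        then show False using elim epowr_strict_mono[of "h x" "g x" q] q by (simp add: min_absorb2)
      qed
    qed
  qed
qed

lemma Lspace_enn2ereal:
  assumes "g \<in> borel_measurable borel" "(\<integral>\<^sup>+x\<in>A. epowr (g x) q \<partial>M) < \<infinity>"
  shows "(\<lambda>x. enn2ereal (g x)) \<in> Lspace q M A"
proof -
  have "g \<in> borel_measurable (completion M)"
    using assms by (intro measurable_completion) simp
  then have [measurable]: "g \<in> borel_measurable (restrict_space (completion M) A)"
    by (rule measurable_restrict_space1)
  show ?thesis using assms by (simp add: Lspace_def nn_integral_completion)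
qed

lemma Lspace_loc_enn2ereal:
  assumes "g \<in> borel_measurable borel" "(\<integral>\<^sup>+x\<in>A. epowr (g x) q \<partial>M) < \<infinity>"
  shows "(\<lambda>x. enn2ereal (g x)) \<in> Lspace_loc q M A"
  unfolding Lspace_loc_def
proof (intro CollectI ballI exI[of _ 1] conjI)
  fix x
  have "(\<integral>\<^sup>+x\<in>A \<inter> ball x 1. epowr (g x) q \<partial>M) \<le> (\<integral>\<^sup>+x\<in>A. epowr (g x) q \<partial>M)"
    by (rule set_nn_integral_mono_set) auto
  then show "(\<lambda>x. enn2ereal (g x)) \<in> Lspace q M (A \<inter> ball x 1)"
    using assms by (intro Lspace_enn2ereal) (auto intro: le_less_trans)
qed simp

text \<open>
  The extended real-valued \<open>u\<close> may differ from the real-valued \<open>f\<close> on a set that almost every path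
  avoids.
\<close>

lemma grad_minimal:
  assumes A: "open A" and g0: "weak_ug A f g0" and fin0: "(\<integral>\<^sup>+x\<in>A. epowr (g0 x) q \<partial>M) < \<infinity>"
    and av: "curve_avoids A {x. u x \<noteq> ereal (f x)}"
  shows "minimal_wug q M A u (grad q M A u)"
    and "AE x in M. x \<in> A \<longrightarrow> grad q M A u x \<le> g0 x"
proof -
  obtain g where g: "weak_ug A f g" "(\<integral>\<^sup>+x\<in>A. epowr (g x) q \<partial>M) < \<infinity>"
    "\<And>h. weak_ug A f h \<Longrightarrow> AE x in M. x \<in> A \<longrightarrow> g x \<le> h x"
    using weak_ug_minimal_exists[OF _ g0 fin0] A by auto
  have "minimal_wug q M A u g"
    unfolding minimal_wug_def
  proof (intro conjI allI impI)
    show "weak_upper_gradient q M A u g" using g(1) av by (rule weak_ug_imp_weak_upper_gradient)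
    show "(\<lambda>x. enn2ereal (g x)) \<in> Lspace_loc q M A"
      using weak_ug_measurable[OF g(1)] g(2) by (rule Lspace_loc_enn2ereal)
    fix h assume h: "weak_upper_gradient q M A u h \<and> (\<lambda>x. enn2ereal (h x)) \<in> Lspace_loc q M A"
    then have hm: "h \<in> borel_measurable borel" by (simp add: weak_upper_gradient_def)
    have "weak_ug A (\<lambda>x. real_of_ereal (u x)) h"
      using h hm A by (intro weak_upper_gradient_imp_weak_ug(1) curve_ae_finite_local) auto
    then have "curve_ae q M A (\<lambda>\<gamma>. ug_along (\<lambda>x. real_of_ereal (u x)) h \<gamma>
        \<and> (\<forall>s. arc_clamp \<gamma> s \<notin> {x. u x \<noteq> ereal (f x)}))"
      using av by (intro curve_ae_conj') (auto simp: weak_ug_def curve_avoids_def)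
    then have "curve_ae q M A (ug_along f h)"
    proof (rule curve_ae_mono, elim conjE)
      fix \<gamma> assume "ug_along (\<lambda>x. real_of_ereal (u x)) h \<gamma>" and *:
          "\<forall>s. arc_clamp \<gamma> s \<notin> {x. u x \<noteq> ereal (f x)}"
      moreover have "real_of_ereal (u (arc_clamp \<gamma> s)) = f (arc_clamp \<gamma> s)" for s using * by simp
      ultimately show "ug_along f h \<gamma>" by (simp add: ug_along_def)
    qed
    then show "AE x in M. x \<in> A \<longrightarrow> g x \<le> h x" using hm by (intro g(3)) (simp add: weak_ug_def)
  qed
  then show *: "minimal_wug q M A u (grad q M A u)"
    using someI_ex[of "minimal_wug q M A u"] by (auto simp: grad_def)
  have "weak_upper_gradient q M A u g0" using g0 av by (rule weak_ug_imp_weak_upper_gradient)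
  moreover have "(\<lambda>x. enn2ereal (g0 x)) \<in> Lspace_loc q M A"
      using weak_ug_measurable[OF g0] fin0 by (rule Lspace_loc_enn2ereal)
  ultimately show "AE x in M. x \<in> A \<longrightarrow> grad q M A u x \<le> g0 x"
    using * unfolding minimal_wug_def by blast
qed

lemma N1_intro:
  assumes A: "open A" and u: "u \<in> Lspace q M A" and g0: "weak_ug A f g0" and fin0:
      "(\<integral>\<^sup>+x\<in>A. epowr (g0 x) q \<partial>M) < \<infinity>"
    and av: "curve_avoids A {x. u x \<noteq> ereal (f x)}"
  shows "u \<in> N1 q M A"
proof -
  note g = grad_minimal[OF A g0 fin0 av]
  have "(\<integral>\<^sup>+x\<in>A. epowr (grad q M A u x) q \<partial>M) \<le> (\<integral>\<^sup>+x\<in>A. epowr (g0 x) q \<partial>M)"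
  proof (rule nn_integral_mono_AE)
    show "AE x in M. epowr (grad q M A u x) q * indicator A x \<le> epowr (g0 x) q * indicator A x"
      using g(2) by eventually_elim (use q in \<open>auto split: split_indicator intro: epowr_mono\<close>)
  qed
  then show ?thesis
    using u g(1) fin0 unfolding N1_def minimal_wug_def weak_upper_gradient_def
    by (auto intro!: Lspace_enn2ereal intro: le_less_trans)
qed

lemma N1_weak_ug:
  assumes A: "open A" "A \<noteq> {}" and u: "u \<in> N1 q M A"
  shows "weak_ug A (\<lambda>x. real_of_ereal (u x)) (grad q M A u)" "curve_avoids A {x. \<bar>u x\<bar> = \<infinity>}"
    "(\<integral>\<^sup>+x\<in>A. epowr (grad q M A u x) q \<partial>M) < \<infinity>" "u \<in> Lspace q M A"
proof -
  show "u \<in> Lspace q M A" using u by (simp add: N1_def)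
  show fin: "(\<integral>\<^sup>+x\<in>A. epowr (grad q M A u x) q \<partial>M) < \<infinity>"
    using u by (simp add: N1_def Lspace_def nn_integral_completion)
  have "\<exists>g. minimal_wug q M A u g"
  proof (rule ccontr)
    assume n: "\<not> ?thesis"
    have "(\<integral>\<^sup>+x\<in>A. epowr (grad q M A u x) q \<partial>M) = top * emeasure M A"
      using n A by (simp add: grad_def nn_integral_cmult_indicator)
    also have "\<dots> = top" using emeasure_open_pos[OF A] by (simp add: ennreal_top_mult)
    finally show False using fin by simp
  qed
  then have "minimal_wug q M A u (grad q M A u)" using someI_ex[of "minimal_wug q M A u"]
    by (auto simp: grad_def)
  then have wug: "weak_upper_gradient q M A u (grad q M A u)"
    and loc: "(\<lambda>x. enn2ereal (grad q M A u x)) \<in> Lspace_loc q M A" by (auto simp: minimal_wug_def)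
  then have "curve_ae q M A (\<lambda>\<gamma>. line_integral (grad q M A u) \<gamma> < \<infinity>)"
    by (intro curve_ae_finite_local A) (auto simp: weak_upper_gradient_def)
  with wug show "weak_ug A (\<lambda>x. real_of_ereal (u x)) (grad q M A u)" "curve_avoids A {x. \<bar>u x\<bar> = \<infinity>}"
    by (auto intro: weak_upper_gradient_imp_weak_ug)
qed

end

section \<open>Sets of zero capacity and functions with zero gradient\<close>

lemma measurable_restrict_UNIV:
  fixes f :: "'b \<Rightarrow> 'c::topological_space"
  shows "f \<in> borel_measurable (restrict_space N UNIV) \<longleftrightarrow> f \<in> borel_measurable N"
proof -
  have "sets (restrict_space N UNIV) = sets N" by (simp add: sets_restrict_space)
  then have "(borel_measurable (restrict_space N UNIV) :: ('b \<Rightarrow> 'c) set) = borel_measurable N"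
    by (rule measurable_cong_sets[OF _ refl])
  then show ?thesis by (simp only:)
qed

lemma e2ennreal_0 [simp]: "e2ennreal 0 = 0"
  by (metis ennreal_0 e2ennreal_ereal zero_ereal_def)

context doubling_space
begin

lemma borel_measurable_completion_borel:
  "g \<in> borel_measurable borel \<Longrightarrow> g \<in> borel_measurable (completion M)"
  by (intro measurable_completion) simp

text \<open>
  Choose \<open>u n\<close> equal to \<open>1\<close> on \<open>E\<close> with so small norm that \<open>T\<close>, the supremum of the functions
  \<open>(n + 1) W n\<close> and \<open>(n + 1) g n\<close>, is integrable to the power \<open>q\<close>, where \<open>W n\<close> is a Borel function equal
  to \<open>\<bar>u n\<bar>\<close> almost everywhere. Along a path of length \<open>L\<close> through
  a point of \<open>E\<close> one has \<open>1 \<le> \<bar>u n\<bar> + \<integral> g n\<close>, and integration gives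
  \<open>(n + 1) L \<le> (1 + L) \<integral> T\<close> for every \<open>n\<close>. So the line integral of \<open>T\<close> is infinite.
\<close>

lemma capacity_zero_avoids:
  assumes E: "capacity q M E = 0"
  shows "curve_avoids UNIV E"
proof -
  define K where "K n = ennreal (real (Suc n) powr (- q) * (1/2) ^ Suc n)" for n
  let ?E = "\<lambda>u. (\<integral>\<^sup>+x. epowr (e2ennreal \<bar>u x\<bar>) q \<partial>completion M)
      + (\<integral>\<^sup>+x. epowr (grad q M UNIV u x) q \<partial>M)"
  have "\<forall>n. \<exists>u. u \<in> N1 q M UNIV \<and> (\<forall>x\<in>E. u x = 1) \<and> ?E u < K n"
  proof
    fix n
    have "capacity q M E < K n" by (simp add: E K_def)
    then show "\<exists>u. u \<in> N1 q M UNIV \<and> (\<forall>x\<in>E. u x = 1) \<and> ?E u < K n"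
      unfolding capacity_def INF_less_iff by auto
  qed
  from choice[OF this] obtain u where u_all: "\<forall>n. u n \<in> N1 q M UNIV \<and> (\<forall>x\<in>E. u n x = 1) \<and> ?E (u n)
      < K n" ..
  then have uN: "u n \<in> N1 q M UNIV" and u1: "x \<in> E \<Longrightarrow> u n x = 1" and uK: "?E (u n) < K n" for n x by auto
  define f where "f n x = real_of_ereal (u n x)" for n x
  define g where "g n = grad q M UNIV (u n)" for n
  define v where "v n x = e2ennreal \<bar>u n x\<bar>" for n x
  have weak_ug: "weak_ug UNIV (f n) (g n)" for n
    using N1_weak_ug(1)[OF _ _ uN[of n]] by (simp add: f_def[abs_def] g_def)
  have [measurable]: "g n \<in> borel_measurable borel" for n using weak_ug_measurable[OF weak_ug] .
  have vm: "v n \<in> borel_measurable (completion M)" for n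
    using N1_weak_ug(4)[OF _ _ uN[of n]] unfolding v_def
    by (auto simp: Lspace_def measurable_restrict_UNIV)
  have "\<forall>n. \<exists>W. W \<in> borel_measurable borel \<and> (AE x in M. v n x = W x)"
  proof
    fix n
    show "\<exists>W. W \<in> borel_measurable borel \<and> (AE x in M. v n x = W x)"
      using completion_ex_borel_measurable[OF vm[of n]] measurable_cong_sets[OF sets_M refl] by auto
  qed
  from choice[OF this] obtain W where W_all: "\<forall>n. W n \<in> borel_measurable borel \<and> (AE x in M. v n x
      = W n x)" ..
  then have [measurable]: "W n \<in> borel_measurable borel" and vW: "AE x in M. v n x = W n x" for n
    by auto
  \<comment> \<open>Combining the functions and their upper gradients in one supremum makes a single line integral
    control all of them.\<close>
  define T where "T x = (SUP n. ennreal (real (Suc n)) * max (W n x) (g n x))" for x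
  have T[measurable]: "T \<in> borel_measurable borel" unfolding T_def by measurable
  have "(\<integral>\<^sup>+x. epowr (T x) q \<partial>M) \<le> (\<integral>\<^sup>+x. (\<Sum>n. epowr (ennreal (real (Suc n)) * max (W n x) (g n x))
      q) \<partial>M)"
    unfolding T_def by (intro nn_integral_mono epowr_SUP_le_suminf q_pos)
  also have "\<dots> = (\<Sum>n. \<integral>\<^sup>+x. epowr (ennreal (real (Suc n)) * max (W n x) (g n x)) q \<partial>M)"
    by (rule nn_integral_suminf) measurable
  also have "\<dots> \<le> (\<Sum>n. ennreal ((1/2) ^ Suc n))"
  proof (intro suminf_le)
    fix n
    have "(\<integral>\<^sup>+x. epowr (ennreal (real (Suc n)) * max (W n x) (g n x)) q \<partial>M)
        = ennreal (real (Suc n) powr q) * (\<integral>\<^sup>+x. epowr (max (W n x) (g n x)) q \<partial>M)"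
      by (subst nn_integral_cmult[symmetric]) (measurable, simp only: epowr_cmult of_nat_0_le_iff)
    also have "(\<integral>\<^sup>+x. epowr (max (W n x) (g n x)) q \<partial>M) \<le> (\<integral>\<^sup>+x. epowr (W n x) q + epowr (g n x) q \<partial>M)"
      using q by (intro nn_integral_mono) (simp add: epowr_max add_increasing add_increasing2)
    also have "\<dots> = (\<integral>\<^sup>+x. epowr (W n x) q \<partial>M) + (\<integral>\<^sup>+x. epowr (g n x) q \<partial>M)"
      by (rule nn_integral_add) measurable
    also have "(\<integral>\<^sup>+x. epowr (W n x) q \<partial>M) = (\<integral>\<^sup>+x. epowr (v n x) q \<partial>M)"
    proof (rule nn_integral_cong_AE)
      show "AE x in M. epowr (W n x) q = epowr (v n x) q" using vW[of n] by eventually_elim simp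
    qed
    also have "\<dots> + (\<integral>\<^sup>+x. epowr (g n x) q \<partial>M) \<le> K n"
      using uK[of n] by (simp add: v_def g_def nn_integral_completion)
    also have "ennreal (real (Suc n) powr q) * K n = ennreal ((1/2) ^ Suc n)"
      unfolding K_def by (subst ennreal_mult[symmetric]) (auto simp: powr_minus simp flip: mult.assoc)
    finally show "(\<integral>\<^sup>+x. epowr (ennreal (real (Suc n)) * max (W n x) (g n x)) q \<partial>M)
        \<le> ennreal ((1/2) ^ Suc n)"
      by (simp add: mult_left_mono)
  qed auto
  also have "\<dots> = ennreal 1"
    using power_half_series by (intro suminf_ennreal_eq) auto
  finally have "(\<integral>\<^sup>+x. epowr (T x) q \<partial>M) < \<infinity>" by (auto intro: le_less_trans)
  then have c1: "curve_ae q M UNIV (\<lambda>\<gamma>. line_integral T \<gamma> < \<infinity>)" by (rule curve_ae_finite[OF T])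
  have "curve_ae q M UNIV (\<lambda>\<gamma>. \<forall>n. ug_along (f n) (g n) \<gamma> \<and> (AE s in lborel. s \<in> {0..arc_len \<gamma>}
      \<longrightarrow> v n (arc_clamp \<gamma> s) = W n (arc_clamp \<gamma> s)))"
    by (intro curve_ae_countable[OF sets_M q_pos] curve_ae_conj' curve_ae_AE vW)
        (use weak_ug in \<open>auto simp: weak_ug_def\<close>)
  from curve_ae_conj'[OF c1 this] show ?thesis
    unfolding curve_avoids_def
  proof (rule curve_ae_mono, intro allI notI, elim conjE)
    fix \<gamma> s
    assume \<gamma>: "\<gamma> \<in> curves_in UNIV" and lfin: "line_integral T \<gamma> < \<infinity>" and sE: "arc_clamp \<gamma> s \<in> E"
      and all: "\<forall>n. ug_along (f n) (g n) \<gamma> \<and> (AE s in lborel. s \<in> {0..arc_len \<gamma>}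
          \<longrightarrow> v n (arc_clamp \<gamma> s) = W n (arc_clamp \<gamma> s))"
    note [measurable] = measurable_arc_clamp[OF \<gamma>]
    let ?c = "arc_clamp \<gamma>"
    define L where "L = arc_len \<gamma>"
    have L: "0 < L" using curves_inD(4)[OF \<gamma>] by (simp add: L_def)
    define s0 where "s0 = max 0 (min L s)"
    have s0: "0 \<le> s0" "s0 \<le> L" using L by (auto simp: s0_def)
    have cs0: "?c s0 \<in> E" using sE s0 by (simp add: s0_def arc_clamp_def L_def)
    obtain j where j: "line_integral T \<gamma> = ennreal j" "0 \<le> j" using lfin
      by (cases "line_integral T \<gamma>") auto
    have main: "real (Suc n) * L \<le> j + j * L" for n
    proof -
      let ?N = "ennreal (real (Suc n))"
      define G where "G = (\<integral>\<^sup>+x\<in>{0..L}. g n (?c x) \<partial>lborel)"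
      define Y where "Y = (\<integral>\<^sup>+x\<in>{0..L}. W n (?c x) \<partial>lborel)"
      have ug: "ug_on L (\<lambda>s. f n (?c s)) (\<lambda>s. g n (?c s))" using all by (simp add: ug_along_def L_def)
      have NT: "?N * h \<le> T x" if "h \<le> max (W n x) (g n x)" for h x
        unfolding T_def using that by (intro SUP_upper2[of n] mult_left_mono) auto
      have N_int: "?N * (\<integral>\<^sup>+x\<in>{0..L}. h (?c x) \<partial>lborel) \<le> ennreal j"
        if [measurable]: "h \<in> borel_measurable borel" and h: "\<And>x. h x \<le> max (W n x) (g n x)" for h
      proof -
        have "?N * (\<integral>\<^sup>+x\<in>{0..L}. h (?c x) \<partial>lborel)
            = (\<integral>\<^sup>+x. ?N * (h (?c x) * indicator {0..L} x) \<partial>lborel)"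
          by (rule nn_integral_cmult[symmetric]) measurable
        also have "\<dots> \<le> (\<integral>\<^sup>+x\<in>{0..L}. T (?c x) \<partial>lborel)"
          unfolding mult.assoc[symmetric] by (intro nn_integral_mono mult_right_mono NT h) simp
        finally show ?thesis using j(1) unfolding line_integral_clamp L_def by simp
      qed
      have NG: "?N * G \<le> ennreal j" unfolding G_def by (rule N_int) auto
      have NY: "?N * Y \<le> ennreal j" unfolding Y_def by (rule N_int) auto
      have one: "1 \<le> ennreal \<bar>f n (?c s)\<bar> + G" if s: "s \<in> {0..L}" for s
      proof -
        have "ennreal \<bar>f n (?c s0) - f n (?c s)\<bar> \<le> (\<integral>\<^sup>+x\<in>{min s0 s..max s0 s}. g n (?c x) \<partial>lborel)"
        proof (cases "s0 \<le> s")
          case True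
          then show ?thesis using ug_on_le[OF ug, of s0 s] s0 s by (simp add: min_absorb1 max_absorb2)
        next
          case False
          then show ?thesis using ug_on_le[OF ug, of s s0] s0 s
            by (simp add: min_absorb2 max_absorb1 abs_minus_commute)
        qed
        also have "\<dots> \<le> G" unfolding G_def by (rule set_nn_integral_mono_set) (use s s0 in auto)
        finally have d: "ennreal \<bar>f n (?c s0) - f n (?c s)\<bar> \<le> G" .
        have "f n (?c s0) = 1" using u1[OF cs0] by (simp add: f_def)
        then have "1 \<le> \<bar>f n (?c s)\<bar> + \<bar>f n (?c s0) - f n (?c s)\<bar>" by simp
        then have "ennreal 1 \<le> ennreal (\<bar>f n (?c s)\<bar> + \<bar>f n (?c s0) - f n (?c s)\<bar>)"
          by (rule ennreal_leI)
        also have "\<dots> = ennreal \<bar>f n (?c s)\<bar> + ennreal \<bar>f n (?c s0) - f n (?c s)\<bar>" by simp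
        also have "\<dots> \<le> ennreal \<bar>f n (?c s)\<bar> + G" using d by (rule add_left_mono)
        finally show ?thesis by simp
      qed
      have fv: "ennreal \<bar>f n x\<bar> \<le> v n x" for x
        unfolding f_def v_def by (cases "u n x") auto
      have "ennreal L = (\<integral>\<^sup>+s\<in>{0..L}. 1 \<partial>lborel)" using L by simp
      also have "\<dots> \<le> (\<integral>\<^sup>+s. W n (?c s) * indicator {0..L} s + G * indicator {0..L} s \<partial>lborel)"
      proof (rule nn_integral_mono_AE)
        have "AE s in lborel. s \<in> {0..L} \<longrightarrow> v n (?c s) = W n (?c s)" using all by (simp add: L_def)
        then show "AE s in lborel. 1 * indicator {0..L} s \<le> W n (?c s) * indicator {0..L} s
            + G * indicator {0..L} s"
        proof eventually_elim
          case (elim s)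
          then show ?case using one[of s] fv[of "?c s"]
            by (auto split: split_indicator intro: order_trans add_right_mono)
        qed
      qed
      also have "\<dots> = Y + G * ennreal L"
        unfolding Y_def using L by (subst nn_integral_add) (auto simp: nn_integral_cmult_indicator)
      finally have "?N * ennreal L \<le> ?N * (Y + G * ennreal L)" by (rule mult_left_mono) simp
      also have "\<dots> = ?N * Y + ?N * G * ennreal L" by (simp only: distrib_left mult.assoc)
      also have "\<dots> \<le> ennreal j + ennreal j * ennreal L" using NY NG
        by (intro add_mono mult_right_mono) auto
      also have "\<dots> = ennreal (j + j * L)" using j L by (simp add: ennreal_mult)
      also have "?N * ennreal L = ennreal (real (Suc n) * L)" using L by (simp add: ennreal_mult)
      finally show ?thesis by (subst (asm) ennreal_le_iff) (use j L in auto)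
    qed
    obtain n :: nat where "(j + j * L) / L < real n" using reals_Archimedean2 by blast
    then have "j + j * L < real n * L" using L by (simp add: pos_divide_less_eq)
    also have "\<dots> \<le> real (Suc n) * L" using L by simp
    finally show False using main[of n] by simp
  qed
qed

lemma null_subset_completion:
  assumes "AE x in M. x \<notin> E"
  shows "E \<in> null_sets (completion M)"
proof -
  obtain N where N: "{x \<in> space M. \<not> x \<notin> E} \<subseteq> N" "N \<in> null_sets M"
    using assms unfolding eventually_ae_filter by blast
  then have "E \<subseteq> N" by auto
  then show ?thesis using N(2) null_sets_completion_iff2 by auto
qed

text \<open>
  Since \<open>\<phi>\<close> is constant along almost every path, so is the indicator function of \<open>{x. \<phi> x \<noteq> 0}\<close>. Hence
  this indicator function, which vanishes almost everywhere, has the weak upper gradient \<open>0\<close>, and it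
  is admissible for the capacity once it is modified on \<open>N\<close>.
\<close>

lemma capacity_zero_intro:
  assumes phi: "weak_ug UNIV \<phi> k" and k0: "AE x in M. k x = 0" and phi0: "AE x in M. \<phi> x = 0"
    and N: "curve_avoids UNIV N" "AE x in M. x \<notin> N"
  shows "capacity q M ({x. \<phi> x \<noteq> 0} \<union> N) = 0"
proof -
  let ?E = "{x. \<phi> x \<noteq> 0} \<union> N"
  define u where "u x = (indicator ?E x :: ereal)" for x
  define f where "f x = (indicator {x. \<phi> x \<noteq> 0} x :: real)" for x
  have "AE x in M. x \<notin> ?E" using phi0 N(2) by eventually_elim simp
  then have E: "?E \<in> null_sets (completion M)" by (rule null_subset_completion)
  have uL: "u \<in> Lspace q M UNIV"
  proof -
    have "?E \<in> sets (completion M)" using E by auto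
    then have "u \<in> borel_measurable (completion M)" unfolding u_def by measurable
    moreover have "(\<integral>\<^sup>+x. epowr (e2ennreal \<bar>u x\<bar>) q \<partial>completion M) = (\<integral>\<^sup>+x. 0 \<partial>completion M)"
    proof (rule nn_integral_cong_AE)
      show "AE x in completion M. epowr (e2ennreal \<bar>u x\<bar>) q = 0"
        using AE_not_in[OF E] by eventually_elim (simp add: u_def)
    qed
    ultimately show ?thesis by (simp add: Lspace_def measurable_restrict_UNIV)
  qed
  have "curve_ae q M UNIV (\<lambda>\<gamma>. ug_along \<phi> k \<gamma> \<and> (AE s in lborel. s \<in> {0..arc_len \<gamma>}
      \<longrightarrow> k (arc_clamp \<gamma> s) = 0))"
    using phi by (intro curve_ae_conj' curve_ae_AE k0) (simp add: weak_ug_def)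
  then have "curve_ae q M UNIV (ug_along f (\<lambda>_. 0))"
  proof (rule curve_ae_mono, elim conjE)
    fix \<gamma> assume ug: "ug_along \<phi> k \<gamma>" and ae: "AE s in lborel. s \<in> {0..arc_len \<gamma>}
        \<longrightarrow> k (arc_clamp \<gamma> s) = 0"
    have eq: "\<phi> (arc_clamp \<gamma> s) = \<phi> (arc_clamp \<gamma> t)" if st: "0 \<le> s" "s \<le> t" "t \<le> arc_len \<gamma>" for s t
    proof -
      have "ennreal \<bar>\<phi> (arc_clamp \<gamma> s) - \<phi> (arc_clamp \<gamma> t)\<bar> \<le> (\<integral>\<^sup>+x\<in>{s..t}. k (arc_clamp \<gamma> x) \<partial>lborel)"
        by (rule ug_on_le[OF ug[unfolded ug_along_def] st])
      also have "\<dots> = integral\<^sup>N lborel (\<lambda>_::real. 0)"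
      proof (rule nn_integral_cong_AE)
        show "AE x in lborel. k (arc_clamp \<gamma> x) * indicator {s..t} x = 0"
          using ae by eventually_elim (use st in \<open>auto split: split_indicator\<close>)
      qed
      finally show ?thesis by simp
    qed
    show "ug_along f (\<lambda>_. 0) \<gamma>"
      unfolding ug_along_def
      by (rule ug_on_cong[OF ug_on_const[of _ "f (arc_clamp \<gamma> 0)"]])
          (use eq[of 0] in \<open>auto simp: f_def indicator_def\<close>)
  qed
  then have weak_ug0: "weak_ug UNIV f (\<lambda>_. 0)" by (simp add: weak_ug_def)
  have av: "curve_avoids UNIV {x. u x \<noteq> ereal (f x)}"
    by (rule curve_avoids_mono[OF N(1)]) (auto simp: u_def f_def indicator_def)
  have uN: "u \<in> N1 q M UNIV" by (rule N1_intro[OF _ uL weak_ug0 _ av]) auto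
  have "AE x in M. x \<in> UNIV \<longrightarrow> grad q M UNIV u x \<le> 0" by (rule grad_minimal(2)[OF _ weak_ug0 _ av]) auto
  then have "(\<integral>\<^sup>+x. epowr (grad q M UNIV u x) q \<partial>M) = (\<integral>\<^sup>+x. 0 \<partial>M)"
    by (intro nn_integral_cong_AE) (auto elim: eventually_mono)
  moreover have "(\<integral>\<^sup>+x. epowr (e2ennreal \<bar>u x\<bar>) q \<partial>completion M) = (\<integral>\<^sup>+x. 0 \<partial>completion M)"
    by (rule nn_integral_cong_AE) (use AE_not_in[OF E] in \<open>eventually_elim, simp add: u_def\<close>)
  moreover have "capacity q M ?E \<le> (\<integral>\<^sup>+x. epowr (e2ennreal \<bar>u x\<bar>) q \<partial>completion M)
      + (\<integral>\<^sup>+x. epowr (grad q M UNIV u x) q \<partial>M)"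
    unfolding capacity_def
    by (intro INF_lower CollectI conjI ballI uN) (simp add: u_def indicator_def)
  ultimately show ?thesis by simp
qed

text \<open>
  By the Poincare inequality \<open>\<phi>\<close> equals its mean value almost everywhere on each ball, and the mean
      value
  over a large ball is \<open>0\<close>, because this ball meets \<open>Z\<close> in a set of positive measure.
\<close>

lemma zero_gradient_imp_zero:
  assumes PI: "weak_Poincare q p M" and p: "0 < p"
    and phi: "weak_ug UNIV \<phi> k" and k0: "AE x in M. k x = 0"
    and L: "(\<lambda>x. ereal (\<phi> x)) \<in> Lspace q M UNIV"
    and Z: "Z \<in> sets borel" "0 < emeasure M Z" "\<And>x. x \<in> Z \<Longrightarrow> \<phi> x = 0"
  shows "AE x in M. \<phi> x = 0"
proof -
  let ?u = "\<lambda>x. ereal (\<phi> x)"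
  have um: "?u \<in> borel_measurable (completion M)" using L
    by (simp add: Lspace_def measurable_restrict_UNIV)
  then have [measurable]: "\<phi> \<in> borel_measurable (completion M)" by simp
  have Lint: "(\<integral>\<^sup>+x. ennreal (\<bar>\<phi> x\<bar> powr q) \<partial>completion M) < \<infinity>" using L by (simp add: Lspace_def)
  have loc: "?u \<in> Lspace_loc 1 M UNIV"
    unfolding Lspace_loc_def
  proof (intro CollectI ballI exI[of _ 1] conjI)
    fix x
    have "(\<integral>\<^sup>+y\<in>UNIV \<inter> ball x 1. epowr (e2ennreal \<bar>ereal (\<phi> y)\<bar>) 1 \<partial>completion M)
      \<le> (\<integral>\<^sup>+y. ennreal (\<bar>\<phi> y\<bar> powr q) + indicator (ball x 1) y \<partial>completion M)"
    proof (rule nn_integral_mono)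
      fix y
      have "\<bar>\<phi> y\<bar> \<le> \<bar>\<phi> y\<bar> powr q + 1"
      proof (cases "\<bar>\<phi> y\<bar> \<le> 1")
        case False
        then have "\<bar>\<phi> y\<bar> powr 1 \<le> \<bar>\<phi> y\<bar> powr q" using q by (intro powr_mono) auto
        then show ?thesis using False by simp
      qed (simp add: add_increasing)
      then have "ennreal \<bar>\<phi> y\<bar> \<le> ennreal (\<bar>\<phi> y\<bar> powr q + 1)" by (rule ennreal_leI)
      then show "epowr (e2ennreal \<bar>ereal (\<phi> y)\<bar>) 1 * indicator (UNIV \<inter> ball x 1) y
          \<le> ennreal (\<bar>\<phi> y\<bar> powr q) + indicator (ball x 1) y"
        by (auto split: split_indicator)
    qed
    also have "\<dots> = (\<integral>\<^sup>+y. ennreal (\<bar>\<phi> y\<bar> powr q) \<partial>completion M)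
        + (\<integral>\<^sup>+y. indicator (ball x 1) y \<partial>completion M)"
      by (rule nn_integral_add) (auto intro!: borel_measurable_completion_borel
          borel_measurable_indicator)
    also have "\<dots> < \<infinity>"
      using Lint emeasure_ball_finite[of x 1] by (simp add: nn_integral_completion)
    finally have "(\<integral>\<^sup>+y\<in>UNIV \<inter> ball x 1. epowr (e2ennreal \<bar>ereal (\<phi> y)\<bar>) 1 \<partial>completion M) < \<infinity>" .
    then show "?u \<in> Lspace 1 M (UNIV \<inter> ball x 1)"
      using um by (simp add: Lspace_def measurable_restrict_space1)
  qed simp
  have "AE x in M. x \<in> UNIV \<longrightarrow> grad q M UNIV ?u x \<le> k x"
  proof (rule grad_minimal(2)[OF _ phi])
    have "(\<integral>\<^sup>+x\<in>UNIV. epowr (k x) q \<partial>M) = (\<integral>\<^sup>+x. 0 \<partial>M)"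
      by (intro nn_integral_cong_AE) (use k0 in \<open>auto elim: eventually_mono\<close>)
    then show "(\<integral>\<^sup>+x\<in>UNIV. epowr (k x) q \<partial>M) < \<infinity>" by simp
  qed (auto intro: curve_avoids_empty)
  then have grad0: "AE x in M. grad q M UNIV ?u x = 0" using k0 by eventually_elim simp
  obtain C l where C: "0 < C" "1 \<le> l" and pi: "\<And>u y r. u \<in> Lspace_loc 1 M UNIV \<Longrightarrow> 0 < r \<Longrightarrow>
        (\<integral>\<^sup>+x\<in>ball y r. e2ennreal \<bar>u x - ereal (mean_value M (ball y r) u)\<bar> \<partial>completion M)
          / emeasure M (ball y r)
        \<le> ennreal (C * r) *
           epowr ((\<integral>\<^sup>+x\<in>ball y (l * r). epowr (grad q M UNIV u x) p \<partial>M)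
                   / emeasure M (ball y (l * r))) (1 / p)"
    using PI unfolding weak_Poincare_def by blast
  have const: "AE x in M. x \<in> ball y r \<longrightarrow> \<phi> x = mean_value M (ball y r) ?u" if r: "0 < r" for y r
  proof -
    let ?m = "mean_value M (ball y r) ?u"
    have "(\<integral>\<^sup>+x\<in>ball y (l * r). epowr (grad q M UNIV ?u x) p \<partial>M) = (\<integral>\<^sup>+x. 0 \<partial>M)"
      by (rule nn_integral_cong_AE) (use grad0 in \<open>auto elim: eventually_mono\<close>)
    then have "(\<integral>\<^sup>+x\<in>ball y r. e2ennreal \<bar>?u x - ereal ?m\<bar> \<partial>completion M) / emeasure M (ball y r) = 0"
      using pi[OF loc r, of y] by simp
    then have "(\<integral>\<^sup>+x\<in>ball y r. ennreal \<bar>\<phi> x - ?m\<bar> \<partial>completion M) = 0"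
      using emeasure_ball_finite[of y r] by (auto simp: ennreal_divide_eq_0_iff)
    then have "AE x in completion M. ennreal \<bar>\<phi> x - ?m\<bar> * indicator (ball y r) x = 0"
    proof (subst (asm) nn_integral_0_iff_AE)
      have "(\<lambda>x. ennreal \<bar>\<phi> x - ?m\<bar>) \<in> borel_measurable (completion M)" by measurable
      moreover have "(indicator (ball y r) :: 'a \<Rightarrow> ennreal) \<in> borel_measurable (completion M)"
        by (rule borel_measurable_completion_borel) (rule borel_measurable_indicator, simp)
      ultimately show "(\<lambda>x. ennreal \<bar>\<phi> x - ?m\<bar> * indicator (ball y r) x) \<in> borel_measurable
          (completion M)"
        by (rule borel_measurable_times_ennreal)
    qed
    then have "AE x in M. ennreal \<bar>\<phi> x - ?m\<bar> * indicator (ball y r) x = 0"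
      by (simp add: AE_completion_iff)
    then show ?thesis by eventually_elim (auto split: split_indicator_asm)
  qed
  fix x0 :: 'a
  define B where "B n = ball x0 (real (Suc n))" for n
  define m where "m n = mean_value M (B n) ?u" for n
  have cB: "AE x in M. x \<in> B n \<longrightarrow> \<phi> x = m n" for n
    unfolding B_def m_def by (rule const) simp
  have Bm: "B n \<in> sets M" for n by (simp add: B_def)
  have UB: "(\<Union>n. B n) = UNIV"
  proof -
    have "x \<in> (\<Union>n. B n)" for x
    proof -
      obtain n :: nat where "dist x0 x < real n" using reals_Archimedean2 by blast
      then have "x \<in> B n" by (simp add: B_def)
      then show ?thesis by blast
    qed
    then show ?thesis by blast
  qed
  \<comment> \<open>The balls \<open>B n\<close> exhaust the space, so one of them meets \<open>Z\<close> in a set of positive measure.\<close>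
  have "\<exists>n0. emeasure M (Z \<inter> B n0) \<noteq> 0"
  proof (rule ccontr)
    assume "\<not> ?thesis"
    then have "\<And>n. Z \<inter> B n \<in> null_sets M" using Z(1) Bm by (auto intro: null_setsI)
    then have "(\<Union>n. Z \<inter> B n) \<in> null_sets M" by (intro null_sets_UN) auto
    moreover have "(\<Union>n. Z \<inter> B n) = Z" using UB by blast
    ultimately show False using Z(2) by auto
  qed
  then obtain n0 where n0: "emeasure M (Z \<inter> B n0) \<noteq> 0" by blast
  have m0: "m n = 0" if "n0 \<le> n" for n
  proof (rule ccontr)
    assume "m n \<noteq> 0"
    then have ae: "AE x in M. x \<notin> Z \<inter> B n" using cB[of n] Z(3) by (auto elim!: eventually_mono)
    have sub: "B n0 \<subseteq> B n" using that unfolding B_def by (intro subset_ball) simp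
    from ae have "AE x in M. x \<notin> Z \<inter> B n0" by eventually_elim (use sub in auto)
    then have "emeasure M (Z \<inter> B n0) = 0"
      using Z(1) Bm by (subst (asm) AE_iff_measurable[where N="Z \<inter> B n0"]) auto
    with n0 show False by simp
  qed
  have "AE x in M. \<forall>n. x \<in> B n \<longrightarrow> \<phi> x = m n" using cB by (simp add: AE_all_countable)
  then show ?thesis
  proof eventually_elim
    case (elim x)
    obtain n where "x \<in> B n" using UB by blast
    moreover have "B n \<subseteq> B (max n n0)" unfolding B_def by (intro subset_ball) simp
    ultimately have "\<phi> x = m (max n n0)" using elim by blast
    then show ?case using m0[of "max n n0"] by simp
  qed
qed

end

section \<open>The energy and its competitors\<close>

lemma powr_midpoint_strict:
  fixes x y p :: real
  assumes p: "1 < p" and xy: "0 \<le> x" "0 \<le> y" "x \<noteq> y"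
  shows "((x + y) / 2) powr p < (x powr p + y powr p) / 2"
proof -
  have *: "((x + y) / 2) powr p < (x powr p + y powr p) / 2" if xy: "0 \<le> x" "x < y" for x y :: real
  proof (cases "x = 0")
    case True
    have "(1 / 2) powr p < (1 / 2 :: real) powr 1" using p by (intro powr_less_mono') auto
    then have "(1 / 2) powr p * y powr p < 1 / 2 * y powr p" using xy
      by (intro mult_strict_right_mono) auto
    moreover have "(y / 2) powr p = (1 / 2) powr p * y powr p"
      using xy powr_mult[of "1 / 2" y p] by simp
    ultimately show ?thesis using True p by simp
  next
    case False
    then have x: "0 < x" using xy by simp
    define m where "m = (x + y) / 2"
    have m: "x < m" "m < y" using xy by (auto simp: m_def)
    have D: "((\<lambda>z. z powr p) has_real_derivative p * z powr (p - 1)) (at z)" if "0 < z" for z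
      using has_real_derivative_powr[OF that, of p] by simp
    obtain c where c: "x < c" "c < m" "m powr p - x powr p = (m - x) * (p * c powr (p - 1))"
      using MVT2[of x m "\<lambda>z. z powr p" "\<lambda>z. p * z powr (p - 1)"] m x D by auto
    obtain d where d: "m < d" "d < y" "y powr p - m powr p = (y - m) * (p * d powr (p - 1))"
      using MVT2[of m y "\<lambda>z. z powr p" "\<lambda>z. p * z powr (p - 1)"] m x D by auto
    have "c powr (p - 1) < d powr (p - 1)" using c d x p by (intro powr_less_mono2) auto
    then have "(m - x) * (p * c powr (p - 1)) < (m - x) * (p * d powr (p - 1))" using m p by simp
    also have "m - x = y - m" by (simp add: m_def field_simps)
    finally have "m powr p - x powr p < y powr p - m powr p"
      using c d \<open>m - x = y - m\<close> by simp
    then show ?thesis by (simp add: m_def)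
  qed
  show ?thesis using *[of x y] *[of y x] xy by (cases "x < y") (auto simp: add.commute)
qed

lemma powr_midpoint_le:
  fixes x y p :: real
  assumes p: "1 < p" and xy: "0 \<le> x" "0 \<le> y"
  shows "((x + y) / 2) powr p \<le> (x powr p + y powr p) / 2"
  using powr_midpoint_strict[OF p xy] by (cases "x = y") auto

context doubling_space
begin

lemma weak_ug_glue_AE:
  assumes v: "weak_ug A v k" and fa: "weak_ug A fa ha" and fb: "weak_ug A fb hb" and S:
      "S \<in> sets (completion M)"
    and eqa: "\<And>x. x \<in> A \<Longrightarrow> x \<in> S \<Longrightarrow> v x = fa x" and eqb: "\<And>x. x \<in> A \<Longrightarrow> x \<notin> S \<Longrightarrow> v x = fb x"
  obtains h where "weak_ug A v h" "AE x in M. h x = (if x \<in> S then ha x else hb x)"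
proof -
  obtain h1 where h1: "weak_ug A v h1" "AE x in M. h1 x = (if x \<in> S then ha x else k x)"
    using weak_ug_replace_AE[OF v fa S] eqa by blast
  have S': "- S \<in> sets (completion M)" using sets.compl_sets[OF S] by (simp add: Compl_eq_Diff_UNIV)
  obtain h2 where h2: "weak_ug A v h2" "AE x in M. h2 x = (if x \<in> - S then hb x else h1 x)"
    using weak_ug_replace_AE[OF h1(1) fb S'] eqb by blast
  have "AE x in M. h2 x = (if x \<in> S then ha x else hb x)"
    using h1(2) h2(2) by eventually_elim auto
  with h2(1) show ?thesis using that by blast
qed

lemma set_nn_integral_epowr_add_finite:
  assumes [measurable]: "A \<in> sets borel" "g \<in> borel_measurable borel" "h \<in> borel_measurable borel"
    and fin: "(\<integral>\<^sup>+x\<in>A. epowr (g x) q \<partial>M) < \<infinity>" "(\<integral>\<^sup>+x\<in>A. epowr (h x) q \<partial>M) < \<infinity>"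
  shows "(\<integral>\<^sup>+x\<in>A. epowr (g x + h x) q \<partial>M) < \<infinity>"
proof -
  have "(\<integral>\<^sup>+x\<in>A. epowr (g x + h x) q \<partial>M)
    \<le> (\<integral>\<^sup>+x. ennreal (2 powr q) * (epowr (g x) q * indicator A x + epowr (h x) q * indicator A x) \<partial>M)"
  proof (rule nn_integral_mono)
    fix x
    show "epowr (g x + h x) q * indicator A x
        \<le> ennreal (2 powr q) * (epowr (g x) q * indicator A x + epowr (h x) q * indicator A x)"
      using epowr_add_le[of q "g x" "h x"] q by (auto split: split_indicator)
  qed
  also have "\<dots> = ennreal (2 powr q) * ((\<integral>\<^sup>+x\<in>A. epowr (g x) q \<partial>M) + (\<integral>\<^sup>+x\<in>A. epowr (h x) q \<partial>M))"
    by (simp add: nn_integral_cmult nn_integral_add)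
  also have "\<dots> < \<infinity>" using fin by (simp add: ennreal_mult_less_top)
  finally show ?thesis .
qed

lemma Lspace_dominated:
  assumes A: "A \<in> sets borel" and w: "w \<in> borel_measurable (restrict_space (completion M) A)"
    and u: "u \<in> Lspace q M A" and v: "v \<in> Lspace q M A"
    and le: "\<And>x. x \<in> A \<Longrightarrow> e2ennreal \<bar>w x\<bar> \<le> e2ennreal \<bar>u x\<bar> + e2ennreal \<bar>v x\<bar>"
  shows "w \<in> Lspace q M A"
proof -
  have A': "A \<inter> space (completion M) \<in> sets (completion M)" using A by auto
  have m: "(\<lambda>x. epowr (e2ennreal \<bar>z x\<bar>) q * indicator A x) \<in> borel_measurable (completion M)"
    if "z \<in> Lspace q M A" for z
  proof -
    have [measurable]: "z \<in> borel_measurable (restrict_space (completion M) A)" using that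
      by (simp add: Lspace_def)
    have "(\<lambda>x. epowr (e2ennreal \<bar>z x\<bar>) q) \<in> borel_measurable (restrict_space (completion M) A)"
      by measurable
    then show ?thesis by (rule iffD1[OF borel_measurable_restrict_space_iff_ennreal[OF A']])
  qed
  have "(\<integral>\<^sup>+x\<in>A. epowr (e2ennreal \<bar>w x\<bar>) q \<partial>completion M) \<le>
    (\<integral>\<^sup>+x. ennreal (2 powr q) * (epowr (e2ennreal \<bar>u x\<bar>) q * indicator A x
        + epowr (e2ennreal \<bar>v x\<bar>) q * indicator A x) \<partial>completion M)"
  proof (rule nn_integral_mono)
    fix x
    show "epowr (e2ennreal \<bar>w x\<bar>) q * indicator A x
        \<le> ennreal (2 powr q) * (epowr (e2ennreal \<bar>u x\<bar>) q * indicator A x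
        + epowr (e2ennreal \<bar>v x\<bar>) q * indicator A x)"
    proof (cases "x \<in> A")
      case True
      have "epowr (e2ennreal \<bar>w x\<bar>) q \<le> epowr (e2ennreal \<bar>u x\<bar> + e2ennreal \<bar>v x\<bar>) q"
        using q by (intro epowr_mono le True) simp
      also have "\<dots> \<le> ennreal (2 powr q) * (epowr (e2ennreal \<bar>u x\<bar>) q + epowr (e2ennreal \<bar>v x\<bar>) q)"
        using q by (intro epowr_add_le) simp
      finally show ?thesis using True by simp
    qed simp
  qed
  also have "\<dots> = ennreal (2 powr q) * ((\<integral>\<^sup>+x\<in>A. epowr (e2ennreal \<bar>u x\<bar>) q \<partial>completion M)
      + (\<integral>\<^sup>+x\<in>A. epowr (e2ennreal \<bar>v x\<bar>) q \<partial>completion M))"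
    using m[OF u] m[OF v] by (simp add: nn_integral_cmult nn_integral_add)
  also have "\<dots> < \<infinity>"
    using u v by (simp add: Lspace_def ennreal_mult_less_top)
  finally show ?thesis using w by (simp add: Lspace_def)
qed

lemma Lspace_extend_zero:
  assumes A: "A \<in> sets borel" and w: "w \<in> Lspace q M A"
    and eq: "\<And>x. x \<in> A \<Longrightarrow> v x = w x" and zero: "\<And>x. x \<notin> A \<Longrightarrow> v x = 0"
  shows "v \<in> Lspace q M UNIV"
proof -
  have A': "A \<inter> space (completion M) \<in> sets (completion M)" using A by auto
  have "(\<lambda>x. w x * indicator A x) \<in> borel_measurable (completion M)"
    using w by (intro iffD1[OF borel_measurable_restrict_space_iff_ereal[OF A']]) (simp add: Lspace_def)
  moreover have "(\<lambda>x. w x * indicator A x) = v" using eq zero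
    by (auto simp: fun_eq_iff split: split_indicator)
  ultimately have "v \<in> borel_measurable (completion M)" by simp
  moreover have "(\<integral>\<^sup>+x\<in>UNIV. epowr (e2ennreal \<bar>v x\<bar>) q \<partial>completion M)
      = (\<integral>\<^sup>+x\<in>A. epowr (e2ennreal \<bar>w x\<bar>) q \<partial>completion M)"
    by (rule nn_integral_cong) (auto simp: eq zero split: split_indicator)
  ultimately show ?thesis using w by (simp add: Lspace_def measurable_restrict_UNIV)
qed

lemma Lspace_real_of_ereal:
  assumes A: "A \<in> sets borel" and u: "u \<in> Lspace q M A"
  shows "(\<lambda>x. ereal (real_of_ereal (u x))) \<in> Lspace q M A"
proof (rule Lspace_dominated[OF A _ u u])
  have [measurable]: "u \<in> borel_measurable (restrict_space (completion M) A)" using u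
    by (simp add: Lspace_def)
  show "(\<lambda>x. ereal (real_of_ereal (u x))) \<in> borel_measurable (restrict_space (completion M) A)"
    by measurable
  fix x
  have "e2ennreal \<bar>ereal (real_of_ereal (u x))\<bar> \<le> e2ennreal \<bar>u x\<bar>" by (cases "u x") auto
  then show "e2ennreal \<bar>ereal (real_of_ereal (u x))\<bar> \<le> e2ennreal \<bar>u x\<bar> + e2ennreal \<bar>u x\<bar>"
    by (simp add: add_increasing)
qed

lemma Lspace_AE_finite:
  assumes A: "A \<in> sets borel" and u: "u \<in> Lspace q M A"
  shows "AE x in M. x \<in> A \<longrightarrow> \<bar>u x\<bar> \<noteq> \<infinity>"
proof -
  have A': "A \<inter> space (completion M) \<in> sets (completion M)" using A by auto
  have [measurable]: "u \<in> borel_measurable (restrict_space (completion M) A)" using u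
    by (simp add: Lspace_def)
  have "(\<lambda>x. epowr (e2ennreal \<bar>u x\<bar>) q) \<in> borel_measurable (restrict_space (completion M) A)"
    by measurable
  then have "(\<lambda>x. epowr (e2ennreal \<bar>u x\<bar>) q * indicator A x) \<in> borel_measurable (completion M)"
    by (rule iffD1[OF borel_measurable_restrict_space_iff_ennreal[OF A']])
  moreover have "(\<integral>\<^sup>+x\<in>A. epowr (e2ennreal \<bar>u x\<bar>) q \<partial>completion M) \<noteq> \<infinity>" using u
    by (simp add: Lspace_def)
  ultimately have "AE x in completion M. epowr (e2ennreal \<bar>u x\<bar>) q * indicator A x \<noteq> \<infinity>"
    by (rule nn_integral_PInf_AE)
  then have "AE x in M. epowr (e2ennreal \<bar>u x\<bar>) q * indicator A x \<noteq> \<infinity>" by (simp add: AE_completion_iff)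
  then show ?thesis
    by eventually_elim auto
qed

end

lemma ennreal_add_right_cancel_le:
  fixes r s t :: ennreal
  shows "s + r \<le> t + r \<Longrightarrow> r \<noteq> \<infinity> \<Longrightarrow> s \<le> t"
  by (simp add: add.commute[of _ r] ennreal_add_left_cancel_le)

text \<open>
  The exponents, the weights and the domain of the energy functional.
\<close>

locale double_phase = doubling_space M q for M :: "'a::metric_space measure" and q +
  fixes p \<alpha> \<beta> :: real and a b :: "'a \<Rightarrow> real" and \<Omega> :: "'a set"
  assumes p: "1 < p" "p < q"
    and am: "a \<in> borel_measurable (completion M)" and bm: "b \<in> borel_measurable (completion M)"
    and \<alpha>: "0 < \<alpha>" and a: "\<And>x. \<alpha> \<le> a x \<and> a x \<le> \<beta>" and b: "\<And>x. \<alpha> \<le> b x \<and> b x \<le> \<beta>"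
    and \<Omega>: "open \<Omega>" "\<Omega> \<noteq> {}" "bounded \<Omega>"
begin

text \<open>
  The integrand of the energy, as a function of the point and of the value of the upper gradient.
\<close>

definition dens :: "'a \<Rightarrow> ennreal \<Rightarrow> ennreal" where
  "dens x t = ennreal (a x) * epowr t p + ennreal (b x) * epowr t q"

text \<open>
  The energy on \<open>S\<close> of an arbitrary upper gradient \<open>g\<close>, in place of the minimal one.
\<close>

definition energy :: "'a set \<Rightarrow> ('a \<Rightarrow> ennreal) \<Rightarrow> ennreal" where
  "energy S g = (\<integral>\<^sup>+x\<in>S. dens x (g x) \<partial>completion M)"

lemma dens_measurable:
  assumes "g \<in> borel_measurable borel"
  shows "(\<lambda>x. dens x (g x)) \<in> borel_measurable (completion M)"
proof -
  note [measurable] = am bm borel_measurable_completion_borel[OF assms]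
  show ?thesis unfolding dens_def by measurable
qed

lemma dens_0 [simp]: "dens x 0 = 0"
  by (simp add: dens_def)

lemma dens_mono: "s \<le> t \<Longrightarrow> dens x s \<le> dens x t"
  unfolding dens_def using p by (intro add_mono mult_left_mono epowr_mono) auto

lemma dens_eq_0_iff: "dens x t = 0 \<longleftrightarrow> t = 0"
proof -
  have "0 < a x" using a[of x] \<alpha> by simp
  then show ?thesis by (auto simp: dens_def)
qed

lemma dens_ennreal: "0 \<le> s \<Longrightarrow> dens x (ennreal s) = ennreal (a x * s powr p + b x * s powr q)"
proof -
  assume "0 \<le> s"
  moreover have "0 \<le> a x" "0 \<le> b x" using a[of x] b[of x] \<alpha> by auto
  ultimately show ?thesis by (simp add: dens_def ennreal_mult)
qed

lemma pq_energy_eq: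
  assumes u: "grad q M \<Omega> u \<in> borel_measurable borel"
  shows "pq_energy p q a b M \<Omega> u = energy \<Omega> (grad q M \<Omega> u)"
proof -
  note [measurable] = am bm borel_measurable_completion_borel[OF u]
  have [measurable]: "\<Omega> \<in> sets (completion M)" using \<Omega> by auto
  show ?thesis
    unfolding pq_energy_def energy_def dens_def distrib_right
    by (rule nn_integral_add[symmetric]) measurable
qed

lemma energy_mono_AE:
  assumes "AE x in M. x \<in> S \<longrightarrow> g x \<le> h x"
  shows "energy S g \<le> energy S h"
  unfolding energy_def
proof (rule nn_integral_mono_AE)
  have "AE x in completion M. x \<in> S \<longrightarrow> g x \<le> h x" using assms by (simp add: AE_completion_iff)
  then show "AE x in completion M. dens x (g x) * indicator S x \<le> dens x (h x) * indicator S x"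
    by eventually_elim (auto split: split_indicator intro: dens_mono)
qed

lemma energy_cong_AE:
  assumes "AE x in M. x \<in> S \<longrightarrow> g x = h x"
  shows "energy S g = energy S h"
  by (rule antisym; rule energy_mono_AE) (use assms in \<open>auto elim: eventually_mono\<close>)

lemma energy_split:
  assumes g: "g \<in> borel_measurable borel" and T: "T \<in> sets (completion M)" "T \<subseteq> S" and S:
      "S \<in> sets (completion M)"
  shows "energy S g = energy T g + energy (S - T) g"
proof -
  note [measurable] = dens_measurable[OF g] T(1) S
  have "energy S g = (\<integral>\<^sup>+x. dens x (g x) * indicator T x
      + dens x (g x) * indicator (S - T) x \<partial>completion M)"
    unfolding energy_def by (rule nn_integral_cong) (use T(2) in \<open>auto split: split_indicator\<close>)
  also have "\<dots> = energy T g + energy (S - T) g" unfolding energy_def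
    by (rule nn_integral_add) measurable
  finally show ?thesis .
qed

lemma energy_finite:
  assumes g: "g \<in> borel_measurable borel" and fin: "(\<integral>\<^sup>+x\<in>\<Omega>. epowr (g x) q \<partial>M) < \<infinity>"
  shows "energy \<Omega> g < \<infinity>"
proof -
  note [measurable] = g
  have [measurable]: "\<Omega> \<in> sets borel" using \<Omega> by auto
  have \<beta>: "0 \<le> \<beta>" using a[of undefined] \<alpha> by auto
  obtain x0 r where "\<Omega> \<subseteq> cball x0 r" using \<Omega>(3) by (auto simp: bounded_def subset_eq)
  then have "\<Omega> \<subseteq> ball x0 (r + 1)" by (auto simp: subset_eq)
  then have "emeasure M \<Omega> \<le> emeasure M (ball x0 (r + 1))" by (rule emeasure_mono) simp
  then have mu: "emeasure M \<Omega> < \<infinity>" using emeasure_ball_finite le_less_trans by blast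
  have "energy \<Omega> g \<le> (\<integral>\<^sup>+x. ennreal \<beta> * (indicator \<Omega> x + 2 * (epowr (g x) q * indicator \<Omega> x)) \<partial>M)"
    unfolding energy_def nn_integral_completion
  proof (rule nn_integral_mono)
    fix x
    have pq: "epowr (g x) p \<le> 1 + epowr (g x) q"
    proof (cases "g x \<le> 1")
      case True
      then have "epowr (g x) p \<le> epowr 1 p" using p by (intro epowr_mono) auto
      also have "epowr 1 p = 1" using epowr_ennreal[of 1 p] by simp
      finally show ?thesis by (simp add: add_increasing2)
    next
      case False
      have "epowr (g x) p \<le> epowr (g x) q"
      proof (cases "g x")
        case (real z)
        then have "1 \<le> z" using False by (simp add: ennreal_le_1)
        then have "z powr p \<le> z powr q" using p by (intro powr_mono) auto
        then show ?thesis using real by (simp add: ennreal_leI)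
      qed simp
      then show ?thesis by (simp add: add_increasing)
    qed
    have "dens x (g x) \<le> ennreal \<beta> * epowr (g x) p + ennreal \<beta> * epowr (g x) q"
      unfolding dens_def using a[of x] b[of x] by (intro add_mono mult_right_mono ennreal_leI) auto
    also have "\<dots> = ennreal \<beta> * (epowr (g x) p + epowr (g x) q)" by (simp add: distrib_left)
    also have "\<dots> \<le> ennreal \<beta> * (1 + epowr (g x) q + epowr (g x) q)"
      using pq by (intro mult_left_mono add_right_mono) auto
    finally show "dens x (g x) * indicator \<Omega> x \<le> ennreal \<beta> * (indicator \<Omega> x
        + 2 * (epowr (g x) q * indicator \<Omega> x))"
      by (auto split: split_indicator simp: mult_2 add.assoc)
  qed
  also have "\<dots> = ennreal \<beta> * (emeasure M \<Omega> + 2 * (\<integral>\<^sup>+x\<in>\<Omega>. epowr (g x) q \<partial>M))"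
    by (simp add: nn_integral_cmult nn_integral_add)
  also have "\<dots> < \<infinity>" using mu fin by (simp add: ennreal_mult_less_top)
  finally show ?thesis .
qed

lemma dens_midpoint_le: "dens x ((s + t) / 2) \<le> (dens x s + dens x t) / 2"
  and dens_midpoint_strict: "s \<noteq> top \<Longrightarrow> t \<noteq> top \<Longrightarrow> s \<noteq> t \<Longrightarrow> dens x ((s + t) / 2) < (dens x s
      + dens x t) / 2"
proof -
  have pos: "0 < a x" "0 < b x" using a[of x] b[of x] \<alpha> by auto
  have q1: "1 < q" by (rule q)
  have conv: "dens x ((s + t) / 2) = ennreal (a x * ((y + z) / 2) powr p + b x * ((y + z) / 2) powr q)"
    "(dens x s + dens x t) / 2 = ennreal ((a x * y powr p + b x * y powr q + (a x * z powr p
        + b x * z powr q)) / 2)"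
    if "s = ennreal y" "t = ennreal z" "0 \<le> y" "0 \<le> z" for y z
  proof -
    have "(s + t) / 2 = ennreal ((y + z) / 2)"
      using that by (simp add: divide_ennreal flip: ennreal_plus ennreal_numeral)
    then show "dens x ((s + t) / 2) = ennreal (a x * ((y + z) / 2) powr p + b x * ((y + z) / 2) powr q)"
      using that by (simp add: dens_ennreal del: ennreal_plus)
    show "(dens x s + dens x t) / 2 = ennreal ((a x * y powr p + b x * y powr q + (a x * z powr p
        + b x * z powr q)) / 2)"
      using that pos by (simp add: dens_ennreal divide_ennreal flip: ennreal_plus ennreal_numeral)
  qed
  show "dens x ((s + t) / 2) \<le> (dens x s + dens x t) / 2"
  proof (cases "s = top \<or> t = top")
    case True
    then have "dens x s = top \<or> dens x t = top" using pos by (auto simp: dens_def ennreal_mult_top)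
    then show ?thesis by (auto simp: ennreal_top_divide)
  next
    case False
    then obtain y z where yz: "s = ennreal y" "t = ennreal z" "0 \<le> y" "0 \<le> z" by (cases s; cases t) auto
    have "a x * ((y + z) / 2) powr p \<le> a x * ((y powr p + z powr p) / 2)"
      using pos yz p by (intro mult_left_mono powr_midpoint_le) auto
    moreover have "b x * ((y + z) / 2) powr q \<le> b x * ((y powr q + z powr q) / 2)"
      using pos yz q by (intro mult_left_mono powr_midpoint_le) auto
    ultimately show ?thesis unfolding conv[OF yz] by (intro ennreal_leI) (simp add: field_simps)
  qed
  show "dens x ((s + t) / 2) < (dens x s + dens x t) / 2" if ne: "s \<noteq> top" "t \<noteq> top" "s \<noteq> t"
  proof -
    obtain y z where yz: "s = ennreal y" "t = ennreal z" "0 \<le> y" "0 \<le> z" using ne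
      by (cases s; cases t) auto
    have "y \<noteq> z" using ne yz by auto
    then have 1: "a x * ((y + z) / 2) powr p < a x * ((y powr p + z powr p) / 2)"
      using pos yz p by (intro mult_strict_left_mono powr_midpoint_strict) auto
    have 2: "b x * ((y + z) / 2) powr q \<le> b x * ((y powr q + z powr q) / 2)"
      using pos yz q by (intro mult_left_mono powr_midpoint_le) auto
    have "a x * ((y + z) / 2) powr p + b x * ((y + z) / 2) powr q
        < a x * ((y powr p + z powr p) / 2) + b x * ((y powr q + z powr q) / 2)"
      by (rule add_less_le_mono[OF 1 2])
    also have "\<dots> = (a x * y powr p + b x * y powr q + (a x * z powr p + b x * z powr q)) / 2"
      by (simp add: field_simps)
    finally have "a x * ((y + z) / 2) powr p + b x * ((y + z) / 2) powr q
      < (a x * y powr p + b x * y powr q + (a x * z powr p + b x * z powr q)) / 2" .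
    moreover have "0 \<le> a x * ((y + z) / 2) powr p + b x * ((y + z) / 2) powr q" using pos by simp
    ultimately show ?thesis unfolding conv[OF yz] by (simp only: ennreal_less_iff)
  qed
qed

text \<open>
  A minimizer can be compared with real-valued competitors \<open>v\<close> that agree with its real part off \<open>V\<close>,
  and any weak upper gradient \<open>h\<close> of \<open>v\<close> may be used. The difference \<open>u - v\<close> is infinite where \<open>u\<close> is,
  but almost every path avoids these points.
\<close>

lemma minimizer_le_competitor:
  assumes u: "pq_minimizer p q a b M \<Omega> u" and V: "open V" "closure V \<subseteq> \<Omega>"
    and v: "weak_ug \<Omega> v h" "(\<integral>\<^sup>+x\<in>\<Omega>. epowr (h x) q \<partial>M) < \<infinity>" "(\<lambda>x. ereal (v x)) \<in> Lspace q M \<Omega>"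
    and eq: "\<And>x. x \<in> \<Omega> \<Longrightarrow> x \<notin> V \<Longrightarrow> v x = real_of_ereal (u x)"
  shows "energy \<Omega> (grad q M \<Omega> u) \<le> energy \<Omega> h"
proof -
  have \<Omega>b[measurable]: "\<Omega> \<in> sets borel" using \<Omega> by auto
  have VO: "V \<subseteq> \<Omega>" using V closure_subset by blast
  have uN: "u \<in> N1 q M \<Omega>" using u by (simp add: pq_minimizer_def)
  note uD = N1_weak_ug[OF \<Omega>(1,2) uN]
  let ?g = "grad q M \<Omega> u"
  have gm[measurable]: "?g \<in> borel_measurable borel" "h \<in> borel_measurable borel" using uD(1) v(1)
    by (auto dest: weak_ug_measurable)
  have vN: "(\<lambda>x. ereal (v x)) \<in> N1 q M \<Omega>"
    by (rule N1_intro[OF \<Omega>(1) v(3) v(1,2)]) (simp add: curve_avoids_empty)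
  define d where "d x = (if x \<in> V then real_of_ereal (u x) - v x else 0)" for x
  define v0 where "v0 x = (if x \<in> \<Omega> then u x - ereal (v x) else 0)" for x
  have cd0: "weak_ug \<Omega> (\<lambda>x. real_of_ereal (u x) - v x) (\<lambda>x. ?g x + h x)"
    by (rule weak_ug_add[OF uD(1) v(1)]) auto
  have fin: "(\<integral>\<^sup>+x\<in>\<Omega>. epowr (?g x + h x) q \<partial>M) < \<infinity>"
    by (rule set_nn_integral_epowr_add_finite[OF \<Omega>b gm uD(3) v(2)])
  have finV: "(\<integral>\<^sup>+x\<in>V. epowr (?g x + h x) q \<partial>M) < \<infinity>"
    by (rule le_less_trans[OF set_nn_integral_mono_set[OF VO] fin])
  have fr: "{x \<in> frontier V. real_of_ereal (u x) - v x \<noteq> 0} = {}"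
  proof -
    have "v x = real_of_ereal (u x)" if "x \<in> frontier V" for x
      using that V by (intro eq) (auto simp: frontier_def interior_open)
    then show ?thesis by auto
  qed
  have cd: "weak_ug UNIV d (\<lambda>x. if x \<in> V then ?g x + h x else 0)"
    unfolding d_def by (rule weak_ug_extend_zero[OF cd0 V finV]) (simp only: fr curve_avoids_empty)
  have dfin: "(\<integral>\<^sup>+x\<in>UNIV. epowr (if x \<in> V then ?g x + h x else 0) q \<partial>M) < \<infinity>"
  proof -
    have "(\<integral>\<^sup>+x\<in>UNIV. epowr (if x \<in> V then ?g x + h x else 0) q \<partial>M) = (\<integral>\<^sup>+x\<in>V. epowr (?g x + h x) q \<partial>M)"
      by (rule nn_integral_cong) (auto split: split_indicator)
    then show ?thesis using finV by simp
  qed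
  have av: "curve_avoids UNIV {x. v0 x \<noteq> ereal (d x)}"
  proof (rule curve_avoids_mono)
    show "curve_avoids UNIV {x \<in> \<Omega>. \<bar>u x\<bar> = \<infinity>}"
      by (rule curve_avoids_extend[OF curve_avoids_mono[OF uD(2)] _ \<Omega>(1)]) auto
    show "{x. v0 x \<noteq> ereal (d x)} \<subseteq> {x \<in> \<Omega>. \<bar>u x\<bar> = \<infinity>}"
    proof (rule subsetI, rule ccontr)
      fix x assume x: "x \<in> {x. v0 x \<noteq> ereal (d x)}" and n: "x \<notin> {x \<in> \<Omega>. \<bar>u x\<bar> = \<infinity>}"
      show False
      proof (cases "x \<in> \<Omega>")
        case True
        then obtain r where "u x = ereal r" using n by (cases "u x") auto
        then show False using x True eq[of x] by (auto simp: v0_def d_def split: if_splits)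
      next
        case False
        then have "x \<notin> V" using VO by blast
        then show False using x False by (auto simp: v0_def d_def)
      qed
    qed
  qed
  have v0\<Omega>: "(\<lambda>x. u x - ereal (v x)) \<in> Lspace q M \<Omega>"
  proof (rule Lspace_dominated[OF \<Omega>b _ uD(4) v(3)])
    have [measurable]: "u \<in> borel_measurable (restrict_space (completion M) \<Omega>)"
        "(\<lambda>x. ereal (v x)) \<in> borel_measurable (restrict_space (completion M) \<Omega>)" using uD(4) v(3)
      by (simp_all add: Lspace_def)
    show "(\<lambda>x. u x - ereal (v x)) \<in> borel_measurable (restrict_space (completion M) \<Omega>)" by measurable
    fix x
    show "e2ennreal \<bar>u x - ereal (v x)\<bar> \<le> e2ennreal \<bar>u x\<bar> + e2ennreal \<bar>ereal (v x)\<bar>"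
      by (cases "u x") (auto intro!: ennreal_leI simp flip: ennreal_plus simp: top_unique)
  qed
  have v0L: "v0 \<in> Lspace q M UNIV"
    by (rule Lspace_extend_zero[OF \<Omega>b v0\<Omega>]) (auto simp: v0_def)
  have "v0 \<in> N1 q M UNIV" by (rule N1_intro[OF _ v0L cd dfin av]) simp
  then have "(\<lambda>x. u x - ereal (v x)) \<in> N1_0 q M \<Omega>"
    unfolding N1_0_def by (intro CollectI bexI[of _ v0]) (auto simp: v0_def)
  then have le: "pq_energy p q a b M \<Omega> u \<le> pq_energy p q a b M \<Omega> (\<lambda>x. ereal (v x))"
    using u vN by (simp add: pq_minimizer_def)
  have "grad q M \<Omega> (\<lambda>x. ereal (v x)) \<in> borel_measurable borel"
    using N1_weak_ug(1)[OF \<Omega>(1,2) vN] by (rule weak_ug_measurable)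
  then have "pq_energy p q a b M \<Omega> (\<lambda>x. ereal (v x)) = energy \<Omega> (grad q M \<Omega> (\<lambda>x. ereal (v x)))"
    by (rule pq_energy_eq)
  also have "\<dots> \<le> energy \<Omega> h"
    by (rule energy_mono_AE, rule grad_minimal(2)[OF \<Omega>(1) v(1,2)]) (simp add: curve_avoids_empty)
  finally show ?thesis using le pq_energy_eq[OF gm(1)] by simp
qed

lemma energy_mono_set: "S \<subseteq> T \<Longrightarrow> energy S g \<le> energy T g"
  unfolding energy_def by (rule set_nn_integral_mono_set)

text \<open>
  If \<open>v\<close> equals \<open>w\<close> on \<open>A\<close> and the minimizer elsewhere, then on \<open>A\<close> the minimizer has no more energy
  than \<open>w\<close>.
\<close>

lemma energy_exchange:
  assumes u: "pq_minimizer p q a b M \<Omega> u" and V: "open V" "closure V \<subseteq> \<Omega>"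
    and A: "A \<in> sets (completion M)" "A \<subseteq> V"
    and v: "weak_ug \<Omega> v k" "(\<lambda>x. ereal (v x)) \<in> Lspace q M \<Omega>"
    and w: "weak_ug \<Omega> w h" "(\<integral>\<^sup>+x\<in>\<Omega>. epowr (h x) q \<partial>M) < \<infinity>"
    and eq: "\<And>x. x \<in> A \<Longrightarrow> v x = w x" "\<And>x. x \<in> \<Omega> \<Longrightarrow> x \<notin> A \<Longrightarrow> v x = real_of_ereal (u x)"
  shows "energy A (grad q M \<Omega> u) \<le> energy A h"
proof -
  let ?g = "grad q M \<Omega> u"
  have \<Omega>b: "\<Omega> \<in> sets borel" and \<Omega>c: "\<Omega> \<in> sets (completion M)" using \<Omega> by auto
  have AO: "A \<subseteq> \<Omega>" using A(2) V closure_subset by blast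
  have "u \<in> N1 q M \<Omega>" using u by (simp add: pq_minimizer_def)
  note D = N1_weak_ug[OF \<Omega>(1,2) this]
  have gm: "?g \<in> borel_measurable borel" using D(1) by (rule weak_ug_measurable)
  have hm: "h \<in> borel_measurable borel" using w(1) by (rule weak_ug_measurable)
  obtain m where m: "weak_ug \<Omega> v m" "AE x in M. m x = (if x \<in> A then h x else ?g x)"
    by (rule weak_ug_glue_AE[OF v(1) w(1) D(1) A(1)]) (auto simp: eq)
  have mm: "m \<in> borel_measurable borel" using m(1) by (rule weak_ug_measurable)
  have "(\<integral>\<^sup>+x\<in>\<Omega>. epowr (m x) q \<partial>M) \<le> (\<integral>\<^sup>+x\<in>\<Omega>. epowr (?g x + h x) q \<partial>M)"
  proof (rule nn_integral_mono_AE)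
    show "AE x in M. epowr (m x) q * indicator \<Omega> x \<le> epowr (?g x + h x) q * indicator \<Omega> x"
      using m(2) by eventually_elim
        (use q in \<open>auto intro!: epowr_mono mult_right_mono simp: add_increasing add_increasing2\<close>)
  qed
  also have "\<dots> < \<infinity>" by (rule set_nn_integral_epowr_add_finite[OF \<Omega>b gm hm D(3) w(2)])
  finally have mfin: "(\<integral>\<^sup>+x\<in>\<Omega>. epowr (m x) q \<partial>M) < \<infinity>" .
  have "energy (\<Omega> - A) ?g \<le> energy \<Omega> ?g" by (rule energy_mono_set) auto
  also have "\<dots> < \<infinity>" by (rule energy_finite[OF gm D(3)])
  finally have fin: "energy (\<Omega> - A) ?g \<noteq> \<infinity>" by simp
  have "energy A ?g + energy (\<Omega> - A) ?g = energy \<Omega> ?g"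
    by (rule energy_split[OF gm A(1) AO \<Omega>c, symmetric])
  also have "\<dots> \<le> energy \<Omega> m"
    by (rule minimizer_le_competitor[OF u V m(1) mfin v(2)]) (use A(2) in \<open>auto intro: eq\<close>)
  also have "\<dots> = energy A m + energy (\<Omega> - A) m" by (rule energy_split[OF mm A(1) AO \<Omega>c])
  also have "energy A m = energy A h" by (rule energy_cong_AE) (use m(2) in eventually_elim, auto)
  also have "energy (\<Omega> - A) m = energy (\<Omega> - A) ?g"
    by (rule energy_cong_AE) (use m(2) in eventually_elim, auto)
  finally show ?thesis by (rule ennreal_add_right_cancel_le[OF _ fin])
qed

end

section \<open>The comparison principle\<close>

context double_phase
begin

lemma minimizer_comparison:
  assumes PI: "weak_Poincare q p M" and mu\<Omega>: "0 < emeasure M (- \<Omega>)"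
    and V: "open V" "closure V \<subseteq> \<Omega>"
    and min1: "pq_minimizer p q a b M \<Omega> u1" and min2: "pq_minimizer p q a b M \<Omega> u2"
    and E0: "capacity q M E0 = 0" "\<And>x. x \<in> frontier V - E0 \<Longrightarrow> u2 x \<le> u1 x"
  shows "qe_in q M V (\<lambda>x. u2 x \<le> u1 x)"
proof -
  have \<Omega>b[measurable]: "\<Omega> \<in> sets borel" and Vb[measurable]: "V \<in> sets borel" using \<Omega> V by auto
  have \<Omega>c[measurable]: "\<Omega> \<in> sets (completion M)" and Vc[measurable]: "V \<in> sets (completion M)"
    using \<Omega> V by auto
  have \<Omega>': "\<Omega> \<inter> space (completion M) \<in> sets (completion M)" by simp
  have VO: "V \<subseteq> \<Omega>" using V closure_subset by blast
  have frO: "frontier V \<subseteq> \<Omega>" using V by (auto simp: frontier_def)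
  have u1N: "u1 \<in> N1 q M \<Omega>" and u2N: "u2 \<in> N1 q M \<Omega>" using min1 min2 by (auto simp: pq_minimizer_def)
  note D1 = N1_weak_ug[OF \<Omega>(1,2) u1N] and D2 = N1_weak_ug[OF \<Omega>(1,2) u2N]
  define f1 where "f1 x = real_of_ereal (u1 x)" for x
  define f2 where "f2 x = real_of_ereal (u2 x)" for x
  define g1 where "g1 = grad q M \<Omega> u1"
  define g2 where "g2 = grad q M \<Omega> u2"
  have c1: "weak_ug \<Omega> f1 g1" and c2: "weak_ug \<Omega> f2 g2"
    using D1(1) D2(1) by (simp_all add: f1_def[abs_def] f2_def[abs_def] g1_def g2_def)
  have gm[measurable]: "g1 \<in> borel_measurable borel" "g2 \<in> borel_measurable borel"
    using c1 c2 by (auto dest: weak_ug_measurable)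
  have g1fin: "(\<integral>\<^sup>+x\<in>\<Omega>. epowr (g1 x) q \<partial>M) < \<infinity>" and g2fin: "(\<integral>\<^sup>+x\<in>\<Omega>. epowr (g2 x) q \<partial>M) < \<infinity>"
    using D1(3) D2(3) by (simp_all add: g1_def g2_def)
  have f1L: "(\<lambda>x. ereal (f1 x)) \<in> Lspace q M \<Omega>" and f2L: "(\<lambda>x. ereal (f2 x)) \<in> Lspace q M \<Omega>"
    using Lspace_real_of_ereal[OF \<Omega>b D1(4)] Lspace_real_of_ereal[OF \<Omega>b D2(4)]
    by (simp_all add: f1_def f2_def)
  then have "(\<lambda>x. ereal (f1 x)) \<in> borel_measurable (restrict_space (completion M) \<Omega>)"
    "(\<lambda>x. ereal (f2 x)) \<in> borel_measurable (restrict_space (completion M) \<Omega>)"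
      by (simp_all add: Lspace_def)
  then have fr[measurable]: "f1 \<in> borel_measurable (restrict_space (completion M) \<Omega>)"
    "f2 \<in> borel_measurable (restrict_space (completion M) \<Omega>)" by simp_all
  \<comment> \<open>The functions are measurable on \<open>\<Omega>\<close> only; cutting them off gives functions measurable on the whole
    space that agree with them on \<open>V\<close>.\<close>
  define F1 where "F1 x = indicator \<Omega> x *\<^sub>R f1 x" for x
  define F2 where "F2 x = indicator \<Omega> x *\<^sub>R f2 x" for x
  have Fm[measurable]: "F1 \<in> borel_measurable (completion M)" "F2 \<in> borel_measurable (completion M)"
    unfolding F1_def[abs_def] F2_def[abs_def]
    by (rule iffD1[OF borel_measurable_restrict_space_iff[OF \<Omega>'] fr(1)],
        rule iffD1[OF borel_measurable_restrict_space_iff[OF \<Omega>'] fr(2)])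
  have F: "F1 x = f1 x" "F2 x = f2 x" if "x \<in> V" for x using that VO by (auto simp: F1_def F2_def)

  define \<psi> where "\<psi> x = max 0 (f2 x - f1 x)" for x
  define \<phi> where "\<phi> x = (if x \<in> V then \<psi> x else 0)" for x
  define k where "k x = (if x \<in> V then g1 x + g2 x else 0)" for x
  define A where "A = {x \<in> V. f1 x < f2 x}"
  have A_eq: "A = V \<inter> {x \<in> space (completion M). F1 x < F2 x}" using F by (auto simp: A_def)
  have A_meas[measurable]: "A \<in> sets (completion M)" unfolding A_eq by measurable
  have AV: "A \<subseteq> V" by (auto simp: A_def)
  have AO: "A \<subseteq> \<Omega>" using AV VO by simp
  have phi_A: "\<phi> x = f2 x - f1 x" if "x \<in> A" for x using that by (auto simp: \<phi>_def \<psi>_def A_def)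
  have phi_nA: "\<phi> x = 0" if "x \<notin> A" for x using that by (auto simp: \<phi>_def \<psi>_def A_def)
  have phi_eq: "\<phi> = (\<lambda>x. if x \<in> V then max 0 (F2 x - F1 x) else 0)" using F
    by (auto simp: \<phi>_def \<psi>_def fun_eq_iff)
  have phim[measurable]: "\<phi> \<in> borel_measurable (completion M)" unfolding phi_eq by measurable
  have phimr[measurable]: "\<phi> \<in> borel_measurable (restrict_space (completion M) \<Omega>)" using phim
    by (rule measurable_restrict_space1)
  have cpsi: "weak_ug \<Omega> \<psi> (\<lambda>x. g1 x + g2 x)"
    by (rule weak_ug_add[OF c1 c2]) (auto simp: \<psi>_def max_def)
  have sumfin: "(\<integral>\<^sup>+x\<in>\<Omega>. epowr (g1 x + g2 x) q \<partial>M) < \<infinity>"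
    by (rule set_nn_integral_epowr_add_finite[OF \<Omega>b gm g1fin g2fin])
  have hfin: "(\<integral>\<^sup>+x\<in>\<Omega>. epowr (h x) q \<partial>M) < \<infinity>" if "AE x in M. h x \<le> g1 x + g2 x" for h
  proof (rule le_less_trans[OF nn_integral_mono_AE sumfin])
    show "AE x in M. epowr (h x) q * indicator \<Omega> x \<le> epowr (g1 x + g2 x) q * indicator \<Omega> x"
      using that by eventually_elim (use q in \<open>auto split: split_indicator intro: epowr_mono\<close>)
  qed
  \<comment> \<open>Outside \<open>N\<close> the real parts of \<open>u1\<close> and \<open>u2\<close> may be compared instead of \<open>u1\<close> and \<open>u2\<close>.\<close>
  define N where "N = {x \<in> \<Omega>. \<bar>u1 x\<bar> = \<infinity>} \<union> {x \<in> \<Omega>. \<bar>u2 x\<bar> = \<infinity>}"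
  have avN: "curve_avoids UNIV N"
    unfolding N_def
    by (intro curve_avoids_Un curve_avoids_extend[OF _ _ \<Omega>(1)]; (rule curve_avoids_mono[OF D1(2)]
        curve_avoids_mono[OF D2(2)])?) auto
  have N_AE: "AE x in M. x \<notin> N"
    using Lspace_AE_finite[OF \<Omega>b D1(4)] Lspace_AE_finite[OF \<Omega>b D2(4)]
    by eventually_elim (auto simp: N_def)
  have real_le: "f2 x \<le> f1 x \<longleftrightarrow> u2 x \<le> u1 x" if "x \<in> \<Omega>" "x \<notin> N" for x
    using that by (cases "u1 x"; cases "u2 x") (auto simp: f1_def f2_def N_def)
  have "curve_avoids UNIV {x \<in> frontier V. \<psi> x \<noteq> 0}"
  proof (rule curve_avoids_mono[OF curve_avoids_Un[OF capacity_zero_avoids[OF E0(1)] avN]],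
      rule subsetI)
    fix x assume x: "x \<in> {x \<in> frontier V. \<psi> x \<noteq> 0}"
    show "x \<in> E0 \<union> N"
    proof (rule ccontr)
      assume n: "x \<notin> E0 \<union> N"
      then have "f2 x \<le> f1 x" using x frO E0(2)[of x] real_le[of x] by auto
      then show False using x by (simp add: \<psi>_def)
    qed
  qed
  then have cphi: "weak_ug UNIV \<phi> k"
    unfolding \<phi>_def[abs_def] k_def[abs_def]
    using le_less_trans[OF set_nn_integral_mono_set[OF VO] sumfin]
    by (intro weak_ug_extend_zero[OF cpsi V])
  have cphiO: "weak_ug \<Omega> \<phi> k" using cphi by (rule weak_ug_subset) simp

  have vL: "(\<lambda>x. ereal (v x)) \<in> Lspace q M \<Omega>"
    if "v \<in> borel_measurable (restrict_space (completion M) \<Omega>)" "\<And>x. x \<in> \<Omega> \<Longrightarrow> \<bar>v x\<bar> \<le> \<bar>f1 x\<bar>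
        + \<bar>f2 x\<bar>" for v
  proof (rule Lspace_dominated[OF \<Omega>b _ f1L f2L])
    show "(\<lambda>x. ereal (v x)) \<in> borel_measurable (restrict_space (completion M) \<Omega>)" using that(1) by simp
    fix x assume "x \<in> \<Omega>"
    then have "ennreal \<bar>v x\<bar> \<le> ennreal (\<bar>f1 x\<bar> + \<bar>f2 x\<bar>)" using that(2) by (intro ennreal_leI)
    then show "e2ennreal \<bar>ereal (v x)\<bar> \<le> e2ennreal \<bar>ereal (f1 x)\<bar> + e2ennreal \<bar>ereal (f2 x)\<bar>" by simp
  qed
  have fin1: "energy \<Omega> g1 < \<infinity>" by (rule energy_finite[OF gm(1) g1fin])
  have efin: "energy A g1 < \<infinity>"
    using energy_mono_set[OF AO] fin1 by (rule le_less_trans)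
  have e12: "energy A g1 \<le> energy A g2"
    unfolding g1_def
  proof (rule energy_exchange[OF min1 V A_meas AV _ _ c2 g2fin])
    show "weak_ug \<Omega> (\<lambda>x. f1 x + \<phi> x) (\<lambda>x. g1 x + k x)" by (rule weak_ug_add[OF c1 cphiO]) auto
    show "(\<lambda>x. ereal (f1 x + \<phi> x)) \<in> Lspace q M \<Omega>"
    proof (rule vL)
      show "\<bar>f1 x + \<phi> x\<bar> \<le> \<bar>f1 x\<bar> + \<bar>f2 x\<bar>" for x by (cases "x \<in> A") (auto simp: phi_A phi_nA)
    qed measurable
  qed (simp_all add: phi_A phi_nA f1_def)
  have e21: "energy A g2 \<le> energy A g1"
    unfolding g2_def
  proof (rule energy_exchange[OF min2 V A_meas AV _ _ c1 g1fin])
    show "weak_ug \<Omega> (\<lambda>x. f2 x - \<phi> x) (\<lambda>x. g2 x + k x)" by (rule weak_ug_add[OF c2 cphiO]) auto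
    show "(\<lambda>x. ereal (f2 x - \<phi> x)) \<in> Lspace q M \<Omega>"
    proof (rule vL)
      show "\<bar>f2 x - \<phi> x\<bar> \<le> \<bar>f1 x\<bar> + \<bar>f2 x\<bar>" for x by (cases "x \<in> A") (auto simp: phi_A phi_nA)
    qed measurable
  qed (simp_all add: phi_A phi_nA f2_def)
  have e_eq: "energy A g1 = energy A g2" using e12 e21 by (rule antisym)

  define gh where "gh x = (g1 x + g2 x) / 2" for x
  have ghm[measurable]: "gh \<in> borel_measurable borel" unfolding gh_def by measurable
  have half: "ennreal (1 / 2) * y = y / 2" for y
  proof -
    have "inverse 2 = ennreal (1 / 2)" using inverse_ennreal[of 2] by (simp add: inverse_eq_divide)
    then show ?thesis by (simp only: divide_ennreal_def mult.commute)
  qed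
  have gh_le: "gh x \<le> g1 x + g2 x" for x
  proof -
    have "ennreal (1 / 2) \<le> ennreal 1" by (rule ennreal_leI) simp
    then have "ennreal (1 / 2) * (g1 x + g2 x) \<le> ennreal 1 * (g1 x + g2 x)"
      by (rule mult_right_mono) simp
    then show ?thesis by (simp only: gh_def half ennreal_1 mult_1)
  qed
  have emid: "energy A g1 \<le> energy A gh"
    unfolding g1_def
  proof (rule energy_exchange[OF min1 V A_meas AV])
    show "weak_ug \<Omega> (\<lambda>x. f1 x + \<phi> x / 2) (\<lambda>x. g1 x + k x)"
      by (rule weak_ug_add[OF c1 cphiO]) (auto simp: abs_if field_simps)
    show "(\<lambda>x. ereal (f1 x + \<phi> x / 2)) \<in> Lspace q M \<Omega>"
    proof (rule vL)
      show "\<bar>f1 x + \<phi> x / 2\<bar> \<le> \<bar>f1 x\<bar> + \<bar>f2 x\<bar>" for x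
        by (cases "x \<in> A") (auto simp: phi_A phi_nA abs_if field_simps)
    qed measurable
    have "weak_ug \<Omega> (\<lambda>x. (f1 x + f2 x) / 2) (\<lambda>x. ennreal (1 / 2) * (g1 x + g2 x))"
    proof (rule weak_ug_cmult)
      show "weak_ug \<Omega> (\<lambda>x. f1 x + f2 x) (\<lambda>x. g1 x + g2 x)" by (rule weak_ug_add[OF c1 c2]) auto
    qed (auto simp: abs_if field_simps)
    then show "weak_ug \<Omega> (\<lambda>x. (f1 x + f2 x) / 2) gh" by (simp only: half gh_def[abs_def])
    show "(\<integral>\<^sup>+x\<in>\<Omega>. epowr (gh x) q \<partial>M) < \<infinity>" by (rule hfin) (simp add: gh_le)
    show "f1 x + \<phi> x / 2 = (f1 x + f2 x) / 2" if "x \<in> A" for x using that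
      by (simp add: phi_A field_simps)
  qed (simp add: phi_nA f1_def)
  have gfin: "AE x in M. x \<in> \<Omega> \<longrightarrow> g1 x \<noteq> top \<and> g2 x \<noteq> top"
  proof -
    have "AE x in M. epowr (g1 x) q * indicator \<Omega> x \<noteq> \<infinity>"
      by (rule nn_integral_PInf_AE) (use g1fin in auto)
    moreover have "AE x in M. epowr (g2 x) q * indicator \<Omega> x \<noteq> \<infinity>"
      by (rule nn_integral_PInf_AE) (use g2fin in auto)
    ultimately show ?thesis by eventually_elim auto
  qed
  \<comment> \<open>The integrated midpoint inequality
    for \<open>dens\<close> is an equality, so the inequality itself is an equality
    almost everywhere.\<close>
  have g_eq: "AE x in M. x \<in> A \<longrightarrow> g1 x = g2 x"
  proof -
    note [measurable] = dens_measurable[OF gm(1)] dens_measurable[OF gm(2)] dens_measurable[OF ghm]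
    have "AE x in completion M. (dens x (g1 x) + dens x (g2 x)) / 2 * indicator A x
        \<le> dens x (gh x) * indicator A x"
    proof (rule nn_integral_le_imp_AE_le)
      show "AE x in completion M. dens x (gh x) * indicator A x \<le> (dens x (g1 x)
          + dens x (g2 x)) / 2 * indicator A x"
        unfolding gh_def by (intro AE_I2 mult_right_mono dens_midpoint_le) simp
      have "(\<integral>\<^sup>+x\<in>A. (dens x (g1 x) + dens x (g2 x)) / 2 \<partial>completion M) = (energy A g1
          + energy A g2) / 2"
      proof -
        have "(\<integral>\<^sup>+x\<in>A. (dens x (g1 x) + dens x (g2 x)) / 2 \<partial>completion M)
          = (\<integral>\<^sup>+x. (dens x (g1 x) * indicator A x + dens x (g2 x) * indicator A x) / 2 \<partial>completion M)"
          by (rule nn_integral_cong) (auto split: split_indicator)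
        also have "\<dots> = (energy A g1 + energy A g2) / 2"
          unfolding energy_def by (subst nn_integral_divide) (simp_all add: nn_integral_add)
        finally show ?thesis .
      qed
      also have "\<dots> = energy A g1"
        unfolding e_eq mult_2_right[symmetric] by (rule mult_divide_eq_ennreal) auto
      finally have mid: "(\<integral>\<^sup>+x\<in>A. (dens x (g1 x) + dens x (g2 x)) / 2 \<partial>completion M) = energy A g1" .
      show "(\<integral>\<^sup>+x\<in>A. (dens x (g1 x) + dens x (g2 x)) / 2 \<partial>completion M)
          \<le> (\<integral>\<^sup>+x\<in>A. dens x (gh x) \<partial>completion M)"
        unfolding mid using emid by (simp add: energy_def)
      have "energy A gh \<le> (\<integral>\<^sup>+x\<in>A. (dens x (g1 x) + dens x (g2 x)) / 2 \<partial>completion M)"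
        unfolding energy_def gh_def by (intro set_nn_integral_mono_fun dens_midpoint_le)
      then show "(\<integral>\<^sup>+x\<in>A. dens x (gh x) \<partial>completion M) < \<infinity>"
        unfolding mid using efin by (auto simp: energy_def intro: le_less_trans)
    qed measurable
    then have "AE x in M. (dens x (g1 x) + dens x (g2 x)) / 2 * indicator A x
        \<le> dens x (gh x) * indicator A x"
      by (simp add: AE_completion_iff)
    then show ?thesis using gfin
    proof eventually_elim
      case (elim x)
      show ?case
      proof (intro impI, rule ccontr)
        assume x: "x \<in> A" and ne: "g1 x \<noteq> g2 x"
        then have "dens x (gh x) < (dens x (g1 x) + dens x (g2 x)) / 2"
          unfolding gh_def using elim AO by (intro dens_midpoint_strict) auto
        with elim x show False by simp
      qed
    qed
  qed

  have trunc: "AE x in M. x \<in> A \<and> f1 x < c \<and> c < f2 x \<longrightarrow> g1 x = 0" for c :: real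
  proof -
    \<comment> \<open>The function \<open>w\<close> is \<open>max f1 (min (f1 + \<phi>) c)\<close>, written in a form that shows that \<open>w - f1\<close>
        vanishes
      off \<open>A\<close>.\<close>
    define \<eta> where "\<eta> x = min (\<phi> x) (max 0 (c - f1 x))" for x
    define w where "w x = f1 x + \<eta> x" for x
    define Ac where "Ac = A \<inter> {x \<in> space (completion M). F1 x < c \<and> c < F2 x}"
    define Ad where "Ad = A \<inter> {x \<in> space (completion M). F2 x \<le> c}"
    have Acm[measurable]: "Ac \<in> sets (completion M)" and Adm[measurable]: "Ad \<in> sets (completion M)"
      unfolding Ac_def Ad_def by measurable
    have Ac_iff: "x \<in> Ac \<longleftrightarrow> x \<in> A \<and> f1 x < c \<and> c < f2 x" for x using F AV by (auto simp: Ac_def)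
    have Ad_iff: "x \<in> Ad \<longleftrightarrow> x \<in> A \<and> f2 x \<le> c" for x using F AV by (auto simp: Ad_def)
    have c\<eta>: "weak_ug \<Omega> \<eta> (\<lambda>x. k x + g1 x)"
    proof (rule weak_ug_add[OF cphiO c1])
      fix x y
      have 1: "\<bar>min s s' - min t t'\<bar> \<le> \<bar>s - t\<bar> + \<bar>s' - t'\<bar>" for s s' t t' :: real
        unfolding min_def by auto
      have 2: "\<bar>max 0 (c - s) - max 0 (c - t)\<bar> \<le> \<bar>s - t\<bar>" for s t :: real
        unfolding max_def by auto
      show "\<bar>\<eta> x - \<eta> y\<bar> \<le> \<bar>\<phi> x - \<phi> y\<bar> + \<bar>f1 x - f1 y\<bar>"
        unfolding \<eta>_def by (rule order_trans[OF 1 add_left_mono[OF 2]])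
    qed
    have cw: "weak_ug \<Omega> w (\<lambda>x. g1 x + (k x + g1 x))" by (rule weak_ug_add[OF c1 c\<eta>]) (auto simp: w_def)
    have A_lt: "f1 x < f2 x" if "x \<in> A" for x using that by (simp add: A_def)
    have wAc: "w x = c" if "x \<in> Ac" for x using that phi_A[of x] by (auto simp: w_def \<eta>_def Ac_iff)
    have wAd: "w x = f2 x" if "x \<in> Ad" for x using that phi_A[of x] A_lt[of x]
      by (auto simp: w_def \<eta>_def Ad_iff)
    have wo: "w x = f1 x" if "x \<notin> Ac" "x \<notin> Ad" for x
    proof (cases "x \<in> A")
      case True
      then have "c \<le> f1 x" using that by (auto simp: Ac_iff Ad_iff)
      then show ?thesis using A_lt[OF True] phi_A[OF True] by (simp add: w_def \<eta>_def)
    next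
      case False
      then show ?thesis by (simp add: w_def \<eta>_def phi_nA)
    qed
    \<comment> \<open>The gradient of \<open>w\<close> is \<open>g2\<close> on \<open>Ad\<close>, \<open>0\<close> on \<open>Ac\<close>, and \<open>g1\<close> elsewhere; these replacements are
      made one after the other, starting from a crude upper gradient.\<close>
    have AcAd: "Ac \<inter> Ad = {}" by (auto simp: Ac_iff Ad_iff)
    obtain h1 where h1: "weak_ug \<Omega> w h1" "AE x in M. h1 x = (if x \<in> Ad then g2 x else g1 x + (k x
        + g1 x))"
      by (rule weak_ug_replace_AE[OF cw c2 Adm]) (auto simp: wAd)
    obtain h2 where h2: "weak_ug \<Omega> w h2" "AE x in M. h2 x = (if x \<in> Ac then 0 else h1 x)"
      by (rule weak_ug_replace_AE[OF h1(1) weak_ug_const[of \<Omega> c] Acm]) (auto simp: wAc)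
    have "- (Ac \<union> Ad) \<in> sets (completion M)" using sets.compl_sets[of "Ac \<union> Ad" "completion M"]
      by (simp add: Compl_eq_Diff_UNIV)
    then obtain h where h: "weak_ug \<Omega> w h" "AE x in M. h x = (if x \<in> - (Ac \<union> Ad) then g1 x else h2 x)"
      by (rule weak_ug_replace_AE[OF h2(1) c1]) (auto simp: wo)
    have h_eq: "AE x in M. h x = (if x \<in> Ac then 0 else if x \<in> Ad then g2 x else g1 x)"
      using h1(2) h2(2) h(2) by eventually_elim (use AcAd in auto)
    have h_eq1: "AE x in M. h x = (if x \<in> Ac then 0 else g1 x)"
      using h_eq g_eq by eventually_elim (auto simp: Ad_iff)
    have hm[measurable]: "h \<in> borel_measurable borel" using h(1) by (rule weak_ug_measurable)
    have le: "energy \<Omega> g1 \<le> energy \<Omega> h"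
      unfolding g1_def
    proof (rule minimizer_le_competitor[OF min1 V h(1) hfin vL])
      show "AE x in M. h x \<le> g1 x + g2 x" using h_eq by eventually_elim auto
      show "w \<in> borel_measurable (restrict_space (completion M) \<Omega>)" unfolding w_def \<eta>_def by measurable
      show "\<bar>w x\<bar> \<le> \<bar>f1 x\<bar> + \<bar>f2 x\<bar>" for x
        by (cases "x \<in> A") (auto simp: w_def \<eta>_def phi_A phi_nA dest: A_lt)
      show "w x = real_of_ereal (u1 x)" if "x \<notin> V" for x
      proof -
        have "x \<notin> A" using that AV by blast
        then show ?thesis by (simp add: w_def \<eta>_def f1_def phi_nA)
      qed
    qed
    note [measurable] = dens_measurable[OF gm(1)] dens_measurable[OF hm]
    have hle: "AE x in completion M. h x \<le> g1 x" using h_eq1 unfolding AE_completion_iff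
      by eventually_elim auto
    have "AE x in completion M. dens x (g1 x) * indicator \<Omega> x \<le> dens x (h x) * indicator \<Omega> x"
    proof (rule nn_integral_le_imp_AE_le)
      show "AE x in completion M. dens x (h x) * indicator \<Omega> x \<le> dens x (g1 x) * indicator \<Omega> x"
        using hle by eventually_elim (auto intro: mult_right_mono dens_mono)
      show "(\<integral>\<^sup>+x\<in>\<Omega>. dens x (g1 x) \<partial>completion M) \<le> (\<integral>\<^sup>+x\<in>\<Omega>. dens x (h x) \<partial>completion M)"
        using le by (simp add: energy_def)
      have "energy \<Omega> h \<le> energy \<Omega> g1"
        by (rule energy_mono_AE) (use hle[unfolded AE_completion_iff] in \<open>auto elim: eventually_mono\<close>)
      then show "(\<integral>\<^sup>+x\<in>\<Omega>. dens x (h x) \<partial>completion M) < \<infinity>" using fin1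
        by (auto simp: energy_def intro: le_less_trans)
    qed measurable
    then have "AE x in M. dens x (g1 x) * indicator \<Omega> x \<le> dens x (h x) * indicator \<Omega> x"
      by (simp add: AE_completion_iff)
    then show ?thesis using h_eq1
    proof eventually_elim
      case (elim x)
      show ?case
      proof
        assume x: "x \<in> A \<and> f1 x < c \<and> c < f2 x"
        then have "x \<in> Ac" "x \<in> \<Omega>" using AO by (auto simp: Ac_iff)
        then have "dens x (g1 x) \<le> 0" using elim by simp
        then show "g1 x = 0" by (simp add: dens_eq_0_iff)
      qed
    qed
  qed
  have g1_0: "AE x in M. x \<in> A \<longrightarrow> g1 x = 0"
  proof -
    have "AE x in M. \<forall>r\<in>\<rat>. x \<in> A \<and> f1 x < r \<and> r < f2 x \<longrightarrow> g1 x = 0"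
      by (subst AE_ball_countable) (auto intro: trunc countable_rat)
    then show ?thesis
    proof eventually_elim
      case (elim x)
      show ?case
      proof
        assume x: "x \<in> A"
        then obtain r where "r \<in> \<rat>" "f1 x < r" "r < f2 x" using Rats_dense_in_real[of "f1 x" "f2 x"]
          by (auto simp: A_def)
        then show "g1 x = 0" using elim x by blast
      qed
    qed
  qed

  have nAc: "- A \<in> sets (completion M)" using sets.compl_sets[OF A_meas]
    by (simp add: Compl_eq_Diff_UNIV)
  obtain k' where k': "weak_ug UNIV \<phi> k'" "AE x in M. k' x = (if x \<in> - A then 0 else k x)"
    by (rule weak_ug_replace_AE[OF cphi weak_ug_const[of UNIV 0] nAc]) (auto simp: phi_nA)
  have k'0: "AE x in M. k' x = 0"
    using k'(2) g1_0 g_eq by eventually_elim (use AV in \<open>auto simp: k_def\<close>)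
  have phiL: "(\<lambda>x. ereal (\<phi> x)) \<in> Lspace q M UNIV"
  proof (rule Lspace_extend_zero[OF \<Omega>b])
    show "(\<lambda>x. ereal (\<phi> x)) \<in> Lspace q M \<Omega>"
    proof (rule vL)
      show "\<bar>\<phi> x\<bar> \<le> \<bar>f1 x\<bar> + \<bar>f2 x\<bar>" for x by (cases "x \<in> A") (auto simp: phi_A phi_nA)
    qed measurable
  qed (use AO in \<open>auto intro!: phi_nA\<close>)
  have phi0: "AE x in M. \<phi> x = 0"
    by (rule zero_gradient_imp_zero[OF PI _ k'(1) k'0 phiL _ mu\<Omega>]) (use p AO in \<open>auto intro!: phi_nA\<close>)
  have "capacity q M ({x. \<phi> x \<noteq> 0} \<union> N) = 0"
    by (rule capacity_zero_intro[OF k'(1) k'0 phi0 avN N_AE])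
  moreover have "u2 x \<le> u1 x" if x: "x \<in> V - ({x. \<phi> x \<noteq> 0} \<union> N)" for x
  proof -
    have "x \<notin> A" using x phi_A[of x] by (auto simp: A_def)
    then have "f2 x \<le> f1 x" using x by (auto simp: A_def)
    then show ?thesis using x real_le[of x] VO by auto
  qed
  ultimately show ?thesis unfolding qe_in_def by blast
qed

end

theorem lemma8p3:
  fixes M :: "'a::complete_space measure"
    and \<Omega> \<Omega>' V :: "'a set"
    and p q Q \<alpha> \<beta> :: real
    and a b :: "'a \<Rightarrow> real"
    and u1 u2 :: "'a \<Rightarrow> ereal"
  assumes "doubling_measure M"
    and "dimension_exponent Q M"
    and "weak_Poincare q p M"
    and "1 < p" and "p < q" and "p < Q" and "q < Q * p / (Q - p)"
    and "a \<in> borel_measurable (completion M)" and "b \<in> borel_measurable (completion M)"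
    and "0 < \<alpha>"
    and "\<And>x. \<alpha> \<le> a x \<and> a x \<le> \<beta>" and "\<And>x. \<alpha> \<le> b x \<and> b x \<le> \<beta>"
    and "open \<Omega>" and "connected \<Omega>" and "\<Omega> \<noteq> {}" and "bounded \<Omega>"
    and "0 < emeasure M (- \<Omega>)"
    and "open V" and "open \<Omega>'"
    and "V \<subseteq> \<Omega>'" and "closure \<Omega>' \<subseteq> \<Omega>"
    and "pq_minimizer p q a b M \<Omega> u1" and "pq_minimizer p q a b M \<Omega> u2"
    and "qe_in q M (closure \<Omega>' - V) (\<lambda>x. u2 x \<le> u1 x)"
  shows "qe_in q M V (\<lambda>x. u2 x \<le> u1 x)"
proof -
  interpret double_phase M q p \<alpha> \<beta> a b \<Omega>
    by unfold_locales (use assms in auto)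
  obtain E0 where E0: "capacity q M E0 = 0" "\<And>x. x \<in> closure \<Omega>' - V - E0 \<Longrightarrow> u2 x \<le> u1 x"
    using assms(24) unfolding qe_in_def by blast
  have cl: "closure V \<subseteq> closure \<Omega>'" using assms(20) by (rule closure_mono)
  show ?thesis
  proof (rule minimizer_comparison[OF assms(3,17,18) _ assms(22,23) E0(1)])
    show "closure V \<subseteq> \<Omega>" using cl assms(21) by simp
    fix x assume "x \<in> frontier V - E0"
    then show "u2 x \<le> u1 x" using cl assms(18) by (intro E0(2)) (auto simp: frontier_def interior_open)
  qed
qed

end
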